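(* Let $\mathcal U=\{f\in \mathrm{End}^1_{\mu}(\mathbb T^2): C_\chi(f)>0\}$. Every $f\in\mathcal U$ is non-uniformly hyperbolic. Moreover, if $E=(e_{ij})$ is a $2\times 2$ integer matrix which is not a homothety and which satisfies $|\det E|/\gcd(e_{ij})>4$, then the intersection $[E]\cap\mathcal U$ is non-empty, and in fact it contains maps that are real analytically homotopic to $E$.
   Context: $\mathbb T^2=\mathbb R^2/\mathbb Z^2$ and $\mu$ is the Lebesgue (Haar) probability measure on $\mathbb T^2$. $\mathrm{End}^r_\mu(\mathbb T^2)$ is the set of $\mathcal C^r$ local diffeomorphisms of $\mathbb T^2$ that preserve $\mu$ and are not invertible. $T^1\mathbb T^2$ is the unit tangent bundle. For $f\in \mathrm{End}^1_\mu(\mathbb T^2)$, $n\ge 1$ and $(x,v)\in T^1\mathbb T^2$ put $$I(x,v;f^n)=\sum_{y\in f^{-n}(x)}\frac{\log\|(D_yf^n)^{-1}v\|}{|\det(D_yf^n)|},\qquad C_\chi(f)=\sup_{n\in\mathbb N}\frac1n\inf_{(x,v)\in T^1\mathbb T^2}I(x,v;f^n).$$ For $\mu$-a.e. $x$ the Lyapunov exponents $\chi^+(x)=\lim_{n\to\infty}\frac1n\log\|D_xf^n\|$ and $\chi^-(x)=\lim_{n\to\infty}\frac1n\log \mathrm m(D_xf^n)$ exist, where $\mathrm m(A)=\inf\{\|Av\|:\|v\|=1\}$ is the conorm. $f$ is non-uniformly hyperbolic if $\chi^-(x)<0<\chi^+(x)$ for $\mu$-a.e. $x$. An integer matrix $E$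 is identified with the induced linear endomorphism of $\mathbb T^2$; $[E]$ denotes the set of maps $g:\mathbb T^2\to\mathbb T^2$ for which there is a $\mathcal C^1$ homotopy between $g$ and $E$. A homothety is a matrix $k\cdot\mathrm{Id}$, $k\in\mathbb Z$. "Real analytically homotopic to $E$" means joined to $E$ by a real analytic homotopy. *)

theory Defs
  imports "HOL-Probability.Probability"
begin

section \<open>The torus\<close>

definition int_vec_rel :: "real^2 \<Rightarrow> real^2 \<Rightarrow> bool" where
  "int_vec_rel x y \<longleftrightarrow> (\<forall>i. x $ i - y $ i \<in> \<int>)"

lemma equivp_int_vec_rel: "equivp int_vec_rel"
proof (rule equivpI)
  show "reflp int_vec_rel"
    by (simp add: reflp_def int_vec_rel_def)
  show "symp int_vec_rel"
    unfolding symp_def int_vec_rel_def by (metis Ints_minus minus_diff_eq)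
  show "transp int_vec_rel"
    unfolding transp_def int_vec_rel_def
  proof (intro allI impI)
    fix x y z :: "real^2" and i :: 2
    assume "\<forall>i. x $ i - y $ i \<in> \<int>" "\<forall>i. y $ i - z $ i \<in> \<int>"
    then have "(x $ i - y $ i) + (y $ i - z $ i) \<in> \<int>"
      by (intro Ints_add) auto
    then show "x $ i - z $ i \<in> \<int>" by simp
  qed
qed

quotient_type torus = "real^2" / int_vec_rel
  by (rule equivp_int_vec_rel)

lift_definition proj :: "real^2 \<Rightarrow> torus" is "\<lambda>x. x" .

lemma proj_eq_iff: "proj x = proj y \<longleftrightarrow> (\<forall>i. x $ i - y $ i \<in> \<int>)"
  by transfer (simp add: int_vec_rel_def)

instantiation torus :: topological_space
begin

definition open_torus :: "torus set \<Rightarrow> bool" where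
  "open_torus U \<longleftrightarrow> open (proj -` U)"

instance
  by standard (auto simp: open_torus_def vimage_Union)

end

lemma continuous_on_proj: "continuous_on UNIV proj"
  by (simp add: continuous_on_open_vimage open_torus_def)

definition haar_torus :: "torus measure" where
  "haar_torus =
     distr (restrict_space lborel {x :: real^2. \<forall>i. 0 \<le> x $ i \<and> x $ i < 1}) borel proj"

lemma prob_space_haar_torus: "prob_space haar_torus"
proof -
  let ?Q = "{x :: real^2. \<forall>i. 0 \<le> x $ i \<and> x $ i < 1}"
  have proj: "proj \<in> borel_measurable (restrict_space lborel ?Q)"
    by (intro measurable_restrict_space1) (simp add: borel_measurable_continuous_onI continuous_on_proj)
  have Q: "?Q = (\<Inter>i. {x. 0 \<le> x $ i} \<inter> {x. x $ i < 1})"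
    by auto
  have Qm: "?Q \<in> sets lborel"
    unfolding Q by measurable
  have "emeasure lborel ?Q = 1"
  proof (rule antisym)
    have cart: "box 0 1 \<subseteq> ?Q" "?Q \<subseteq> cbox 0 (1 :: real^2)"
      by (auto simp: mem_box_cart less_imp_le)
    have "emeasure lborel (box 0 (1 :: real^2)) = 1" "emeasure lborel (cbox 0 (1 :: real^2)) = 1"
      by (auto simp: emeasure_lborel_box_eq emeasure_lborel_cbox_eq Basis_vec_def inner_axis
          intro!: prod.neutral)
    then show "emeasure lborel ?Q \<le> 1" "1 \<le> emeasure lborel ?Q"
      using emeasure_mono[OF cart(2), of lborel] emeasure_mono[OF cart(1) Qm] by auto
  qed
  then have "prob_space (restrict_space lborel ?Q)"
    using Qm by (intro prob_spaceI) (simp add: emeasure_restrict_space space_restrict_space)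
  then show ?thesis
    unfolding haar_torus_def using proj by (rule prob_space.prob_space_distr)
qed


section \<open>Regularity of maps into the torus\<close>

text \<open>
  On a set that is not open, such as the product of the closed unit interval and the plane,
  the derivative is taken relative to the set, so it is one-sided at the end points.
\<close>

definition C1_on :: "'a::euclidean_space set \<Rightarrow> ('a \<Rightarrow> 'b::euclidean_space) \<Rightarrow> bool" where
  "C1_on S F \<longleftrightarrow> (\<exists>F' :: 'a \<Rightarrow> 'a \<Rightarrow>\<^sub>L 'b.
     (\<forall>x\<in>S. (F has_derivative blinfun_apply (F' x)) (at x within S)) \<and> continuous_on S F')"

text \<open>
  Real analyticity in several variables: near each point \<open>a\<close> of \<open>S\<close> the function is, on \<open>S\<close>,
  the sum of a power series in the coordinates of \<open>y - a\<close>. The multi-indices are the functions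
  from \<open>Basis\<close> to \<open>nat\<close> (extensional, so that each occurs once).
\<close>

definition real_analytic_on ::
    "'a::euclidean_space set \<Rightarrow> ('a \<Rightarrow> 'b::euclidean_space) \<Rightarrow> bool" where
  "real_analytic_on S F \<longleftrightarrow> (\<forall>a\<in>S. \<exists>r>0. \<exists>c :: ('a \<Rightarrow> nat) \<Rightarrow> 'b. \<forall>y. y \<in> S \<longrightarrow> dist y a < r \<longrightarrow>
     ((\<lambda>\<alpha>. (\<Prod>b\<in>Basis. ((y - a) \<bullet> b) ^ \<alpha> b) *\<^sub>R c \<alpha>) has_sum F y)
       (Basis \<rightarrow>\<^sub>E UNIV))"

text \<open>
  The local inverses of \<^const>\<open>proj\<close> are the charts of the torus. A map into the torus has the
  regularity \<open>P\<close> if it has it in these charts, that is, if it has local lifts satisfying \<open>P\<close>.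
\<close>

definition lifts_locally ::
    "('a::euclidean_space set \<Rightarrow> ('a \<Rightarrow> real^2) \<Rightarrow> bool) \<Rightarrow> 'a set \<Rightarrow> ('a \<Rightarrow> torus) \<Rightarrow> bool" where
  "lifts_locally P S G \<longleftrightarrow> (\<forall>x\<in>S. \<exists>W F. open W \<and> x \<in> W \<and> P (S \<inter> W) F \<and>
     (\<forall>y\<in>S \<inter> W. G y = proj (F y)))"

definition torus_C1_on :: "torus set \<Rightarrow> (torus \<Rightarrow> torus) \<Rightarrow> bool" where
  "torus_C1_on U f \<longleftrightarrow> lifts_locally C1_on (proj -` U) (f \<circ> proj)"

definition C1_local_diffeo :: "(torus \<Rightarrow> torus) \<Rightarrow> bool" where
  "C1_local_diffeo f \<longleftrightarrow> (\<forall>p. \<exists>U g. open U \<and> p \<in> U \<and> open (f ` U) \<and>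
     homeomorphism U (f ` U) f g \<and> torus_C1_on U f \<and> torus_C1_on (f ` U) g)"

definition End1 :: "(torus \<Rightarrow> torus) set" where
  "End1 = {f. C1_local_diffeo f \<and> \<not> bij f \<and>
     f \<in> haar_torus \<rightarrow>\<^sub>M haar_torus \<and> distr haar_torus haar_torus f = haar_torus}"


section \<open>Derivatives and exponents\<close>

text \<open>
  Every tangent space of the torus is identified with the plane by means of \<^const>\<open>proj\<close>, and
  the unit tangent bundle with \<open>UNIV \<times> sphere 0 1\<close>.
\<close>

definition torus_has_derivative ::
    "(torus \<Rightarrow> torus) \<Rightarrow> torus \<Rightarrow> (real^2 \<Rightarrow> real^2) \<Rightarrow> bool" where
  "torus_has_derivative f p A \<longleftrightarrow> (\<exists>x F. p = proj x \<and>
     (\<forall>\<^sub>F y in nhds x. f (proj y) = proj (F y)) \<and> (F has_derivative A) (at x))"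

lemma torus_has_derivative_unique:
  assumes "torus_has_derivative f p A" "torus_has_derivative f p B"
  shows "A = B"
proof -
  obtain x F where x: "p = proj x" and F: "\<forall>\<^sub>F y in nhds x. f (proj y) = proj (F y)"
    and dF: "(F has_derivative A) (at x)"
    using assms(1) unfolding torus_has_derivative_def by blast
  obtain x' G where x': "p = proj x'" and G: "\<forall>\<^sub>F y in nhds x'. f (proj y) = proj (G y)"
    and dG: "(G has_derivative B) (at x')"
    using assms(2) unfolding torus_has_derivative_def by blast
  define m where "m = x' - x"
  have m: "proj (y + m) = proj y" for y
  proof -
    have "proj x' = proj x" using x x' by simp
    then show ?thesis by (simp add: m_def proj_eq_iff)
  qed
  define d where "d = (\<lambda>y. F y - G (y + m))"
  have dG': "((\<lambda>y. G (y + m)) has_derivative B) (at x)"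
  proof -
    have "((\<lambda>y. y + m) has_derivative (\<lambda>h. h)) (at x)"
      by (auto intro!: derivative_eq_intros)
    moreover have "(G has_derivative B) (at (x + m))"
      using dG by (simp add: m_def)
    ultimately show ?thesis
      by (rule has_derivative_compose)
  qed
  have dd: "(d has_derivative (\<lambda>h. A h - B h)) (at x)"
    unfolding d_def by (intro has_derivative_diff dF dG')
  have G': "\<forall>\<^sub>F y in nhds x. f (proj (y + m)) = proj (G (y + m))"
  proof -
    have "filterlim (\<lambda>y. y + m) (nhds (x + m)) (nhds x)"
      by (intro tendsto_intros filterlim_ident)
    then show ?thesis
      using G by (auto simp: m_def dest: eventually_compose_filterlim)
  qed
  have int: "\<forall>\<^sub>F y in nhds x. \<forall>i. d y $ i \<in> \<int>"
    using F G' by eventually_elim (simp add: m proj_eq_iff d_def)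
  have "isCont d x"
    using dd by (rule has_derivative_continuous)
  then have "\<forall>\<^sub>F y in nhds x. dist (d y) (d x) < 1"
    by (intro tendstoD) (auto simp: continuous_at tendsto_at_iff_tendsto_nhds)
  then have ev: "\<forall>\<^sub>F y in nhds x. d y = d x"
    using int
  proof eventually_elim
    case (elim y)
    have "d y $ i = d x $ i" for i
    proof -
      have "d y $ i - d x $ i \<in> \<int>"
        using elim(2) eventually_nhds_x_imp_x[OF int] by (intro Ints_diff) auto
      moreover have "\<bar>d y $ i - d x $ i\<bar> < 1"
        using elim(1) component_le_norm_cart[of "d y - d x" i] by (simp add: dist_norm)
      ultimately show ?thesis
        by (metis Ints_nonzero_abs_less1 eq_iff_diff_eq_0)
    qed
    then show ?case by (simp add: vec_eq_iff)
  qed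
  have "(d has_derivative (\<lambda>_. 0)) (at x)"
  proof -
    have "((\<lambda>_. d x) has_derivative (\<lambda>_. 0)) (at x)"
      by simp
    moreover have "\<forall>\<^sub>F y in at x. d x = d y"
      using ev by (auto simp: eventually_at_filter elim: eventually_mono)
    ultimately show ?thesis
      by (rule has_derivative_transform_eventually) simp_all
  qed
  with dd have "(\<lambda>h. A h - B h) = (\<lambda>_. 0)"
    by (rule has_derivative_unique)
  then show ?thesis
    by (metis eq_iff_diff_eq_0 ext)
qed

definition torus_deriv :: "(torus \<Rightarrow> torus) \<Rightarrow> torus \<Rightarrow> real^2 \<Rightarrow> real^2" where
  "torus_deriv f p = (THE A. torus_has_derivative f p A)"

definition I_chi :: "(torus \<Rightarrow> torus) \<Rightarrow> nat \<Rightarrow> torus \<Rightarrow> real^2 \<Rightarrow> real" where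
  "I_chi f n x v = (\<Sum>y\<in>(f ^^ n) -` {x}.
     ln (norm (inv (torus_deriv (f ^^ n) y) v)) / \<bar>det (matrix (torus_deriv (f ^^ n) y))\<bar>)"

definition C_chi :: "(torus \<Rightarrow> torus) \<Rightarrow> ereal" where
  "C_chi f = (SUP n\<in>{1..}. ereal (1 / real n) *
     (INF (x, v)\<in>UNIV \<times> sphere 0 1. ereal (I_chi f n x v)))"

definition conorm :: "(real^2 \<Rightarrow> real^2) \<Rightarrow> real" where
  "conorm A = (INF v\<in>sphere 0 1. norm (A v))"

definition nonuniformly_hyperbolic :: "(torus \<Rightarrow> torus) \<Rightarrow> bool" where
  "nonuniformly_hyperbolic f \<longleftrightarrow> (AE x in haar_torus. \<exists>\<chi>\<^sub>m \<chi>\<^sub>p.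
     (\<lambda>n. 1 / real n * ln (conorm (torus_deriv (f ^^ n) x))) \<longlonglongrightarrow> \<chi>\<^sub>m \<and>
     (\<lambda>n. 1 / real n * ln (onorm (torus_deriv (f ^^ n) x))) \<longlonglongrightarrow> \<chi>\<^sub>p \<and>
     \<chi>\<^sub>m < 0 \<and> 0 < \<chi>\<^sub>p)"

definition U_chi :: "(torus \<Rightarrow> torus) set" where
  "U_chi = {f \<in> End1. C_chi f > 0}"


section \<open>Linear endomorphisms and homotopies\<close>

lift_definition toral_end :: "int^2^2 \<Rightarrow> torus \<Rightarrow> torus" is
  "\<lambda>E x. map_matrix real_of_int E *v x"
proof -
  fix E :: "int^2^2" and x y :: "real^2"
  assume *: "int_vec_rel x y"
  have "(map_matrix real_of_int E *v x) $ i - (map_matrix real_of_int E *v y) $ i \<in> \<int>" for i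
  proof -
    have "(map_matrix real_of_int E *v x) $ i - (map_matrix real_of_int E *v y) $ i
      = (\<Sum>j\<in>UNIV. real_of_int (E $ i $ j) * (x $ j - y $ j))"
      by (simp add: matrix_vector_mult_def sum_subtractf right_diff_distrib)
    also have "\<dots> \<in> \<int>"
      using * by (intro Ints_sum Ints_mult) (auto simp: int_vec_rel_def)
    finally show ?thesis .
  qed
  then show "int_vec_rel (map_matrix real_of_int E *v x) (map_matrix real_of_int E *v y)"
    by (simp add: int_vec_rel_def)
qed

definition torus_homotopic ::
    "((real \<times> (real^2)) set \<Rightarrow> (real \<times> (real^2) \<Rightarrow> real^2) \<Rightarrow> bool) \<Rightarrow>
     (torus \<Rightarrow> torus) \<Rightarrow> (torus \<Rightarrow> torus) \<Rightarrow> bool" where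
  "torus_homotopic P g h \<longleftrightarrow> (\<exists>H :: real \<Rightarrow> torus \<Rightarrow> torus.
     lifts_locally P ({0..1} \<times> UNIV) (\<lambda>(t, x). H t (proj x)) \<and> H 0 = g \<and> H 1 = h)"

definition C1_homotopy_class :: "int^2^2 \<Rightarrow> (torus \<Rightarrow> torus) set" where
  "C1_homotopy_class E = {g. torus_homotopic C1_on g (toral_end E)}"

definition homothety :: "int^2^2 \<Rightarrow> bool" where
  "homothety E \<longleftrightarrow> (\<exists>k. E = mat k)"

end

theory Submission
  imports Defs
begin

text \<open>
  Let \<open>f\<close> preserve \<open>\<mu>\<close>. The exponents exist almost everywhere by the subadditive ergodic theorem, applied
  to \<open>ln (onorm D\<^sub>xf\<^sup>n)\<close> and \<open>- ln (conorm D\<^sub>xf\<^sup>n)\<close>. By the area formula the weights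
  \<open>1 / \<bar>det D\<^sub>yf\<bar>\<close> of the preimages of almost every point add up to 1; hence \<open>\<bar>det Df\<bar> \<ge> 1\<close> and the
  sum of the exponents is nonnegative. If \<open>I(x, v; f\<^sup>n) \<ge> c > 0\<close> for some \<open>n\<close>, then
  \<open>I(x, v; f\<^sup>n\<^sup>k) \<ge> k c\<close>, and integrating this over the invariant set where \<open>\<chi>\<^sup>-\<close> is nonnegative
  shows that this set is null, since the integral of \<open>- ln (conorm Df\<^sup>n\<^sup>k) / (n k)\<close> over it converges to
  a nonpositive number.

  For the second part take \<open>f = E \<circ> h\<close> with the shear \<open>h x = x + t sin (2 \<pi> l\<cdot>x) / (2 \<pi>) u\<close>, where
  \<open>l = (1, k)\<close> and \<open>u = (-k, 1)\<close>. For a suitable integer \<open>k\<close> the values of \<open>l\<close> on the preimages of a point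
  are the translates by multiples of \<open>1 / \<tau>\<close>, \<open>\<tau> = \<bar>det E\<bar> / gcd\<close>, all equally often, and \<open>u\<close> is not an
  eigenvector of \<open>E\<close>. Call \<open>v\<close> good if \<open>E\<^sup>-\<^sup>1 v\<close> is transversal to \<open>u\<close>. Except at a fraction of at most
  \<open>2 / \<tau>\<close> of the preimages, \<open>(D\<^sub>yf)\<^sup>-\<^sup>1 v\<close> is good, with norm of order at least \<open>t\<close> if \<open>v\<close> is good and at
  least 1 otherwise; at the exceptional preimages these orders are 1 and \<open>1 / t\<close>. Hence
  \<open>I(x, v; f\<^sup>n)\<close> grows at least like \<open>n ((1 - 4 / \<tau>) ln t - O(1))\<close>, which is positive for large \<open>t\<close>
  because \<open>\<tau> > 4\<close>.
\<close>

section \<open>A subadditive ergodic theorem\<close>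

text \<open>\<open>f\<close> need not be ergodic, so the exponents remain functions of the point and
  the sign of \<open>\<chi>\<close> must be excluded on a set. That set is invariant in both
  directions, so it contains every preimage of its points, and the area formula can be restricted to
  it. The bounds on iterates hold only almost everywhere, because the weights add up to 1 only
  there.

  The ergodic theorem is proved for cocycles that change boundedly when the first step of an orbit
  is dropped, which compactness supplies; then all averages are bounded and greedy cutting of orbits
  suffices.

  The bound 4 comes from an account kept for vectors: a vector that is not good carries a debt
  \<open>ln t\<close>. Relative to this account an ordinary preimage gains \<open>ln t\<close> and
  an exceptional one loses \<open>ln t\<close>, whatever the vector was. With a fraction
  \<open>2 / \<tau>\<close> of exceptions, the 2 being the number of times a level of the cosine is
  met in a period, the mean gain is \<open>(1 - 4 / \<tau>) * ln t\<close>.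

  Homotheties are excluded because every direction is an eigendirection for them: inverse branches
  would then send the strongly sheared direction \<open>u\<close> to itself, where shearing has no
  effect.\<close>

locale measure_preserving_map = prob_space M for M :: "'a measure" +
  fixes T :: "'a \<Rightarrow> 'a"
  assumes space_UNIV: "space M = UNIV"
    and T_measurable [measurable]: "T \<in> M \<rightarrow>\<^sub>M M"
    and T_invariant: "distr M M T = M"
begin

lemma funpow_measurable [measurable]: "T ^^ n \<in> M \<rightarrow>\<^sub>M M"
  by (induction n) (auto intro: measurable_comp simp: id_def[symmetric])

lemma distr_funpow: "distr M M (T ^^ n) = M"
proof (induction n)
  case 0
  show ?case by (simp add: id_def distr_id)
next
  case (Suc n)
  have "distr M M (T \<circ> T ^^ n) = distr (distr M M (T ^^ n)) M T"
    by (rule distr_distr[symmetric]) auto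
  then show ?case using Suc T_invariant by (simp add: o_def)
qed

lemma integral_funpow:
  fixes \<phi> :: "'a \<Rightarrow> real"
  assumes [measurable]: "\<phi> \<in> borel_measurable M"
  shows "(\<integral>x. \<phi> ((T ^^ n) x) \<partial>M) = (\<integral>x. \<phi> x \<partial>M)"
  using integral_distr[of "T ^^ n" M M \<phi>] distr_funpow[of n] by simp

lemma bounded_integrable:
  fixes \<phi> :: "'a \<Rightarrow> real"
  assumes "\<phi> \<in> borel_measurable M" "\<And>x. \<bar>\<phi> x\<bar> \<le> C"
  shows "integrable M \<phi>"
  by (rule integrable_const_bound[of _ C]) (use assms in auto)

end

text \<open>\<open>g_shift\<close> takes the place of the usual integrability of \<open>g 1\<close>.
  It holds for derivative cocycles when the derivative and its inverse are bounded; it bounds all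
  averages by \<open>C\<close> and makes \<open>lower\<close> invariant at every point, not only
  almost everywhere.\<close>

locale bounded_subadditive = measure_preserving_map M T for M :: "'a measure" and T +
  fixes g :: "nat \<Rightarrow> 'a \<Rightarrow> real" and C :: real
  assumes g_measurable [measurable]: "g n \<in> borel_measurable M"
    and g_0: "g 0 x = 0"
    and g_add: "g (n + m) x \<le> g n x + g m ((T ^^ n) x)"
    and g_shift: "\<bar>g (Suc n) x - g n (T x)\<bar> \<le> C"
begin

lemma C_nonneg: "0 \<le> C"
  using g_shift[of 0 undefined] by linarith

lemma g_bound: "\<bar>g n x\<bar> \<le> C * n"
proof (induction n arbitrary: x)
  case 0
  then show ?case by (simp add: g_0)
next
  case (Suc n)
  from Suc[of "T x"] g_shift[of n x] show ?case by (simp add: algebra_simps abs_le_iff)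
qed

lemma avg_bound: "\<bar>g n x / n\<bar> \<le> C"
  using g_bound[of n x] C_nonneg by (cases "n = 0") (auto simp: field_simps)

definition lower :: "'a \<Rightarrow> real" where
  "lower x = real_of_ereal (liminf (\<lambda>n. ereal (g n x / n)))"

definition upper :: "'a \<Rightarrow> real" where
  "upper x = real_of_ereal (limsup (\<lambda>n. ereal (g n x / n)))"

lemma lower_measurable [measurable]: "lower \<in> borel_measurable M"
  unfolding lower_def by measurable

lemma upper_measurable [measurable]: "upper \<in> borel_measurable M"
  unfolding upper_def by measurable

lemma liminf_bounds: "ereal (- C) \<le> liminf (\<lambda>n. ereal (g n x / n))"
    "limsup (\<lambda>n. ereal (g n x / n)) \<le> ereal C"
    "liminf (\<lambda>n. ereal (g n x / n)) \<le> limsup (\<lambda>n. ereal (g n x / n))"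
proof -
  have b: "- C \<le> g n x / n" "g n x / n \<le> C" for n
    using avg_bound[of n x] by (auto simp only: abs_le_iff)
  show "ereal (- C) \<le> liminf (\<lambda>n. ereal (g n x / n))"
    by (rule Liminf_bounded) (use b in auto)
  show "limsup (\<lambda>n. ereal (g n x / n)) \<le> ereal C"
    by (rule Limsup_bounded) (use b in auto)
  show "liminf (\<lambda>n. ereal (g n x / n)) \<le> limsup (\<lambda>n. ereal (g n x / n))"
    by (rule Liminf_le_Limsup) auto
qed

lemma ereal_lower: "ereal (lower x) = liminf (\<lambda>n. ereal (g n x / n))"
  unfolding lower_def using liminf_bounds[of x]
  by (cases "liminf (\<lambda>n. ereal (g n x / n))") auto

lemma ereal_upper: "ereal (upper x) = limsup (\<lambda>n. ereal (g n x / n))"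
  unfolding upper_def using liminf_bounds[of x]
  by (cases "limsup (\<lambda>n. ereal (g n x / n))") auto

lemma lower_bound: "\<bar>lower x\<bar> \<le> C" and upper_bound: "\<bar>upper x\<bar> \<le> C" and lower_le_upper: "lower x \<le> upper x"
proof -
  have "- C \<le> lower x" "upper x \<le> C" "lower x \<le> upper x"
    using liminf_bounds[of x] by (simp_all flip: ereal_lower ereal_upper)
  then show "\<bar>lower x\<bar> \<le> C" "\<bar>upper x\<bar> \<le> C" "lower x \<le> upper x" by auto
qed

text \<open>By \<open>g_shift\<close> and \<open>avg_bound\<close>, the average of length
  \<open>n + 1\<close> at \<open>x\<close> and that of length \<open>n\<close> at \<open>T x\<close>
  differ by at most \<open>2 * C / Suc n\<close>.\<close>

lemma lower_invariant: "lower (T x) = lower x"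
proof -
  let ?a = "\<lambda>n. ereal (g n x / n)" and ?b = "\<lambda>n. ereal (g n (T x) / n)"
  define u where "u n = g (Suc n) x / Suc n - g n (T x) / n" for n
  have u: "u \<longlonglongrightarrow> 0"
  proof (rule Lim_null_comparison)
    show "\<forall>\<^sub>F n in sequentially. norm (u n) \<le> 2 * C / Suc n"
      using eventually_gt_at_top[of 0]
    proof eventually_elim
      case (elim n)
      have "u n = (g (Suc n) x - g n (T x)) / Suc n - (g n (T x) / n) / Suc n"
        using elim by (simp add: u_def divide_simps) (simp add: algebra_simps)
      also have "\<bar>\<dots>\<bar> \<le> \<bar>(g (Suc n) x - g n (T x)) / Suc n\<bar> + \<bar>(g n (T x) / n) / Suc n\<bar>"
        by (rule abs_triangle_ineq4)
      also have "\<dots> = \<bar>g (Suc n) x - g n (T x)\<bar> / Suc n + \<bar>g n (T x) / n\<bar> / Suc n"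
        by (simp only: abs_divide abs_of_nat)
      also have "\<dots> \<le> C / Suc n + C / Suc n"
        using g_shift[of n x] avg_bound[of n "T x"]
        by (intro add_mono divide_right_mono) auto
      finally show ?case by simp
    qed
    show "(\<lambda>n. 2 * C / Suc n) \<longlonglongrightarrow> 0"
      using tendsto_mult_right_zero[OF LIMSEQ_inverse_real_of_nat, of "2 * C"] by (simp add: divide_inverse)
  qed
  then have "(\<lambda>n. ereal (u n)) \<longlonglongrightarrow> 0"
    by (simp add: zero_ereal_def)
  then have "liminf (\<lambda>n. ereal (u n) + ?b n) = 0 + liminf ?b"
    by (rule ereal_liminf_lim_add) auto
  moreover have "(\<lambda>n. ereal (u n) + ?b n) = (\<lambda>n. ?a (Suc n))"
    by (auto simp: u_def)
  moreover have "liminf (\<lambda>n. ?a (Suc n)) = liminf ?a"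
    using liminf_shift[of ?a] by simp
  ultimately have "liminf ?a = liminf ?b" by simp
  then show ?thesis by (simp add: lower_def)
qed

lemma lower_invariant_funpow: "lower ((T ^^ n) x) = lower x"
  by (induction n) (auto simp: lower_invariant)

lemma ex_avg_le_lower:
  assumes "\<epsilon> > 0"
  shows "\<exists>n\<ge>1. g n x \<le> n * (lower x + \<epsilon>)"
proof (rule ccontr)
  assume "\<not> ?thesis"
  then have "n * (lower x + \<epsilon>) < g n x" if "n \<ge> 1" for n
    using that by (meson not_le)
  then have "g n x / n > lower x + \<epsilon>" if "n \<ge> 1" for n
    using that by (simp add: pos_less_divide_eq mult.commute)
  then have "\<forall>\<^sub>F n in sequentially. ereal (lower x + \<epsilon>) \<le> ereal (g n x / n)"
    by (intro eventually_mono[OF eventually_ge_at_top[of 1]]) (auto intro: less_imp_le)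
  then have "ereal (lower x + \<epsilon>) \<le> liminf (\<lambda>n. ereal (g n x / n))"
    by (rule Liminf_bounded)
  then show False using assms by (simp flip: ereal_lower)
qed

definition slow :: "real \<Rightarrow> nat \<Rightarrow> 'a set" where
  "slow \<epsilon> N = {x. \<forall>l\<in>{1..N}. l * (lower x + \<epsilon>) < g l x}"

lemma slow_sets [measurable]: "slow \<epsilon> N \<in> sets M"
proof -
  have "slow \<epsilon> N = {x \<in> space M. \<forall>l\<in>{1..N}. l * (lower x + \<epsilon>) < g l x}"
    by (simp add: slow_def space_UNIV)
  also have "\<dots> \<in> sets M" by measurable
  finally show ?thesis .
qed

text \<open>The sets decrease in \<open>N\<close>, and by \<open>ex_avg_le_lower\<close> no point
  lies in all of them.\<close>

lemma measure_slow_tendsto: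
  assumes "\<epsilon> > 0"
  shows "(\<lambda>N. measure M (slow \<epsilon> N)) \<longlonglongrightarrow> 0"
proof -
  have "(\<Inter>N. slow \<epsilon> N) = {}"
  proof -
    have "x \<notin> (\<Inter>N. slow \<epsilon> N)" for x
    proof -
      obtain n where "n \<ge> 1" "g n x \<le> n * (lower x + \<epsilon>)"
        using ex_avg_le_lower[OF assms] by blast
      then have "x \<notin> slow \<epsilon> n"
        unfolding slow_def by (auto simp: not_less)
      then show ?thesis by blast
    qed
    then show ?thesis by blast
  qed
  moreover have "(\<lambda>N. measure M (slow \<epsilon> N)) \<longlonglongrightarrow> measure M (\<Inter>N. slow \<epsilon> N)"
  proof (rule finite_Lim_measure_decseq)
    show "range (slow \<epsilon>) \<subseteq> sets M" using slow_sets by blast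
  qed (auto simp: decseq_def slow_def)
  ultimately show ?thesis by simp
qed

text \<open>Cut the orbit segment greedily into blocks along which the average is nearly \<open>lower\<close>;
  only visits to \<open>slow \<epsilon> N\<close> and the last \<open>N\<close> times escape the blocks.\<close>

lemma g_le_lower:
  assumes "\<epsilon> > 0"
  shows "g n x \<le> n * (lower x + \<epsilon>) + 2 * C * ((\<Sum>k<n. indicat_real (slow \<epsilon> N) ((T ^^ k) x)) + N)"
proof (induction n arbitrary: x rule: less_induct)
  case (less n)
  let ?B = "slow \<epsilon> N" and ?S = "\<lambda>n x. (\<Sum>k<n. indicat_real (slow \<epsilon> N) ((T ^^ k) x)) :: real"
  have low: "lower x \<ge> - C" using lower_bound[of x] by auto
  have S_nonneg: "?S n x \<ge> 0" by (intro sum_nonneg) auto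
  have S_split: "?S (a + b) x = ?S a x + ?S b ((T ^^ a) x)" for a b
    by (induction b) (auto simp: funpow_add add.commute)
  consider "n = 0" | "n > 0" "x \<in> ?B" | "n > 0" "x \<notin> ?B" by auto
  then show ?case
  proof cases
    case 1
    then show ?thesis using C_nonneg by (simp add: g_0)
  next
    case 2
    then obtain m where m: "n = Suc m" by (cases n) auto
    \<comment> \<open>A slow time costs at most \<open>C\<close>, while the share
      \<open>lower x + \<epsilon>\<close> credited to it may be close to \<open>- C\<close>; hence
      the price \<open>2 * C\<close> per visit.\<close>
    have "g n x \<le> g m (T x) + C"
      using g_shift[of m x] m by auto
    also have "g m (T x) \<le> m * (lower (T x) + \<epsilon>) + 2 * C * (?S m (T x) + N)"
      using less[of m "T x"] m by auto
    also have "?S m (T x) = ?S n x - 1"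
      using S_split[of 1 m] m 2 by auto
    finally have "g n x \<le> m * (lower x + \<epsilon>) + 2 * C * (?S n x - 1 + N) + C"
      by (simp add: lower_invariant)
    moreover have "n * (lower x + \<epsilon>) = m * (lower x + \<epsilon>) + (lower x + \<epsilon>)"
      using m by (simp add: algebra_simps)
    ultimately show ?thesis using low assms by (simp add: algebra_simps)
  next
    case 3
    then obtain l where l: "1 \<le> l" "l \<le> N" "g l x \<le> l * (lower x + \<epsilon>)"
      by (auto simp: slow_def not_less)
    show ?thesis
    proof (cases "l \<le> n")
      case True
      then obtain m where m: "n = l + m" using le_Suc_ex by blast
      have "g n x \<le> g l x + g m ((T ^^ l) x)"
        using g_add m by auto
      also have "g m ((T ^^ l) x) \<le> m * (lower ((T ^^ l) x) + \<epsilon>) + 2 * C * (?S m ((T ^^ l) x) + N)"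
        by (rule less) (use m l in auto)
      also have "?S m ((T ^^ l) x) \<le> ?S n x"
        using S_split[of l m] m sum_nonneg[of "{..<l}" "\<lambda>k. indicat_real ?B ((T ^^ k) x) :: real"] by auto
      finally have "g n x \<le> g l x + (m * (lower x + \<epsilon>) + 2 * C * (?S n x + N))"
        using C_nonneg by (simp add: lower_invariant_funpow mult_left_mono)
      then show ?thesis using l(3) m by (simp add: algebra_simps)
    next
      case False
      \<comment> \<open>Here the block overshoots the end of the segment, so
        \<open>n < l \<le> N\<close>, and the crude bound is off by at most
        \<open>2 * C * N\<close>.\<close>
      have "g n x \<le> C * n" using g_bound[of n x] by auto
      also have "\<dots> = n * (- C) + 2 * C * n" by (simp add: algebra_simps)
      also have "\<dots> \<le> n * (lower x + \<epsilon>) + 2 * C * (?S n x + N)"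
        using low assms C_nonneg False l S_nonneg
        by (intro add_mono mult_left_mono) auto
      finally show ?thesis .
    qed
  qed
qed

lemma integrable_lower [simp]: "integrable M lower"
  by (rule bounded_integrable[OF _ lower_bound]) auto

lemma integrable_upper [simp]: "integrable M upper"
  by (rule bounded_integrable[OF _ upper_bound]) auto

text \<open>Integrate \<open>g_le_lower\<close>: by invariance each visit term contributes
  \<open>measure M (slow \<epsilon> N)\<close>. Divide by \<open>n\<close>, then let
  \<open>n\<close> and afterwards \<open>N\<close> tend to infinity.\<close>

lemma integral_lower_ge:
  assumes \<gamma>: "\<And>n. real n * \<gamma> \<le> (\<integral>x. g n x \<partial>M)"
  shows "\<gamma> \<le> (\<integral>x. lower x \<partial>M)"
proof (rule field_le_epsilon)
  fix \<epsilon> :: real assume \<epsilon>: "\<epsilon> > 0"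
  let ?B = "slow \<epsilon>"
  have step: "\<gamma> \<le> (\<integral>x. lower x \<partial>M) + \<epsilon> + 2 * C * measure M (?B N)" for N
  proof (rule LIMSEQ_le_const)
    show "(\<lambda>n. (\<integral>x. lower x \<partial>M) + \<epsilon> + 2 * C * measure M (?B N) + 2 * C * N / n)
        \<longlonglongrightarrow> (\<integral>x. lower x \<partial>M) + \<epsilon> + 2 * C * measure M (?B N)"
      by (rule tendsto_eq_intros refl lim_const_over_n)+ simp
    have "\<gamma> \<le> (\<integral>x. lower x \<partial>M) + \<epsilon> + 2 * C * measure M (?B N) + 2 * C * N / n" if n: "n > 0" for n :: nat
    proof -
      have int: "integrable M (\<lambda>x. indicat_real (?B N) ((T ^^ k) x) :: real)" for k
        by (rule bounded_integrable[of _ 1]) (auto simp: indicator_def)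
      have ind: "(\<integral>x. indicat_real (?B N) ((T ^^ k) x) \<partial>M) = measure M (?B N)" for k
        by (subst integral_funpow[of "indicat_real (?B N)"]) auto
      have "real n * \<gamma> \<le> (\<integral>x. g n x \<partial>M)" by (rule \<gamma>)
      also have "\<dots> \<le> (\<integral>x. n * (lower x + \<epsilon>) + 2 * C * ((\<Sum>k<n. indicat_real (?B N) ((T ^^ k) x)) + N) \<partial>M)"
        by (intro integral_mono g_le_lower[OF \<epsilon>] bounded_integrable[OF _ g_bound]
            integrable_add integrable_mult_right integrable_sum int) (auto simp: int)
      also have "\<dots> = n * ((\<integral>x. lower x \<partial>M) + \<epsilon>) + 2 * C * (n * measure M (?B N) + N)"
        using int by (simp add: ind prob_space)
      finally show ?thesis using n by (simp add: field_simps)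
    qed
    then show "\<exists>N0. \<forall>n\<ge>N0. \<gamma> \<le> (\<integral>x. lower x \<partial>M) + \<epsilon> + 2 * C * measure M (?B N) + 2 * C * N / real n"
      by (intro exI[of _ 1]) auto
  qed
  show "\<gamma> \<le> (\<integral>x. lower x \<partial>M) + \<epsilon>"
  proof (rule LIMSEQ_le_const)
    show "(\<lambda>N. (\<integral>x. lower x \<partial>M) + \<epsilon> + 2 * C * measure M (?B N)) \<longlonglongrightarrow> (\<integral>x. lower x \<partial>M) + \<epsilon>"
      by (rule tendsto_eq_intros refl measure_slow_tendsto[OF \<epsilon>])+ simp
  qed (use step in auto)
qed

lemma upper_leI:
  assumes "\<forall>\<^sub>F n in sequentially. g n x / n \<le> c"
  shows "upper x \<le> c"
proof -
  have "limsup (\<lambda>n. ereal (g n x / n)) \<le> ereal c"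
    by (rule Limsup_bounded) (use assms in simp)
  then show ?thesis by (simp flip: ereal_upper)
qed

end

context measure_preserving_map
begin

text \<open>Half of Birkhoff's theorem. Minus the visit count is additive with integrals exactly
  \<open>- n * measure M A\<close>, so \<open>integral_lower_ge\<close> applies to it;
  \<open>b\<close> is minus its \<open>lower\<close>, that is, the upper visit frequency.\<close>

lemma visit_frequency_bound:
  assumes A [measurable]: "A \<in> sets M"
  obtains b :: "'a \<Rightarrow> real" where "integrable M b" "(\<integral>x. b x \<partial>M) \<le> measure M A"
    "\<And>x \<epsilon>. \<epsilon> > 0 \<Longrightarrow> \<forall>\<^sub>F n in sequentially. (\<Sum>k<n. indicat_real A ((T ^^ k) x)) / n \<le> b x + \<epsilon>"
proof -
  define g :: "nat \<Rightarrow> 'a \<Rightarrow> real" where "g n x = - (\<Sum>k<n. indicat_real A ((T ^^ k) x))" for n x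
  have split: "g (a + b) x = g a x + g b ((T ^^ a) x)" for a b x
    unfolding g_def by (induction b) (auto simp: funpow_add add.commute)
  interpret bounded_subadditive M T g 1
  proof unfold_locales
    show "\<bar>g (Suc n) x - g n (T x)\<bar> \<le> 1" for n x
      using split[of 1 n x] by (simp add: g_def)
  next
    show "g (n + m) x \<le> g n x + g m ((T ^^ n) x)" for n m x
      by (simp add: split)
  next
    show "g n \<in> borel_measurable M" for n
      unfolding g_def by measurable
  qed (auto simp: g_def)
  have "(\<integral>x. g n x \<partial>M) = real n * (- measure M A)" for n
  proof -
    have int: "integrable M (\<lambda>x. indicat_real A ((T ^^ k) x) :: real)" for k
      by (rule bounded_integrable[of _ 1]) (auto simp: indicator_def)
    have ind: "(\<integral>x. indicat_real A ((T ^^ k) x) \<partial>M) = measure M A" for k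
      by (subst integral_funpow[of "indicat_real A"]) auto
    show ?thesis using int by (simp add: g_def ind)
  qed
  then have "- measure M A \<le> (\<integral>x. lower x \<partial>M)"
    by (intro integral_lower_ge) simp
  then have "(\<integral>x. - lower x \<partial>M) \<le> measure M A" by simp
  moreover have "\<forall>\<^sub>F n in sequentially. (\<Sum>k<n. indicat_real A ((T ^^ k) x)) / n \<le> - lower x + \<epsilon>"
    if "\<epsilon> > 0" for x \<epsilon>
  proof -
    have "liminf (\<lambda>n. ereal (g n x / n)) > ereal (lower x - \<epsilon>)"
      using that by (simp flip: ereal_lower)
    then have "\<forall>\<^sub>F n in sequentially. ereal (lower x - \<epsilon>) < ereal (g n x / n)"
      by (rule less_LiminfD)
    then show ?thesis by eventually_elim (simp add: g_def)
  qed
  ultimately show ?thesis by (intro that[of "\<lambda>x. - lower x"]) auto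
qed

end

text \<open>In \<open>g_le_lower\<close> the frequency of slow times is replaced by its bound
  \<open>b\<close>, whose integral is small. So \<open>upper\<close> exceeds \<open>lower\<close> by
  at most a function of arbitrarily small integral, and the two agree almost everywhere.\<close>

theorem (in bounded_subadditive) AE_tendsto_lower:
  "AE x in M. (\<lambda>n. g n x / n) \<longlonglongrightarrow> lower x"
proof -
  have le: "(\<integral>x. upper x \<partial>M) \<le> (\<integral>x. lower x \<partial>M) + \<epsilon>" if \<epsilon>: "\<epsilon> > 0" for \<epsilon>
  proof (rule LIMSEQ_le_const)
    show "(\<lambda>N. (\<integral>x. lower x \<partial>M) + \<epsilon> + 2 * C * measure M (slow \<epsilon> N)) \<longlonglongrightarrow> (\<integral>x. lower x \<partial>M) + \<epsilon>"
      by (rule tendsto_eq_intros refl measure_slow_tendsto[OF \<epsilon>])+ simp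
    have "(\<integral>x. upper x \<partial>M) \<le> (\<integral>x. lower x \<partial>M) + \<epsilon> + 2 * C * measure M (slow \<epsilon> N)" for N
    proof -
      obtain b where b: "integrable M b" "(\<integral>x. b x \<partial>M) \<le> measure M (slow \<epsilon> N)"
        "\<And>x \<delta>. \<delta> > 0 \<Longrightarrow> \<forall>\<^sub>F n in sequentially. (\<Sum>k<n. indicat_real (slow \<epsilon> N) ((T ^^ k) x)) / n \<le> b x + \<delta>"
        using visit_frequency_bound[OF slow_sets] by metis
      have "upper x \<le> lower x + \<epsilon> + 2 * C * b x" for x
      proof (rule field_le_epsilon)
        fix \<delta> :: real assume "\<delta> > 0"
        \<comment> \<open>Both \<open>N / n\<close> and the error in \<open>b\<close> are kept below
          \<open>\<eta>\<close>, so \<open>4 * C * \<eta> \<le> \<delta>\<close> suffices; the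
          summand 1 covers \<open>C = 0\<close>.\<close>
        define \<eta> where "\<eta> = \<delta> / (2 * C + 1) / 2"
        have \<eta>: "\<eta> > 0" "4 * C * \<eta> \<le> \<delta>"
          using \<open>\<delta> > 0\<close> C_nonneg by (auto simp: \<eta>_def field_simps)
        have "\<forall>\<^sub>F n in sequentially. N / n < \<eta>"
          using order_tendstoD(2)[OF lim_const_over_n \<eta>(1)] .
        then have "\<forall>\<^sub>F n in sequentially. g n x / n \<le> lower x + \<epsilon> + 2 * C * b x + \<delta>"
          using b(3)[OF \<eta>(1), of x] eventually_gt_at_top[of 0]
        proof eventually_elim
          case (elim n)
          let ?S = "(\<Sum>k<n. indicat_real (slow \<epsilon> N) ((T ^^ k) x)) :: real"
          have "g n x / n \<le> (n * (lower x + \<epsilon>) + 2 * C * (?S + N)) / n"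
            by (intro divide_right_mono g_le_lower[OF \<epsilon>]) auto
          also have "\<dots> = lower x + \<epsilon> + 2 * C * (?S / n + N / n)"
            using elim by (simp add: field_simps)
          also have "\<dots> \<le> lower x + \<epsilon> + 2 * C * ((b x + \<eta>) + \<eta>)"
            using elim C_nonneg by (intro add_mono mult_left_mono order_refl) auto
          also have "\<dots> \<le> lower x + \<epsilon> + 2 * C * b x + \<delta>"
            using \<eta> by (simp add: algebra_simps)
          finally show ?case .
        qed
        then show "upper x \<le> lower x + \<epsilon> + 2 * C * b x + \<delta>"
          by (rule upper_leI)
      qed
      then have "(\<integral>x. upper x \<partial>M) \<le> (\<integral>x. lower x + \<epsilon> + 2 * C * b x \<partial>M)"
        using b(1) by (intro integral_mono) auto
      also have "\<dots> = (\<integral>x. lower x \<partial>M) + \<epsilon> + 2 * C * (\<integral>x. b x \<partial>M)"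
        using b(1) by (simp add: prob_space)
      also have "\<dots> \<le> (\<integral>x. lower x \<partial>M) + \<epsilon> + 2 * C * measure M (slow \<epsilon> N)"
        using b(2) C_nonneg by (intro add_mono mult_left_mono) auto
      finally show ?thesis .
    qed
    then show "\<exists>N0. \<forall>N\<ge>N0. (\<integral>x. upper x \<partial>M) \<le> (\<integral>x. lower x \<partial>M) + \<epsilon> + 2 * C * measure M (slow \<epsilon> N)"
      by auto
  qed
  then have "(\<integral>x. upper x \<partial>M) \<le> (\<integral>x. lower x \<partial>M)"
    by (rule field_le_epsilon)
  then have "(\<integral>x. upper x - lower x \<partial>M) \<le> 0" by simp
  moreover have "(\<integral>x. upper x - lower x \<partial>M) \<ge> 0"
    using lower_le_upper by (intro Bochner_Integration.integral_nonneg) auto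
  ultimately have "(\<integral>x. upper x - lower x \<partial>M) = 0" by simp
  then have "AE x in M. upper x - lower x = 0"
    using lower_le_upper by (subst (asm) integral_nonneg_eq_0_iff_AE) auto
  then show ?thesis
  proof eventually_elim
    case (elim x)
    then have "liminf (\<lambda>n. ereal (g n x / n)) = ereal (lower x)"
      "limsup (\<lambda>n. ereal (g n x / n)) = ereal (lower x)"
      by (simp_all flip: ereal_lower ereal_upper)
    then have "(\<lambda>n. ereal (g n x / n)) \<longlonglongrightarrow> ereal (lower x)"
      by (intro Liminf_eq_Limsup) auto
    then show ?case by simp
  qed
qed

section \<open>The torus and its Haar measure\<close>

definition int_vecs :: "(real^2) set" where
  "int_vecs = {m. \<forall>i. m $ i \<in> \<int>}"

lemma proj_eq_iff_diff: "proj x = proj y \<longleftrightarrow> x - y \<in> int_vecs"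
  by (simp add: proj_eq_iff int_vecs_def)

lemma proj_add_int [simp]: "m \<in> int_vecs \<Longrightarrow> proj (x + m) = proj x"
  by (simp add: proj_eq_iff_diff)

lemma int_vecs_closed:
  "0 \<in> int_vecs" "x \<in> int_vecs \<Longrightarrow> - x \<in> int_vecs"
  "x \<in> int_vecs \<Longrightarrow> y \<in> int_vecs \<Longrightarrow> x + y \<in> int_vecs"
  "x \<in> int_vecs \<Longrightarrow> y \<in> int_vecs \<Longrightarrow> x - y \<in> int_vecs"
  by (auto simp: int_vecs_def)

lemma int_vecs_small:
  assumes "m \<in> int_vecs" "norm m < 1"
  shows "m = 0"
proof -
  have "m $ i = 0" for i
  proof (rule Ints_nonzero_abs_less1)
    show "m $ i \<in> \<int>" using assms(1) by (simp add: int_vecs_def)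
    show "\<bar>m $ i\<bar> < 1" using assms(2) component_le_norm_cart[of m i] by linarith
  qed
  then show ?thesis by (simp add: vec_eq_iff)
qed

lemma countable_int_vecs: "countable int_vecs"
proof -
  have "int_vecs \<subseteq> range (\<lambda>(a, b). vector [of_int a, of_int b] :: real^2)"
  proof
    fix m :: "real^2" assume "m \<in> int_vecs"
    then have "m $ 1 \<in> \<int>" "m $ 2 \<in> \<int>" by (auto simp: int_vecs_def)
    then obtain a b where "m $ 1 = of_int a" "m $ 2 = of_int b" by (metis Ints_cases)
    then have "m = vector [of_int a, of_int b]" by (simp add: vec_eq_iff forall_2)
    then show "m \<in> range (\<lambda>(a, b). vector [of_int a, of_int b] :: real^2)" by force
  qed
  then show ?thesis by (rule countable_subset) auto
qed

definition unit_square :: "(real^2) set" where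
  "unit_square = {x. \<forall>i. 0 \<le> x $ i \<and> x $ i < 1}"

lemma unit_square_sets [measurable]: "unit_square \<in> sets borel"
proof -
  have "unit_square = (\<Inter>i. {x. 0 \<le> x $ i} \<inter> {x. x $ i < 1})"
    by (auto simp: unit_square_def)
  also have "\<dots> \<in> sets lborel" by measurable
  finally show ?thesis by simp
qed

lemma ex1_unit_square: "\<exists>!m. m \<in> int_vecs \<and> x - m \<in> unit_square"
proof (rule ex1I)
  let ?m = "\<chi> i. of_int \<lfloor>x $ i\<rfloor>"
  show "?m \<in> int_vecs \<and> x - ?m \<in> unit_square"
    by (auto simp: int_vecs_def unit_square_def) linarith
next
  fix m :: "real^2" assume m: "m \<in> int_vecs \<and> x - m \<in> unit_square"
  have "m $ i = of_int \<lfloor>x $ i\<rfloor>" for i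
  proof -
    have "m $ i \<in> \<int>" using m by (auto simp: int_vecs_def)
    then obtain a where a: "m $ i = of_int a" by (metis Ints_cases)
    have "0 \<le> (x - m) $ i \<and> (x - m) $ i < 1" using m unfolding unit_square_def by blast
    with a have "\<lfloor>x $ i\<rfloor> = a" by (intro floor_unique) auto
    with a show ?thesis by simp
  qed
  then show "m = (\<chi> i. of_int \<lfloor>x $ i\<rfloor>)" by (simp add: vec_eq_iff)
qed

lemma proj_unit_square: "\<exists>x\<in>unit_square. p = proj x"
proof -
  obtain y where y: "p = proj y"
    by transfer (auto intro: equivp_reflp[OF equivp_int_vec_rel])
  obtain m where m: "m \<in> int_vecs" "y - m \<in> unit_square" using ex1_unit_square[of y] by blast
  have "proj (y - m) = proj y" using m(1) by (simp add: proj_eq_iff_diff int_vecs_closed)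
  then show ?thesis using y m by metis
qed

lemma proj_surj: "surj proj"
  unfolding surj_def using proj_unit_square by blast

lemma compact_UNIV_torus: "compact (UNIV :: torus set)"
proof -
  have "unit_square \<subseteq> cbox 0 1"
    by (auto simp: unit_square_def mem_box_cart less_imp_le)
  then have "proj ` cbox 0 1 = UNIV"
    using proj_unit_square by auto blast
  then show ?thesis
    using compact_continuous_image[of "cbox 0 1" proj] continuous_on_subset[OF continuous_on_proj]
    by (metis compact_cbox subset_UNIV)
qed

lemma open_proj_image:
  assumes "open U"
  shows "open (proj ` U)"
proof -
  have "proj -` proj ` U = (\<Union>m\<in>int_vecs. (\<lambda>x. x + m) ` U)"
  proof (intro set_eqI iffI)
    fix x assume "x \<in> proj -` proj ` U"
    then obtain y where y: "y \<in> U" "proj x = proj y" by auto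
    then show "x \<in> (\<Union>m\<in>int_vecs. (\<lambda>x. x + m) ` U)"
      by (intro UN_I[of "x - y"] image_eqI[of _ _ y]) (auto simp: proj_eq_iff_diff)
  qed auto
  moreover have "open ((\<lambda>x. x + m) ` U)" for m :: "real^2"
    using open_translation[OF assms, of m] by (simp add: add.commute)
  ultimately show ?thesis unfolding open_torus_def by auto
qed

lemma continuous_on_torusI:
  fixes \<phi> :: "torus \<Rightarrow> 'b::topological_space"
  assumes "continuous_on UNIV (\<lambda>x. \<phi> (proj x))"
  shows "continuous_on UNIV \<phi>"
  unfolding continuous_on_open_vimage[OF open_UNIV]
proof (intro allI impI)
  fix B :: "'b set" assume "open B"
  then have "open ((\<lambda>x. \<phi> (proj x)) -` B)"
    using assms by (simp add: continuous_on_open_vimage)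
  then show "open (\<phi> -` B \<inter> UNIV)"
    by (simp add: open_torus_def vimage_def)
qed

lemma inj_on_proj:
  assumes "\<And>x y. x \<in> B \<Longrightarrow> y \<in> B \<Longrightarrow> norm (x - y) < 1"
  shows "inj_on proj B"
proof (rule inj_onI)
  fix x y assume "x \<in> B" "y \<in> B" "proj x = proj y"
  then have "x - y = 0"
    using assms by (intro int_vecs_small) (auto simp: proj_eq_iff_diff)
  then show "x = y" by simp
qed

lemma inj_on_proj_ball: "inj_on proj (ball x (1/2))"
proof (rule inj_on_proj)
  fix y z assume "y \<in> ball x (1/2)" "z \<in> ball x (1/2)"
  then show "norm (y - z) < 1"
    using dist_triangle_less_add[of y x "1/2" z "1/2"] by (simp add: dist_norm norm_minus_commute)
qed

lemma proj_measurable [measurable]: "proj \<in> borel \<rightarrow>\<^sub>M borel"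
  by (simp add: borel_measurable_continuous_onI continuous_on_proj)

lemma sets_haar_torus [measurable_cong, simp]: "sets haar_torus = sets borel"
  by (simp add: haar_torus_def)

lemma space_haar_torus [simp]: "space haar_torus = UNIV"
  by (simp add: haar_torus_def)

interpretation haar: prob_space haar_torus
  by (rule prob_space_haar_torus)

lemma nn_integral_haar_torus:
  assumes [measurable]: "\<psi> \<in> borel_measurable borel"
  shows "(\<integral>\<^sup>+p. \<psi> p \<partial>haar_torus) = (\<integral>\<^sup>+x. \<psi> (proj x) * indicator unit_square x \<partial>lborel)"
proof -
  have "(\<integral>\<^sup>+p. \<psi> p \<partial>haar_torus) = (\<integral>\<^sup>+x. \<psi> (proj x) \<partial>restrict_space lborel unit_square)"
    unfolding haar_torus_def unit_square_def[symmetric]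
    by (intro nn_integral_distr measurable_restrict_space1) auto
  also have "\<dots> = (\<integral>\<^sup>+x. \<psi> (proj x) * indicator unit_square x \<partial>lborel)"
    by (intro nn_integral_restrict_space) auto
  finally show ?thesis .
qed

lemma nn_integral_count_unique:
  assumes "\<And>m. m \<in> A \<Longrightarrow> P m \<Longrightarrow> m = m0" "m0 \<in> A" "P m0"
  shows "(\<integral>\<^sup>+m. indicator {m. P m} m \<partial>count_space A) = 1"
proof -
  have "(\<integral>\<^sup>+m. indicator {m. P m} m \<partial>count_space A) = (\<integral>\<^sup>+m. indicator {m0} m \<partial>count_space A)"
  proof (rule nn_integral_cong)
    fix m assume "m \<in> space (count_space A)"
    then have "P m \<longleftrightarrow> m = m0" using assms by (metis space_count_space)
    then show "indicator {m. P m} m = (indicator {m0} m :: ennreal)"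
      by (simp add: indicator_def)
  qed
  also have "\<dots> = 1" using assms(2) by simp
  finally show ?thesis .
qed

lemma nn_integral_lborel_shift:
  fixes m :: "'a::euclidean_space"
  assumes [measurable]: "\<psi> \<in> borel_measurable borel"
  shows "(\<integral>\<^sup>+x. \<psi> (x + m) \<partial>lborel) = (\<integral>\<^sup>+x. \<psi> x \<partial>lborel)"
proof -
  have "(\<integral>\<^sup>+x. \<psi> x \<partial>lborel) = (\<integral>\<^sup>+x. \<psi> x \<partial>distr lborel borel ((+) m))"
    by (simp add: lborel_distr_plus)
  also have "\<dots> = (\<integral>\<^sup>+x. \<psi> (m + x) \<partial>lborel)"
    by (intro nn_integral_distr) auto
  finally show ?thesis by (simp add: add.commute)
qed

text \<open>The integrand is distributed over the lattice translates of the unit square, which tile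
  the plane (\<open>Q1\<close>). A shift by \<open>m\<close> moves each tile to the unit square, and
  the shifted copies of \<open>B\<close> add up to the indicator of the image, because
  \<open>B\<close> meets every lattice orbit at most once (\<open>B1\<close>).\<close>

lemma nn_integral_chart:
  assumes [measurable]: "\<psi> \<in> borel_measurable borel"
    and B: "open B" "inj_on proj B"
  shows "(\<integral>\<^sup>+x. \<psi> (proj x) * indicator B x \<partial>lborel)
       = (\<integral>\<^sup>+p. \<psi> p * indicator (proj ` B) p \<partial>haar_torus)"
proof -
  have [measurable]: "B \<in> sets borel" "proj ` B \<in> sets borel"
    using B(1) open_proj_image by auto
  have B1: "(\<integral>\<^sup>+m. indicator B (x + m) \<partial>count_space int_vecs) = indicator (proj ` B) (proj x)"
    for x
  proof (cases "proj x \<in> proj ` B")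
    case True
    then obtain y where y: "y \<in> B" "proj x = proj y" by auto
    have "(\<integral>\<^sup>+m. indicator B (x + m) \<partial>count_space int_vecs)
        = (\<integral>\<^sup>+m. indicator {m. x + m \<in> B} m \<partial>count_space int_vecs)"
      by (intro nn_integral_cong) (auto simp: indicator_def)
    also have "\<dots> = 1"
    proof (rule nn_integral_count_unique[of _ _ "y - x"])
      show "y - x \<in> int_vecs" using y(2) by (metis proj_eq_iff_diff)
      show "x + (y - x) \<in> B" using y(1) by simp
    next
      fix m assume m: "m \<in> int_vecs" "x + m \<in> B"
      have "proj (x + m) = proj y" using m y by simp
      then have "x + m = y" using B(2) m(2) y(1) by (auto dest: inj_onD)
      then show "m = y - x" by auto
    qed
    finally show ?thesis using True by simp
  next
    case False
    then have "x + m \<notin> B" if "m \<in> int_vecs" for m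
      using that by (metis imageI proj_add_int)
    then have "(\<integral>\<^sup>+m. indicator B (x + m) \<partial>count_space int_vecs)
        = (\<integral>\<^sup>+m. 0 \<partial>count_space int_vecs)"
      by (intro nn_integral_cong) (auto simp: indicator_def)
    with False show ?thesis by simp
  qed
  have Q1: "(\<integral>\<^sup>+m. indicator unit_square (x - m) \<partial>count_space int_vecs) = 1" for x
  proof -
    obtain m0 where m0: "m0 \<in> int_vecs" "x - m0 \<in> unit_square"
      "\<And>m. m \<in> int_vecs \<Longrightarrow> x - m \<in> unit_square \<Longrightarrow> m = m0"
      using ex1_unit_square[of x] by blast
    have "(\<integral>\<^sup>+m. indicator unit_square (x - m) \<partial>count_space int_vecs)
        = (\<integral>\<^sup>+m. indicator {m. x - m \<in> unit_square} m \<partial>count_space int_vecs)"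
      by (intro nn_integral_cong) (auto simp: indicator_def)
    also have "\<dots> = 1" by (rule nn_integral_count_unique[of _ _ m0]) (use m0 in blast)+
    finally show ?thesis .
  qed
  have "(\<integral>\<^sup>+x. \<psi> (proj x) * indicator B x \<partial>lborel)
      = (\<integral>\<^sup>+x. (\<integral>\<^sup>+m. \<psi> (proj x) * indicator B x * indicator unit_square (x - m) \<partial>count_space int_vecs) \<partial>lborel)"
    by (simp add: nn_integral_cmult Q1)
  also have "\<dots> = (\<integral>\<^sup>+m. (\<integral>\<^sup>+x. \<psi> (proj x) * indicator B x * indicator unit_square (x - m) \<partial>lborel) \<partial>count_space int_vecs)"
    by (intro nn_integral_count_space_nn_integral[OF countable_int_vecs]) measurable
  also have "\<dots> = (\<integral>\<^sup>+m. (\<integral>\<^sup>+x. \<psi> (proj x) * indicator unit_square x * indicator B (x + m) \<partial>lborel) \<partial>count_space int_vecs)"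
  proof (rule nn_integral_cong)
    fix m assume "m \<in> space (count_space int_vecs)"
    then have m: "m \<in> int_vecs" by simp
    have "(\<integral>\<^sup>+x. \<psi> (proj x) * indicator B x * indicator unit_square (x - m) \<partial>lborel)
      = (\<integral>\<^sup>+x. \<psi> (proj (x + m)) * indicator B (x + m) * indicator unit_square (x + m - m) \<partial>lborel)"
      by (rule nn_integral_lborel_shift[symmetric]) measurable
    also have "\<dots> = (\<integral>\<^sup>+x. \<psi> (proj x) * indicator unit_square x * indicator B (x + m) \<partial>lborel)"
      using m by (simp add: mult_ac)
    finally show "(\<integral>\<^sup>+x. \<psi> (proj x) * indicator B x * indicator unit_square (x - m) \<partial>lborel) = \<dots>" .
  qed
  also have "\<dots> = (\<integral>\<^sup>+x. (\<integral>\<^sup>+m. \<psi> (proj x) * indicator unit_square x * indicator B (x + m) \<partial>count_space int_vecs) \<partial>lborel)"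
    by (intro nn_integral_count_space_nn_integral[OF countable_int_vecs, symmetric]) measurable
  also have "\<dots> = (\<integral>\<^sup>+x. \<psi> (proj x) * indicator (proj ` B) (proj x) * indicator unit_square x \<partial>lborel)"
    by (simp add: nn_integral_cmult B1 mult_ac)
  also have "\<dots> = (\<integral>\<^sup>+p. \<psi> p * indicator (proj ` B) p \<partial>haar_torus)"
    by (rule nn_integral_haar_torus[symmetric]) measurable
  finally show ?thesis .
qed

section \<open>The area formula\<close>

text \<open>Cramer's formula, kept explicit so that continuity in the entries can be read
  off.\<close>

definition inv2 :: "real^2^2 \<Rightarrow> real^2^2" where
  "inv2 A = vector [vector [A$2$2 / det A, - A$1$2 / det A], vector [- A$2$1 / det A, A$1$1 / det A]]"

lemma inv2:
  assumes "det A \<noteq> 0"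
  shows "inv2 A ** A = mat 1" "A ** inv2 A = mat 1"
proof -
  have *: "A$1$1 * A$2$2 - A$1$2 * A$2$1 \<noteq> 0" using assms by (simp add: det_2)
  show "inv2 A ** A = mat 1" "A ** inv2 A = mat 1"
    using * by (simp_all add: inv2_def matrix_matrix_mult_def vec_eq_iff forall_2 sum_2 mat_def det_2
        diff_divide_distrib[symmetric] add_divide_distrib[symmetric] mult.commute)
qed

lemma inv2_vector:
  assumes "det A \<noteq> 0"
  shows "inv2 A *v (A *v v) = v" "A *v (inv2 A *v v) = v"
  using inv2[OF assms] by (simp_all add: matrix_vector_mul_assoc)

lemma inv_matrix_vector_mult:
  assumes "det A \<noteq> 0"
  shows "inv ((*v) A) = (*v) (inv2 A)"
  using inv2_vector[OF assms] by (intro inv_equality) auto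

lemma inv2_unique: "A ** B = mat 1 \<Longrightarrow> det A \<noteq> 0 \<Longrightarrow> inv2 A = B"
  by (metis inv2(1) matrix_mul_assoc matrix_mul_lid matrix_mul_rid)

lemma inv2_mult:
  assumes "det A \<noteq> 0" "det B \<noteq> 0"
  shows "inv2 (A ** B) = inv2 B ** inv2 A"
proof (rule inv2_unique)
  have "(A ** B) ** (inv2 B ** inv2 A) = A ** (B ** inv2 B) ** inv2 A"
    by (simp add: matrix_mul_assoc)
  then show "(A ** B) ** (inv2 B ** inv2 A) = mat 1"
    using inv2[OF assms(1)] inv2[OF assms(2)] by simp
  show "det (A ** B) \<noteq> 0" using assms by (simp add: det_mul)
qed

text \<open>The claim says that two measures agree: the image under \<open>F\<close> of the density
  \<open>\<bar>det D\<bar>\<close> on \<open>B\<close>, and Lebesgue measure on the image of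
  \<open>B\<close>. It is enough to compare them on Borel sets, where this is the volume formula for
  injective differentiable images; the boundedness of \<open>B\<close> and of the determinant gives
  integrability.\<close>

lemma nn_integral_diffeo:
  fixes F :: "real^2 \<Rightarrow> real^2" and D :: "real^2 \<Rightarrow> real^2^2"
  assumes B: "open B" "bounded B" and contD: "continuous_on B D"
    and dF: "\<And>y. y \<in> B \<Longrightarrow> (F has_derivative (*v) (D y)) (at y)"
    and inj: "inj_on F B" and bd: "\<And>y. y \<in> B \<Longrightarrow> \<bar>det (D y)\<bar> \<le> K"
    and [measurable]: "\<psi> \<in> borel_measurable borel"
  shows "(\<integral>\<^sup>+y. \<psi> (F y) * ennreal \<bar>det (D y)\<bar> * indicator B y \<partial>lborel)
       = (\<integral>\<^sup>+z. \<psi> z * indicator (F ` B) z \<partial>lborel)"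
proof -
  \<comment> \<open>Extension by 0 makes the map and the density Borel on the whole plane; as
    \<open>J\<close> vanishes off \<open>B\<close>, the values of \<open>F'\<close> there do not
    count.\<close>
  define F' where "F' y = (if y \<in> B then F y else 0)" for y
  define J where "J y = (if y \<in> B then \<bar>det (D y)\<bar> else 0)" for y
  have contF: "continuous_on B F"
    using dF B(1) by (meson has_derivative_at_withinI has_derivative_continuous_on)
  have contJ: "continuous_on B (\<lambda>y. \<bar>det (D y)\<bar>)"
    unfolding det_2 by (intro continuous_intros contD)
  have Bm [measurable]: "B \<in> sets borel" using B(1) by auto
  have [measurable]: "F' \<in> borel_measurable borel"
    unfolding F'_def by (intro borel_measurable_continuous_on_if contF Bm continuous_on_const)
  have [measurable]: "J \<in> borel_measurable borel"
    unfolding J_def by (intro borel_measurable_continuous_on_if contJ Bm continuous_on_const)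
  have FB: "open (F ` B)" using invariance_of_domain[OF contF B(1) inj] .
  then have [measurable]: "F ` B \<in> sets borel" by auto
  have finB: "emeasure lborel B < \<infinity>" using B(2) by (rule emeasure_bounded_finite)
  have key: "(\<integral>\<^sup>+y. ennreal (J y) * indicator A y \<partial>lborel) = emeasure lborel (F ` A)"
    if A [measurable]: "A \<in> sets borel" and AB: "A \<subseteq> B" and FA: "F ` A \<in> sets borel" for A
  proof -
    have int: "integrable lborel (\<lambda>y. indicator A y *\<^sub>R J y)"
    proof (rule integrableI_bounded_set_indicator)
      show "emeasure lborel A < \<infinity>"
        using emeasure_mono[OF AB, of lborel] finB by auto
      show "AE x in lborel. x \<in> A \<longrightarrow> norm (J x) \<le> K"
        using bd AB by (auto simp: J_def)
    qed auto
    then have sint: "set_integrable lborel A J" by (simp add: set_integrable_def)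
    have JA: "J y = \<bar>det (D y)\<bar>" if "y \<in> A" for y using that AB by (auto simp: J_def)
    have iJ: "J integrable_on A" by (rule set_borel_integral_eq_integral[OF sint])
    then have idet: "(\<lambda>y. \<bar>det (matrix ((*v) (D y)))\<bar>) integrable_on A"
      using JA by (simp add: integrable_cong[of A "\<lambda>y. \<bar>det (D y)\<bar>" J])
    have dFA: "(F has_derivative (*v) (D y)) (at y within A)" if "y \<in> A" for y
      using dF that AB by (auto intro: has_derivative_at_withinI)
    have injA: "inj_on F A" using inj AB by (rule inj_on_subset)
    have AL: "A \<in> sets lebesgue" by auto
    have lm: "F ` A \<in> lmeasurable"
      using measurable_differentiable_image_eq[OF AL dFA injA] idet by blast
    have "measure lebesgue (F ` A) = integral A (\<lambda>y. \<bar>det (matrix ((*v) (D y)))\<bar>)"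
      by (rule measure_differentiable_image_eq[OF AL dFA injA idet])
    also have "\<dots> = integral A J" using JA by (intro integral_cong) simp
    also have "\<dots> = (LINT y:A|lborel. J y)" by (simp add: set_borel_integral_eq_integral[OF sint])
    finally have "emeasure lebesgue (F ` A) = ennreal (LINT y:A|lborel. J y)"
      by (simp only: emeasure_eq_measure2[OF lm])
    also have "\<dots> = (\<integral>\<^sup>+y. ennreal (indicator A y *\<^sub>R J y) \<partial>lborel)"
      unfolding set_lebesgue_integral_def
      by (intro nn_integral_eq_integral[symmetric] int) (auto simp: J_def)
    also have "\<dots> = (\<integral>\<^sup>+y. ennreal (J y) * indicator A y \<partial>lborel)"
      by (intro nn_integral_cong) (auto simp: indicator_def)
    finally show ?thesis using FA by simp
  qed
  have "distr (density lborel J) borel F' = density lborel (indicator (F ` B))" (is "?M1 = ?M2")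
  proof (rule measure_eqI)
    fix X assume "X \<in> sets ?M1"
    then have X [measurable]: "X \<in> sets borel" by simp
    define A where "A = B \<inter> F' -` X"
    have FX [measurable]: "F' -` X \<in> sets borel"
      using measurable_sets[OF \<open>F' \<in> borel_measurable borel\<close> X] by simp
    then have [measurable]: "A \<in> sets borel"
      unfolding A_def by auto
    have FA: "F ` A = X \<inter> F ` B" by (auto simp: A_def F'_def)
    have "emeasure ?M1 X = (\<integral>\<^sup>+y. ennreal (J y) * indicator (F' -` X) y \<partial>lborel)"
      using FX by (subst emeasure_distr) (auto simp: emeasure_density)
    also have "\<dots> = (\<integral>\<^sup>+y. ennreal (J y) * indicator A y \<partial>lborel)"
      by (intro nn_integral_cong) (auto simp: J_def A_def indicator_def)
    also have "\<dots> = emeasure lborel (X \<inter> F ` B)"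
      using key[of A] FA by (auto simp: A_def)
    also have "\<dots> = (\<integral>\<^sup>+z. indicator (X \<inter> F ` B) z \<partial>lborel)"
      by (intro nn_integral_indicator[symmetric]) auto
    also have "\<dots> = (\<integral>\<^sup>+z. indicator (F ` B) z * indicator X z \<partial>lborel)"
      by (intro nn_integral_cong) (auto simp: indicator_def)
    also have "\<dots> = emeasure ?M2 X"
      by (subst emeasure_density) auto
    finally show "emeasure ?M1 X = emeasure ?M2 X" .
  qed simp
  then have "(\<integral>\<^sup>+z. \<psi> z \<partial>?M1) = (\<integral>\<^sup>+z. \<psi> z \<partial>?M2)" by simp
  moreover have "(\<integral>\<^sup>+z. \<psi> z \<partial>?M1) = (\<integral>\<^sup>+y. ennreal (J y) * \<psi> (F' y) \<partial>lborel)"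
    by (subst nn_integral_distr) (auto simp: nn_integral_density)
  moreover have "(\<integral>\<^sup>+z. \<psi> z \<partial>?M2) = (\<integral>\<^sup>+z. indicator (F ` B) z * \<psi> z \<partial>lborel)"
    by (subst nn_integral_density) auto
  moreover have "(\<integral>\<^sup>+y. ennreal (J y) * \<psi> (F' y) \<partial>lborel)
      = (\<integral>\<^sup>+y. \<psi> (F y) * ennreal \<bar>det (D y)\<bar> * indicator B y \<partial>lborel)"
    by (intro nn_integral_cong) (auto simp: J_def F'_def indicator_def mult_ac)
  ultimately show ?thesis by (simp add: mult.commute)
qed

text \<open>The infinitesimal side of a local diffeomorphism: lifts with continuous invertible
  Jacobian. In this form the property passes to compositions, hence to iterates, by the chain rule
  alone.\<close>

definition C1_regular :: "(torus \<Rightarrow> torus) \<Rightarrow> bool" where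
  "C1_regular f \<longleftrightarrow> (\<forall>x. \<exists>W F D. open W \<and> x \<in> W \<and> continuous_on W (D :: real^2 \<Rightarrow> real^2^2) \<and>
     (\<forall>y\<in>W. f (proj y) = proj (F y) \<and> (F has_derivative (*v) (D y)) (at y) \<and> det (D y) \<noteq> 0))"

definition torus_jac :: "(torus \<Rightarrow> torus) \<Rightarrow> torus \<Rightarrow> real^2^2" where
  "torus_jac f p = matrix (torus_deriv f p)"

lemma torus_deriv_eqI: "torus_has_derivative f p A \<Longrightarrow> torus_deriv f p = A"
  unfolding torus_deriv_def by (blast intro: torus_has_derivative_unique)

lemma torus_deriv_lift:
  assumes "open W" "x \<in> W" "\<And>y. y \<in> W \<Longrightarrow> f (proj y) = proj (F y)"
    "(F has_derivative (*v) A) (at x)"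
  shows "torus_deriv f (proj x) = (*v) A" "torus_jac f (proj x) = A"
proof -
  have "\<forall>\<^sub>F y in nhds x. y \<in> W" using assms(1,2) by (rule eventually_nhds_in_open)
  then have "\<forall>\<^sub>F y in nhds x. f (proj y) = proj (F y)"
    by eventually_elim (rule assms(3))
  then have "torus_has_derivative f (proj x) ((*v) A)"
    unfolding torus_has_derivative_def using assms(4) by blast
  then show "torus_deriv f (proj x) = (*v) A" by (rule torus_deriv_eqI)
  then show "torus_jac f (proj x) = A" by (simp add: torus_jac_def)
qed

text \<open>Uniqueness of the derivative on the torus replaces the Jacobian of the chosen lift by
  \<open>torus_jac\<close>, which does not depend on the lift.\<close>

lemma C1_regular_lift:
  assumes "C1_regular f"
  obtains W F where "open W" "x \<in> W" "continuous_on W (\<lambda>y. torus_jac f (proj y))"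
    "continuous_on W F"
    "\<And>y. y \<in> W \<Longrightarrow> f (proj y) = proj (F y)"
    "\<And>y. y \<in> W \<Longrightarrow> (F has_derivative (*v) (torus_jac f (proj y))) (at y)"
    "\<And>y. y \<in> W \<Longrightarrow> det (torus_jac f (proj y)) \<noteq> 0"
    "\<And>y. y \<in> W \<Longrightarrow> torus_deriv f (proj y) = (*v) (torus_jac f (proj y))"
proof -
  obtain W F D where W: "open W" "x \<in> W" "continuous_on W D"
    "\<And>y. y \<in> W \<Longrightarrow> f (proj y) = proj (F y)"
    "\<And>y. y \<in> W \<Longrightarrow> (F has_derivative (*v) (D y)) (at y)"
    "\<And>y. y \<in> W \<Longrightarrow> det (D y) \<noteq> 0"
    using assms unfolding C1_regular_def by metis
  have jac: "torus_jac f (proj y) = D y" and der: "torus_deriv f (proj y) = (*v) (D y)"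
    if "y \<in> W" for y
    using torus_deriv_lift[OF W(1) that W(4) W(5)[OF that]] by auto
  have "continuous_on W F"
    using W(5) by (meson has_derivative_at_withinI has_derivative_continuous_on)
  moreover have "continuous_on W (\<lambda>y. torus_jac f (proj y))"
    using W(3) by (rule continuous_on_eq) (simp add: jac)
  ultimately show ?thesis
    using W jac der by (intro that[of W F]) auto
qed

lemma torus_jac_continuous:
  assumes "C1_regular f"
  shows "continuous_on UNIV (torus_jac f)"
proof (rule continuous_on_torusI)
  have "isCont (\<lambda>y. torus_jac f (proj y)) x" for x
    using C1_regular_lift[OF assms, of x] by (metis continuous_on_eq_continuous_at)
  then show "continuous_on UNIV (\<lambda>y. torus_jac f (proj y))"
    by (simp add: continuous_at_imp_continuous_on)
qed

lemma C1_regular_continuous: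
  assumes "C1_regular f"
  shows "continuous_on UNIV f"
proof (rule continuous_on_torusI)
  have "isCont (\<lambda>y. f (proj y)) x" for x
  proof -
    obtain W F where W: "open W" "x \<in> W" "continuous_on W F"
      "\<And>y. y \<in> W \<Longrightarrow> f (proj y) = proj (F y)"
      using C1_regular_lift[OF assms, of x] by metis
    have "continuous_on W (\<lambda>y. proj (F y))"
      using continuous_on_compose2[OF continuous_on_proj W(3)] by simp
    then have "continuous_on W (\<lambda>y. f (proj y))"
      by (rule continuous_on_eq) (simp add: W(4))
    then show ?thesis using W by (metis continuous_on_eq_continuous_at)
  qed
  then show "continuous_on UNIV (\<lambda>y. f (proj y))"
    by (simp add: continuous_at_imp_continuous_on)
qed

lemma torus_jac_det_nonzero: "C1_regular f \<Longrightarrow> det (torus_jac f p) \<noteq> 0"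
  using C1_regular_lift[of f] proj_surj by (metis surj_def)

lemma torus_deriv_jac: "C1_regular f \<Longrightarrow> torus_deriv f p = (*v) (torus_jac f p)"
  using C1_regular_lift[of f] proj_surj by (metis surj_def)

lemma C1_regular_compose:
  assumes f: "C1_regular f" and g: "C1_regular g"
  shows "C1_regular (f \<circ> g)" "torus_jac (f \<circ> g) p = torus_jac f (g p) ** torus_jac g p"
proof -
  have *: "\<exists>W H. open W \<and> x \<in> W \<and>
      continuous_on W (\<lambda>y. torus_jac f (g (proj y)) ** torus_jac g (proj y)) \<and>
      (\<forall>y\<in>W. (f \<circ> g) (proj y) = proj (H y) \<and>
       (H has_derivative (*v) (torus_jac f (g (proj y)) ** torus_jac g (proj y))) (at y) \<and>
        det (torus_jac f (g (proj y)) ** torus_jac g (proj y)) \<noteq> 0)" for x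
  proof -
    obtain W G where G: "open W" "x \<in> W" "continuous_on W G"
      "continuous_on W (\<lambda>y. torus_jac g (proj y))"
      "\<And>y. y \<in> W \<Longrightarrow> g (proj y) = proj (G y)"
      "\<And>y. y \<in> W \<Longrightarrow> (G has_derivative (*v) (torus_jac g (proj y))) (at y)"
      using C1_regular_lift[OF g, of x] by metis
    obtain V F where F: "open V" "G x \<in> V"
      "continuous_on V (\<lambda>y. torus_jac f (proj y))"
      "\<And>y. y \<in> V \<Longrightarrow> f (proj y) = proj (F y)"
      "\<And>y. y \<in> V \<Longrightarrow> (F has_derivative (*v) (torus_jac f (proj y))) (at y)"
      using C1_regular_lift[OF f, of "G x"] by metis
    define X where "X = W \<inter> G -` V"
    have X: "open X" "x \<in> X" "X \<subseteq> W" "G ` X \<subseteq> V"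
      using G F unfolding X_def by (auto intro: continuous_open_preimage)
    have "continuous_on X (\<lambda>y. torus_jac f (proj (G y)))"
      using X(4) by (intro continuous_on_compose2[OF F(3) continuous_on_subset[OF G(3) X(3)]])
    then have c1: "continuous_on X (\<lambda>y. torus_jac f (g (proj y)))"
      using X(3) G(5) by (auto elim!: continuous_on_eq)
    have c2: "continuous_on X (\<lambda>y. torus_jac g (proj y))"
      using G(4) X(3) by (rule continuous_on_subset)
    have "continuous_on X (\<lambda>y. torus_jac f (g (proj y)) ** torus_jac g (proj y))"
      unfolding matrix_matrix_mult_def by (intro continuous_intros c1 c2)
    moreover have "((\<lambda>y. F (G y)) has_derivative (*v) (torus_jac f (g (proj y)) ** torus_jac g (proj y))) (at y)"
      if "y \<in> X" for y
    proof -
      have "((\<lambda>y. F (G y)) has_derivative (\<lambda>h. torus_jac f (proj (G y)) *v (torus_jac g (proj y) *v h))) (at y)"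
        using that X by (intro has_derivative_compose[OF G(6) F(5)]) auto
      moreover have "g (proj y) = proj (G y)" using that X G(5) by auto
      ultimately show ?thesis by (simp add: matrix_vector_mul_assoc)
    qed
    moreover have "f (g (proj y)) = proj (F (G y))" if "y \<in> X" for y
    proof -
      have "y \<in> W" "G y \<in> V" using that X by auto
      then show ?thesis using G(5) F(4) by metis
    qed
    ultimately show ?thesis
      using X torus_jac_det_nonzero[OF f] torus_jac_det_nonzero[OF g]
      by (intro exI[of _ X] exI[of _ "\<lambda>y. F (G y)"]) (auto simp: det_mul)
  qed
  then show "C1_regular (f \<circ> g)"
    unfolding C1_regular_def by blast
  obtain x where x: "p = proj x" using proj_surj by (metis surj_def)
  obtain W H where H: "open W" "x \<in> W" "\<And>y. y \<in> W \<Longrightarrow> (f \<circ> g) (proj y) = proj (H y)"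
    "(H has_derivative (*v) (torus_jac f (g (proj x)) ** torus_jac g (proj x))) (at x)"
    using *[of x] by blast
  show "torus_jac (f \<circ> g) p = torus_jac f (g p) ** torus_jac g p"
    unfolding x by (rule torus_deriv_lift(2)[OF H(1,2) H(3) H(4)])
qed

lemma C1_regular_id: "C1_regular id" "torus_jac id p = mat 1"
proof -
  have d: "((\<lambda>y. y) has_derivative (*v) (mat 1)) (at x)" for x :: "real^2"
  proof -
    have "(*v) (mat 1 :: real^2^2) = (\<lambda>y. y)" by auto
    then show ?thesis by simp
  qed
  show "C1_regular id"
    unfolding C1_regular_def using d
    by (intro allI exI[of _ UNIV] exI[of _ "\<lambda>y. y"] exI[of _ "\<lambda>y. mat 1"]) auto
  obtain x where x: "p = proj x" using proj_surj by (metis surj_def)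
  show "torus_jac id p = mat 1"
    unfolding x by (rule torus_deriv_lift(2)[OF open_UNIV _ _ d]) auto
qed

lemma C1_regular_funpow: "C1_regular f \<Longrightarrow> C1_regular (f ^^ n)"
  by (induction n) (auto simp: C1_regular_id C1_regular_compose)

lemma torus_jac_funpow_add:
  assumes "C1_regular f"
  shows "torus_jac (f ^^ (n + m)) p = torus_jac (f ^^ m) ((f ^^ n) p) ** torus_jac (f ^^ n) p"
proof -
  have "f ^^ (n + m) = f ^^ m \<circ> f ^^ n"
    by (subst add.commute) (rule funpow_add)
  then show ?thesis using C1_regular_compose(2)[OF C1_regular_funpow C1_regular_funpow] assms by simp
qed


text \<open>Locally the area formula is the change of variables formula; the sum over preimages
  arises when the torus is cut into finitely many pieces on which \<open>f\<close> is injective.\<close>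

definition area_chart :: "(torus \<Rightarrow> torus) \<Rightarrow> torus set \<Rightarrow> bool" where
  "area_chart f U \<longleftrightarrow> open U \<and> inj_on f U \<and> (\<forall>V\<subseteq>U. open V \<longrightarrow> open (f ` V)) \<and>
    (\<forall>\<phi>\<in>borel_measurable borel.
       (\<integral>\<^sup>+q. \<phi> (f q) * ennreal \<bar>det (torus_jac f q)\<bar> * indicator U q \<partial>haar_torus)
     = (\<integral>\<^sup>+p. \<phi> p * indicator (f ` U) p \<partial>haar_torus))"

lemma area_chart_empty: "area_chart f {}"
  by (simp add: area_chart_def)

lemma area_chartD:
  assumes "area_chart f U" "\<phi> \<in> borel_measurable borel"
  shows "(\<integral>\<^sup>+q. \<phi> (f q) * ennreal \<bar>det (torus_jac f q)\<bar> * indicator U q \<partial>haar_torus)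
     = (\<integral>\<^sup>+p. \<phi> p * indicator (f ` U) p \<partial>haar_torus)"
  using assms unfolding area_chart_def by (elim conjE) (drule (1) bspec)

text \<open>On a small ball the lift is injective because its derivative is invertible and
  continuous, and both the ball and its image are small enough for \<open>proj\<close> to be
  injective on them. The formula is then \<open>nn_integral_diffeo\<close> between two applications
  of \<open>nn_integral_chart\<close>.\<close>

lemma area_local:
  assumes f: "C1_regular f"
  shows "\<exists>U. p \<in> U \<and> area_chart f U"
proof -
  obtain x where x: "p = proj x" using proj_surj by (metis surj_def)
  obtain W F where W: "open W" "x \<in> W" and cont: "continuous_on W (\<lambda>y. torus_jac f (proj y))"
    "continuous_on W F"
    and fF: "\<And>y. y \<in> W \<Longrightarrow> f (proj y) = proj (F y)"
    and dF: "\<And>y. y \<in> W \<Longrightarrow> (F has_derivative (*v) (torus_jac f (proj y))) (at y)"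
    using C1_regular_lift[OF f, of x] by metis
  let ?D = "\<lambda>y. torus_jac f (proj y)"
  have contD: "continuous_on UNIV ?D"
    using continuous_on_compose2[OF torus_jac_continuous[OF f] continuous_on_proj] by simp
  then have atD: "(?D \<longlongrightarrow> ?D x) (nhds x)"
    by (metis UNIV_I continuous_on_eq_continuous_at isCont_def open_UNIV tendsto_at_iff_tendsto_nhds)
  \<comment> \<open>Local injectivity asks for continuity of the derivative in operator norm.
    Passing from the entries to that norm costs a factor 4, so \<open>e / 8\<close> leaves
    \<open>e / 2 < e\<close>.\<close>
  have "\<exists>d>0. \<forall>y. dist x y < d \<longrightarrow> onorm (\<lambda>v. ?D y *v v - ?D x *v v) < e" if e: "e > 0" for e
  proof -
    have "\<forall>\<^sub>F y in nhds x. dist (?D y) (?D x) < e / 8"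
      using tendstoD[OF atD, of "e/8"] e by simp
    then obtain d where d: "d > 0" "\<And>y. dist y x < d \<Longrightarrow> dist (?D y) (?D x) < e / 8"
      by (auto simp: eventually_nhds_metric)
    have "onorm (\<lambda>v. ?D y *v v - ?D x *v v) < e" if "dist x y < d" for y
    proof -
      have "\<bar>(?D y - ?D x) $ i $ j\<bar> \<le> e / 8" for i j :: 2
      proof -
        have "\<bar>(?D y - ?D x) $ i $ j\<bar> \<le> norm (?D y - ?D x)"
          by (rule order_trans[OF component_le_norm_cart Finite_Cartesian_Product.norm_nth_le])
        moreover have "norm (?D y - ?D x) < e / 8"
          using d(2)[of y] that by (simp only: dist_commute dist_norm[symmetric])
        ultimately show ?thesis by linarith
      qed
      then have "onorm ((*v) (?D y - ?D x)) \<le> real CARD(2) * real CARD(2) * (e / 8)"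
        by (rule onorm_le_matrix_component)
      moreover have "(*v) (?D y - ?D x) = (\<lambda>v. ?D y *v v - ?D x *v v)"
        by (simp add: matrix_vector_mult_diff_rdistrib fun_eq_iff)
      ultimately show ?thesis using e by simp
    qed
    then show ?thesis using d(1) by blast
  qed
  moreover have "(*v) (inv2 (?D x)) \<circ> (*v) (?D x) = id"
    using inv2_vector(1)[OF torus_jac_det_nonzero[OF f]] by (auto simp: o_def)
  ultimately obtain r where r: "r > 0" "ball x r \<subseteq> W" "inj_on F (ball x r)"
    using has_derivative_locally_injective[OF W(2,1) matrix_vector_mul_bounded_linear,
        of "inv2 (?D x)" "\<lambda>y. (*v) (?D y)" F] dF
    by blast
  have "(F \<longlongrightarrow> F x) (nhds x)"
    using cont(2) W by (metis continuous_on_eq_continuous_at isCont_def tendsto_at_iff_tendsto_nhds)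
  then have "\<forall>\<^sub>F y in nhds x. dist (F y) (F x) < 1/2" by (rule tendstoD) simp
  moreover have "\<forall>\<^sub>F y in nhds x. dist (det (?D y)) (det (?D x)) < 1"
  proof (rule tendstoD)
    show "((\<lambda>y. det (?D y)) \<longlongrightarrow> det (?D x)) (nhds x)"
      unfolding det_2 by (intro tendsto_intros atD)
  qed simp
  ultimately have "\<forall>\<^sub>F y in nhds x. dist (F y) (F x) < 1/2 \<and> dist (det (?D y)) (det (?D x)) < 1"
    by eventually_elim simp
  then obtain d where d: "d > 0" "\<And>y. dist y x < d \<Longrightarrow> dist (F y) (F x) < 1/2"
    "\<And>y. dist y x < d \<Longrightarrow> dist (det (?D y)) (det (?D x)) < 1"
    unfolding eventually_nhds_metric by blast
  define B where "B = ball x (min (min r d) (1/2))"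
  have B: "open B" "bounded B" "x \<in> B" "B \<subseteq> W" "inj_on F B" "inj_on proj B"
    "\<And>y. y \<in> B \<Longrightarrow> dist y x < d"
    using r d inj_on_proj_ball[of x] by (auto simp: B_def dist_commute intro: inj_on_subset)
  have injP: "inj_on proj (F ` B)"
  proof (rule inj_on_subset[OF inj_on_proj_ball[of "F x"]])
    show "F ` B \<subseteq> ball (F x) (1/2)" using d(2) B(7) by (auto simp: dist_commute)
  qed
  have contF: "continuous_on B F" using cont(2) B(4) by (rule continuous_on_subset)
  have openF: "open (F ` V)" if "open V" "V \<subseteq> B" for V
    using that B(5) contF by (intro invariance_of_domain) (auto intro: continuous_on_subset inj_on_subset)
  have fB: "f ` proj ` V = proj ` F ` V" if "V \<subseteq> B" for V
    using that B(4) fF by (force simp: image_iff)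
  define U where "U = proj ` B"
  have "inj_on f U"
  proof (rule inj_onI)
    fix a b assume "a \<in> U" "b \<in> U" "f a = f b"
    then obtain y z where yz: "y \<in> B" "z \<in> B" "a = proj y" "b = proj z" "f (proj y) = f (proj z)"
      unfolding U_def by blast
    then have "proj (F y) = proj (F z)" using fF B(4) by (metis subsetD)
    then have "F y = F z" using injP yz by (auto dest: inj_onD)
    then show "a = b" using B(5) yz by (auto dest: inj_onD)
  qed
  moreover have "open (f ` V)" if "V \<subseteq> U" "open V" for V
  proof -
    define V' where "V' = proj -` V \<inter> B"
    have "open V'" using that B(1) by (auto simp: V'_def open_torus_def)
    moreover have "V = proj ` V'" using that by (auto simp: V'_def U_def)
    moreover have "open (proj ` F ` V')"
      using \<open>open V'\<close> by (intro open_proj_image openF) (auto simp: V'_def)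
    moreover have "f ` proj ` V' = proj ` F ` V'" by (rule fB) (simp add: V'_def)
    ultimately show ?thesis by simp
  qed
  moreover have "(\<integral>\<^sup>+q. \<phi> (f q) * ennreal \<bar>det (torus_jac f q)\<bar> * indicator U q \<partial>haar_torus)
     = (\<integral>\<^sup>+p. \<phi> p * indicator (f ` U) p \<partial>haar_torus)"
    if [measurable]: "\<phi> \<in> borel_measurable borel" for \<phi>
  proof -
    have [measurable]: "f \<in> borel \<rightarrow>\<^sub>M borel"
      by (intro borel_measurable_continuous_onI C1_regular_continuous f)
    have [measurable]: "(\<lambda>q. det (torus_jac f q)) \<in> borel_measurable borel"
      unfolding det_2 by (intro borel_measurable_continuous_onI continuous_intros torus_jac_continuous f)
    have "(\<integral>\<^sup>+q. \<phi> (f q) * ennreal \<bar>det (torus_jac f q)\<bar> * indicator U q \<partial>haar_torus)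
       = (\<integral>\<^sup>+y. \<phi> (f (proj y)) * ennreal \<bar>det (?D y)\<bar> * indicator B y \<partial>lborel)"
      unfolding U_def by (rule nn_integral_chart[symmetric]) (use B in auto)
    also have "\<dots> = (\<integral>\<^sup>+y. \<phi> (proj (F y)) * ennreal \<bar>det (?D y)\<bar> * indicator B y \<partial>lborel)"
      using fF B(4) by (intro nn_integral_cong) (auto simp: indicator_def)
    also have "\<dots> = (\<integral>\<^sup>+z. \<phi> (proj z) * indicator (F ` B) z \<partial>lborel)"
    proof (rule nn_integral_diffeo[where K = "\<bar>det (?D x)\<bar> + 1"])
      show "\<bar>det (?D y)\<bar> \<le> \<bar>det (?D x)\<bar> + 1" if "y \<in> B" for y
        using d(3)[OF B(7)[OF that]] by (auto simp: dist_real_def)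
    qed (use B dF contD in \<open>auto intro: continuous_on_subset\<close>)
    also have "\<dots> = (\<integral>\<^sup>+p. \<phi> p * indicator (proj ` F ` B) p \<partial>haar_torus)"
      by (rule nn_integral_chart) (use openF B injP in auto)
    finally show ?thesis using fB[of B] by (simp add: U_def)
  qed
  moreover have "open U" "p \<in> U"
    using B open_proj_image by (auto simp: U_def x)
  ultimately show ?thesis unfolding area_chart_def by (intro exI[of _ U] conjI allI impI ballI)
qed

theorem area_formula:
  assumes f: "C1_regular f" and \<psi> [measurable]: "\<psi> \<in> borel_measurable borel"
  shows "finite (f -` {p})"
    and "(\<lambda>p. \<Sum>q\<in>f -` {p}. \<psi> q / ennreal \<bar>det (torus_jac f q)\<bar>) \<in> borel_measurable borel"
    and "(\<integral>\<^sup>+q. \<psi> q \<partial>haar_torus)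
       = (\<integral>\<^sup>+p. (\<Sum>q\<in>f -` {p}. \<psi> q / ennreal \<bar>det (torus_jac f q)\<bar>) \<partial>haar_torus)"
proof -
  define J where "J q = ennreal \<bar>det (torus_jac f q)\<bar>" for q
  have [measurable]: "f \<in> borel \<rightarrow>\<^sub>M borel"
    by (intro borel_measurable_continuous_onI C1_regular_continuous f)
  have "(\<lambda>q. det (torus_jac f q)) \<in> borel_measurable borel"
    unfolding det_2 by (intro borel_measurable_continuous_onI continuous_intros torus_jac_continuous f)
  then have Jm [measurable]: "J \<in> borel_measurable borel"
    unfolding J_def by measurable
  have J: "J q \<noteq> 0" "J q \<noteq> top" for q
    using torus_jac_det_nonzero[OF f] by (auto simp: J_def)
  obtain \<U> where \<U>: "\<U> \<subseteq> Collect (area_chart f)" "finite \<U>" "UNIV \<subseteq> \<Union>\<U>"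
  proof (rule compactE[OF compact_UNIV_torus])
    show "UNIV \<subseteq> \<Union>(Collect (area_chart f))" using area_local[OF f] by blast
    show "\<And>B. B \<in> Collect (area_chart f) \<Longrightarrow> open B" by (simp add: area_chart_def)
  qed
  obtain n and e :: "nat \<Rightarrow> torus set" where e: "\<U> = e ` {..<n}"
    using \<U>(2) by (metis finite_conv_nat_seg_image lessThan_def)
  define U where "U i = (if i < n then e i else {})" for i
  have chart: "area_chart f (U i)" for i
    using \<U>(1) e by (auto simp: U_def area_chart_empty)
  have openU: "open (U i)" and injU: "inj_on f (U i)"
    and openfV: "V \<subseteq> U i \<Longrightarrow> open V \<Longrightarrow> open (f ` V)" for i V
    using chart[of i] by (simp_all add: area_chart_def)
  have UcoverE: "\<exists>i<n. q \<in> U i" for q using \<U>(3) e by (auto simp: U_def)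
  \<comment> \<open>Disjoint Borel pieces, so that each preimage is counted once; the open charts
    \<open>U i\<close> around them carry the inverse branches.\<close>
  define A where "A i = U i - (\<Union>j<i. U j)" for i
  have [measurable]: "U i \<in> sets borel" for i using openU by auto
  then have [measurable]: "A i \<in> sets borel" for i by (auto simp: A_def)
  have AU: "A i \<subseteq> U i" for i by (auto simp: A_def)
  have disj: "A i \<inter> A j = {}" if "i \<noteq> j" for i j
    using that by (cases i j rule: linorder_cases) (auto simp: A_def)
  have cover: "(\<Union>i<n. A i) = UNIV"
  proof -
    have "\<exists>i<n. q \<in> A i" for q
    proof -
      obtain i where i: "i < n" "q \<in> U i" using UcoverE by blast
      define k where "k = (LEAST k. q \<in> U k)"
      have "q \<in> U k" unfolding k_def using i(2) by (rule LeastI)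
      moreover have "q \<notin> U j" if "j < k" for j using not_less_Least that unfolding k_def by blast
      moreover have "k \<le> i" unfolding k_def using i(2) by (rule Least_le)
      ultimately show ?thesis using i(1) by (intro exI[of _ k]) (auto simp: A_def)
    qed
    then show ?thesis by blast
  qed
  define h where "h i = the_inv_into (U i) f" for i
  have h: "h i (f q) = q" if "q \<in> U i" for i q
    unfolding h_def using that injU by (simp add: the_inv_into_f_f)
  have openfU: "open (f ` U i)" for i using openU openfV by blast
  \<comment> \<open>The inverse branch is continuous only on the open image of its chart; a constant
    value elsewhere makes it Borel on the whole torus.\<close>
  define g where "g i p = (if p \<in> f ` U i then h i p else undefined)" for i p
  have g [measurable]: "g i \<in> borel \<rightarrow>\<^sub>M borel" for i
    unfolding g_def
  proof (intro borel_measurable_continuous_on_if continuous_on_const)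
    show "f ` U i \<in> sets borel" using openfU by auto
    show "continuous_on (f ` U i) (h i)"
      unfolding continuous_on_open_vimage[OF openfU]
    proof (intro allI impI)
      fix V :: "torus set" assume "open V"
      then have "open (f ` (V \<inter> U i))"
        using openU by (intro openfV[of _ i]) auto
      moreover have "h i -` V \<inter> f ` U i = f ` (V \<inter> U i)"
        using h by (auto simp: image_iff)
      ultimately show "open (h i -` V \<inter> f ` U i)" by simp
    qed
  qed
  define \<phi> where "\<phi> i p = (if p \<in> f ` U i \<and> g i p \<in> A i then \<psi> (g i p) / J (g i p) else 0)" for i p
  have [measurable]: "f ` U i \<in> sets borel" for i using openfU by auto
  have \<phi>m [measurable]: "\<phi> i \<in> borel_measurable borel" for i
    unfolding \<phi>_def by measurable
  have fib: "f -` {p} \<inter> A i = (if p \<in> f ` U i \<and> g i p \<in> A i then {g i p} else {})" for i p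
  proof (intro set_eqI iffI)
    fix q assume "q \<in> f -` {p} \<inter> A i"
    moreover from this have "q \<in> U i" using AU by auto
    moreover from this have "h i (f q) = q" by (rule h)
    moreover have "f q \<in> f ` U i" using \<open>q \<in> U i\<close> by (rule imageI)
    ultimately show "q \<in> (if p \<in> f ` U i \<and> g i p \<in> A i then {g i p} else {})"
      by (auto simp: g_def)
  next
    fix q assume "q \<in> (if p \<in> f ` U i \<and> g i p \<in> A i then {g i p} else {})"
    then have "p \<in> f ` U i" "g i p \<in> A i" "q = g i p" by (auto split: if_splits)
    moreover then obtain q' where "q' \<in> U i" "p = f q'" by blast
    ultimately show "q \<in> f -` {p} \<inter> A i" using h[of q' i] by (auto simp: g_def)
  qed
  have split: "f -` {p} = (\<Union>i<n. f -` {p} \<inter> A i)" for p using cover by blast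
  show fin: "finite (f -` {p})" for p
    by (subst split) (auto simp: fib)
  have S: "(\<Sum>q\<in>f -` {p}. \<psi> q / J q) = (\<Sum>i<n. \<phi> i p)" for p
  proof -
    have "(\<Sum>q\<in>f -` {p}. \<psi> q / J q) = (\<Sum>q\<in>(\<Union>i<n. f -` {p} \<inter> A i). \<psi> q / J q)"
      by (subst (1) split) simp
    also have "\<dots> = (\<Sum>i<n. \<Sum>q\<in>f -` {p} \<inter> A i. \<psi> q / J q)"
      by (rule sum.UNION_disjoint) (use fin disj in auto)
    also have "\<dots> = (\<Sum>i<n. \<phi> i p)"
      by (intro sum.cong) (auto simp: fib \<phi>_def)
    finally show ?thesis .
  qed
  show "(\<lambda>p. \<Sum>q\<in>f -` {p}. \<psi> q / ennreal \<bar>det (torus_jac f q)\<bar>) \<in> borel_measurable borel"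
    unfolding J_def[symmetric] S by measurable
  have "(\<integral>\<^sup>+q. \<psi> q \<partial>haar_torus) = (\<integral>\<^sup>+q. (\<Sum>i<n. \<psi> q * indicator (A i) q) \<partial>haar_torus)"
  proof (rule nn_integral_cong)
    fix q
    obtain i where i: "i < n" "q \<in> A i" using cover by blast
    have "(\<Sum>j<n. \<psi> q * indicator (A j) q) = (\<Sum>j<n. if j = i then \<psi> q else 0)"
      using i disj by (intro sum.cong) (auto simp: indicator_def)
    then show "\<psi> q = (\<Sum>j<n. \<psi> q * indicator (A j) q)" using i by simp
  qed
  also have "\<dots> = (\<Sum>i<n. \<integral>\<^sup>+q. \<psi> q * indicator (A i) q \<partial>haar_torus)"
    by (intro nn_integral_sum) measurable
  also have "\<dots> = (\<Sum>i<n. \<integral>\<^sup>+q. \<phi> i (f q) * J q * indicator (U i) q \<partial>haar_torus)"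
  proof (intro sum.cong refl nn_integral_cong)
    fix i q
    show "\<psi> q * indicator (A i) q = \<phi> i (f q) * J q * indicator (U i) q"
      using AU[of i] h[of q i] J[of q]
      by (auto simp: \<phi>_def g_def indicator_def ennreal_divide_times ennreal_divide_self less_top)
  qed
  also have "\<dots> = (\<Sum>i<n. \<integral>\<^sup>+p. \<phi> i p * indicator (f ` U i) p \<partial>haar_torus)"
    unfolding J_def by (intro sum.cong refl area_chartD[OF chart \<phi>m])
  also have "\<dots> = (\<Sum>i<n. \<integral>\<^sup>+p. \<phi> i p \<partial>haar_torus)"
    by (intro sum.cong refl nn_integral_cong) (auto simp: \<phi>_def indicator_def)
  also have "\<dots> = (\<integral>\<^sup>+p. (\<Sum>i<n. \<phi> i p) \<partial>haar_torus)"
    by (intro nn_integral_sum[symmetric]) measurable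
  finally show "(\<integral>\<^sup>+q. \<psi> q \<partial>haar_torus)
       = (\<integral>\<^sup>+p. (\<Sum>q\<in>f -` {p}. \<psi> q / ennreal \<bar>det (torus_jac f q)\<bar>) \<partial>haar_torus)"
    unfolding J_def[symmetric] S .
qed

section \<open>Norms and conorms\<close>

lemma norm_matrix_vector_mult_le:
  fixes A :: "real^2^2"
  shows "norm (A *v v) \<le> 4 * norm A * norm v"
proof -
  have "\<bar>A $ i $ j\<bar> \<le> norm A" for i j :: 2
    by (rule order_trans[OF component_le_norm_cart Finite_Cartesian_Product.norm_nth_le])
  then have "onorm ((*v) A) \<le> real CARD(2) * real CARD(2) * norm A"
    by (rule onorm_le_matrix_component)
  then have "onorm ((*v) A) * norm v \<le> 4 * norm A * norm v"
    by (intro mult_right_mono) auto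
  then show ?thesis
    using onorm[OF matrix_vector_mul_bounded_linear, of A v] by linarith
qed

lemma onorm_le_iff:
  fixes A :: "real^2^2"
  shows "onorm ((*v) A) \<le> a \<longleftrightarrow> (\<forall>v\<in>sphere 0 1. norm (A *v v) \<le> a)"
proof
  assume a: "onorm ((*v) A) \<le> a"
  show "\<forall>v\<in>sphere 0 1. norm (A *v v) \<le> a"
    using onorm[OF matrix_vector_mul_bounded_linear, of A] a by (fastforce intro: order_trans)
next
  assume a: "\<forall>v\<in>sphere 0 1. norm (A *v v) \<le> a"
  show "onorm ((*v) A) \<le> a"
  proof (rule onorm_le)
    fix v :: "real^2"
    show "norm (A *v v) \<le> a * norm v"
    proof (cases "v = 0")
      case False
      then have "norm (A *v ((1 / norm v) *\<^sub>R v)) \<le> a" using a by simp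
      then show ?thesis using False by (simp add: matrix_vector_mult_scaleR divide_simps mult.commute)
    qed simp
  qed
qed

lemma sphere_nonempty: "sphere (0::real^2) 1 \<noteq> {}"
  by simp

lemma conorm_ge_iff: "a \<le> conorm A \<longleftrightarrow> (\<forall>v\<in>sphere 0 1. a \<le> norm (A v))"
  unfolding conorm_def
  by (intro le_cINF_iff sphere_nonempty) (auto intro!: bdd_belowI2[of _ 0])

lemma conorm_mult_le:
  fixes A :: "real^2^2"
  shows "conorm ((*v) A) * norm v \<le> norm (A *v v)"
proof (cases "v = 0")
  case False
  then have "conorm ((*v) A) \<le> norm (A *v ((1 / norm v) *\<^sub>R v))"
    using conorm_ge_iff[of "conorm ((*v) A)" "(*v) A"] by auto
  then show ?thesis using False by (simp add: matrix_vector_mult_scaleR divide_simps mult.commute)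
qed simp

lemma conorm_geI:
  fixes A :: "real^2^2"
  assumes "\<And>v. a * norm v \<le> norm (A *v v)"
  shows "a \<le> conorm ((*v) A)"
  unfolding conorm_ge_iff using assms by (metis mem_sphere_0 mult.right_neutral)

text \<open>With \<open>w\<close> the vector \<open>v\<close> turned by a right angle,
  \<open>A *v v\<close> and \<open>A *v w\<close> span a parallelogram of area
  \<open>\<bar>det A\<bar>\<close>, at most the product of its sides. Turning \<open>A *v w\<close>
  back by a right angle gives \<open>b\<close> and makes the area an inner product.\<close>

lemma det_le_norms:
  fixes A :: "real^2^2"
  assumes "norm v = 1"
  shows "\<bar>det A\<bar> \<le> norm (A *v v) * onorm ((*v) A)"
proof -
  define w :: "real^2" where "w = vector [- v$2, v$1]"
  have w: "norm w = 1" using assms by (simp add: w_def norm_eq_sqrt_inner inner_vec_def sum_2 add.commute)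
  define b :: "real^2" where "b = vector [(A *v w)$2, - (A *v w)$1]"
  have v1: "v$1 * v$1 + v$2 * v$2 = 1"
    using assms by (simp add: norm_eq_sqrt_inner inner_vec_def sum_2)
  have "(A *v v) \<bullet> b = (A *v v)$1 * (A *v w)$2 - (A *v v)$2 * (A *v w)$1"
    by (simp add: b_def inner_vec_def sum_2)
  also have "\<dots> = det A * (v$1 * v$1 + v$2 * v$2)"
    by (simp add: matrix_vector_mult_def w_def sum_2 det_2 algebra_simps)
  finally have "det A = (A *v v) \<bullet> b" using v1 by simp
  then have "\<bar>det A\<bar> \<le> norm (A *v v) * norm b"
    using Cauchy_Schwarz_ineq2 by metis
  moreover have "norm b = norm (A *v w)"
    by (simp add: b_def norm_eq_sqrt_inner inner_vec_def sum_2 add.commute)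
  moreover have "norm (A *v w) \<le> onorm ((*v) A)"
    using onorm[OF matrix_vector_mul_bounded_linear, of A w] w by simp
  ultimately show ?thesis
    using mult_left_mono[of "norm b" "onorm ((*v) A)" "norm (A *v v)"] by simp
qed

lemma
  fixes A :: "real^2^2"
  assumes "det A \<noteq> 0"
  shows onorm_pos: "0 < onorm ((*v) A)" and conorm_pos: "0 < conorm ((*v) A)"
    and det_le_onorm_conorm: "\<bar>det A\<bar> \<le> onorm ((*v) A) * conorm ((*v) A)"
    and norm_inv2_le: "norm (inv2 A *v v) \<le> norm v / conorm ((*v) A)"
proof -
  have nz: "norm (A *v v) * onorm ((*v) A) \<ge> \<bar>det A\<bar>" if "norm v = 1" for v
    using det_le_norms[OF that] .
  obtain v0 :: "real^2" where v0: "norm v0 = 1" using vector_choose_size[of 1] by auto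
  have "onorm ((*v) A) \<noteq> 0" using nz[OF v0] assms by auto
  then show o: "0 < onorm ((*v) A)"
    using onorm_pos_le[OF matrix_vector_mul_bounded_linear, of A] by linarith
  have "\<bar>det A\<bar> / onorm ((*v) A) \<le> conorm ((*v) A)"
    unfolding conorm_ge_iff using nz o by (auto simp: divide_le_eq)
  then show "\<bar>det A\<bar> \<le> onorm ((*v) A) * conorm ((*v) A)"
    using o by (simp add: divide_le_eq mult.commute)
  have "0 < \<bar>det A\<bar> / onorm ((*v) A)" using assms o by simp
  then show c: "0 < conorm ((*v) A)"
    using \<open>\<bar>det A\<bar> / onorm ((*v) A) \<le> conorm ((*v) A)\<close> by linarith
  show "norm (inv2 A *v v) \<le> norm v / conorm ((*v) A)"
    using conorm_mult_le[of A "inv2 A *v v"] c by (simp add: inv2_vector[OF assms] le_divide_eq mult.commute)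
qed

lemma onorm_matrix_mult:
  fixes A B :: "real^2^2"
  shows "onorm ((*v) (A ** B)) \<le> onorm ((*v) A) * onorm ((*v) B)"
  using onorm_compose[OF matrix_vector_mul_bounded_linear matrix_vector_mul_bounded_linear, of A B]
  by (simp add: o_def matrix_vector_mul_assoc)

text \<open>Counterpart of \<open>onorm_matrix_mult\<close> from below; it gives the lower half of
  \<open>g_shift\<close> for \<open>log_onorm\<close>.\<close>

lemma onorm_mult_conorm_le:
  fixes A B :: "real^2^2"
  assumes "det B \<noteq> 0"
  shows "onorm ((*v) A) * conorm ((*v) B) \<le> onorm ((*v) (A ** B))"
proof -
  have "onorm ((*v) A) \<le> onorm ((*v) (A ** B)) / conorm ((*v) B)"
  proof (rule onorm_le)
    fix v
    have "norm (A *v v) = norm ((A ** B) *v (inv2 B *v v))"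
      by (simp add: matrix_vector_mul_assoc[symmetric] inv2_vector[OF assms])
    also have "\<dots> \<le> onorm ((*v) (A ** B)) * norm (inv2 B *v v)"
      by (rule onorm[OF matrix_vector_mul_bounded_linear])
    also have "\<dots> \<le> onorm ((*v) (A ** B)) * (norm v / conorm ((*v) B))"
      by (intro mult_left_mono norm_inv2_le assms onorm_pos_le matrix_vector_mul_bounded_linear)
    finally show "norm (A *v v) \<le> onorm ((*v) (A ** B)) / conorm ((*v) B) * norm v" by simp
  qed
  then show ?thesis using conorm_pos[OF assms] by (simp add: le_divide_eq)
qed

lemma conorm_matrix_mult:
  fixes A B :: "real^2^2"
  assumes "det A \<noteq> 0"
  shows "conorm ((*v) A) * conorm ((*v) B) \<le> conorm ((*v) (A ** B))"
proof (rule conorm_geI)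
  fix v
  have "conorm ((*v) A) * (conorm ((*v) B) * norm v) \<le> conorm ((*v) A) * norm (B *v v)"
    using conorm_pos[OF assms] by (intro mult_left_mono conorm_mult_le) auto
  also have "\<dots> \<le> norm (A *v (B *v v))" by (rule conorm_mult_le)
  finally show "conorm ((*v) A) * conorm ((*v) B) * norm v \<le> norm (A ** B *v v)"
    by (simp add: matrix_vector_mul_assoc mult.assoc)
qed

text \<open>Counterpart of \<open>conorm_matrix_mult\<close> from above; it gives the lower half of
  \<open>g_shift\<close> for \<open>log_conorm\<close>, where the sign is reversed.\<close>

lemma conorm_mult_onorm_ge:
  fixes A B :: "real^2^2"
  assumes A: "det A \<noteq> 0" and B: "det B \<noteq> 0"
  shows "conorm ((*v) (A ** B)) \<le> conorm ((*v) A) * onorm ((*v) B)"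
proof -
  have "conorm ((*v) (A ** B)) / onorm ((*v) B) \<le> conorm ((*v) A)"
  proof (rule conorm_geI)
    fix v
    have "norm v \<le> onorm ((*v) B) * norm (inv2 B *v v)"
      using onorm[OF matrix_vector_mul_bounded_linear, of B "inv2 B *v v"] inv2_vector[OF B] by simp
    then have "conorm ((*v) (A ** B)) / onorm ((*v) B) * norm v
        \<le> conorm ((*v) (A ** B)) / onorm ((*v) B) * (onorm ((*v) B) * norm (inv2 B *v v))"
      using onorm_pos[OF B] conorm_pos[of "A ** B"] A B
      by (intro mult_left_mono) (auto simp: det_mul)
    also have "\<dots> = conorm ((*v) (A ** B)) * norm (inv2 B *v v)"
      using onorm_pos[OF B] by simp
    also have "\<dots> \<le> norm (A ** B *v (inv2 B *v v))" by (rule conorm_mult_le)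
    also have "\<dots> = norm (A *v v)"
      by (simp add: matrix_vector_mul_assoc[symmetric] inv2_vector[OF B])
    finally show "conorm ((*v) (A ** B)) / onorm ((*v) B) * norm v \<le> norm (A *v v)" .
  qed
  then show ?thesis using onorm_pos[OF B] by (simp add: divide_le_eq)
qed

section \<open>Volume preserving endomorphisms\<close>

locale torus_endo =
  fixes f :: "torus \<Rightarrow> torus"
  assumes regular: "C1_regular f"
    and invariant: "distr haar_torus haar_torus f = haar_torus"
begin

lemma f_measurable [measurable]: "f \<in> haar_torus \<rightarrow>\<^sub>M haar_torus"
proof -
  have "f \<in> borel \<rightarrow>\<^sub>M borel"
    by (intro borel_measurable_continuous_onI C1_regular_continuous regular)
  then show ?thesis by (simp cong: measurable_cong_sets)
qed

sublocale measure_preserving_map haar_torus f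
  by unfold_locales (auto simp: invariant)

lemma torus_endo_funpow: "torus_endo (f ^^ n)"
  by unfold_locales (auto simp: C1_regular_funpow regular distr_funpow)

lemma AE_funpow:
  assumes "AE p in haar_torus. P p"
  shows "AE q in haar_torus. P ((f ^^ n) q)"
proof -
  have "AE p in distr haar_torus haar_torus (f ^^ n). P p"
    unfolding distr_funpow by (rule assms)
  then show ?thesis by (rule AE_distrD[OF funpow_measurable])
qed

lemma finite_preimage: "finite (f -` {p})"
  using area_formula(1)[OF regular, of "\<lambda>_. 0"] by simp

text \<open>By the area formula, the sum of the weights is the density of the image of Haar measure
  under \<open>f\<close>; invariance makes this density 1.\<close>

lemma weight_sum:
  "AE p in haar_torus. (\<Sum>q\<in>f -` {p}. 1 / \<bar>det (torus_jac f q)\<bar>) = 1"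
proof -
  define S where "S p = (\<Sum>q\<in>f -` {p}. 1 / ennreal \<bar>det (torus_jac f q)\<bar>)" for p
  have S [measurable]: "S \<in> borel_measurable haar_torus"
    unfolding S_def using area_formula(2)[OF regular, of "\<lambda>_. 1"] by simp
  have "density haar_torus S = density haar_torus (\<lambda>_. 1)"
  proof (rule measure_eqI)
    fix X assume "X \<in> sets (density haar_torus S)"
    then have X [measurable]: "X \<in> sets borel" by simp
    have fb [measurable]: "f \<in> borel \<rightarrow>\<^sub>M borel"
      by (intro borel_measurable_continuous_onI C1_regular_continuous regular)
    have "emeasure (density haar_torus S) X = (\<integral>\<^sup>+p. S p * indicator X p \<partial>haar_torus)"
      by (subst emeasure_density) auto
    also have "\<dots> = (\<integral>\<^sup>+p. (\<Sum>q\<in>f -` {p}. indicator X (f q) / ennreal \<bar>det (torus_jac f q)\<bar>) \<partial>haar_torus)"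
    proof (rule nn_integral_cong)
      fix p
      have "(\<Sum>q\<in>f -` {p}. indicator X (f q) / ennreal \<bar>det (torus_jac f q)\<bar>)
         = (\<Sum>q\<in>f -` {p}. 1 / ennreal \<bar>det (torus_jac f q)\<bar> * indicator X p)"
        by (intro sum.cong) (auto simp: indicator_def)
      then show "S p * indicator X p = (\<Sum>q\<in>f -` {p}. indicator X (f q) / ennreal \<bar>det (torus_jac f q)\<bar>)"
        by (simp add: S_def sum_distrib_right)
    qed
    also have "\<dots> = (\<integral>\<^sup>+q. indicator X (f q) \<partial>haar_torus)"
      by (rule area_formula(3)[OF regular, symmetric]) measurable
    also have "\<dots> = (\<integral>\<^sup>+p. indicator X p \<partial>distr haar_torus haar_torus f)"
      by (subst nn_integral_distr) auto
    also have "\<dots> = emeasure (density haar_torus (\<lambda>_. 1)) X"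
      by (simp add: invariant emeasure_density)
    finally show "emeasure (density haar_torus S) X = emeasure (density haar_torus (\<lambda>_. 1)) X" .
  qed simp
  then have "AE p in haar_torus. S p = 1"
    by (intro haar.density_unique) auto
  then show ?thesis
  proof eventually_elim
    case (elim p)
    have "S p = (\<Sum>q\<in>f -` {p}. ennreal (1 / \<bar>det (torus_jac f q)\<bar>))"
      unfolding S_def using torus_jac_det_nonzero[OF regular]
      by (intro sum.cong) (auto simp: divide_ennreal[symmetric])
    also have "\<dots> = ennreal (\<Sum>q\<in>f -` {p}. 1 / \<bar>det (torus_jac f q)\<bar>)"
      by (intro sum_ennreal) auto
    finally show ?case using elim by (simp add: sum_nonneg)
  qed
qed

text \<open>For the indicator of a null set the integral in the area formula is 0; as all weights
  are positive, almost no point has a preimage in the null set.\<close>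

lemma AE_preimages:
  assumes "AE q in haar_torus. P q"
  shows "AE p in haar_torus. \<forall>q\<in>f -` {p}. P q"
proof -
  obtain N where N: "{q. \<not> P q} \<subseteq> N" "N \<in> sets haar_torus" "emeasure haar_torus N = 0"
    using assms by (auto elim!: AE_E)
  then have N' [measurable]: "N \<in> sets borel" by simp
  have "0 = (\<integral>\<^sup>+q. indicator N q \<partial>haar_torus)" using N by simp
  also have "\<dots> = (\<integral>\<^sup>+p. (\<Sum>q\<in>f -` {p}. indicator N q / ennreal \<bar>det (torus_jac f q)\<bar>) \<partial>haar_torus)"
    by (rule area_formula(3)[OF regular]) measurable
  finally have "AE p in haar_torus. (\<Sum>q\<in>f -` {p}. indicator N q / ennreal \<bar>det (torus_jac f q)\<bar>) = 0"
    using area_formula(2)[OF regular, of "indicator N"] by (subst (asm) eq_commute, subst (asm) nn_integral_0_iff_AE) auto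
  then show ?thesis
  proof eventually_elim
    case (elim p)
    then have "\<forall>q\<in>f -` {p}. indicator N q / ennreal \<bar>det (torus_jac f q)\<bar> = 0"
      using finite_preimage by (simp add: sum_eq_0_iff)
    moreover have "1 / ennreal \<bar>det (torus_jac f q)\<bar> \<noteq> 0" for q
    proof -
      have "1 / ennreal \<bar>det (torus_jac f q)\<bar> = ennreal (1 / \<bar>det (torus_jac f q)\<bar>)"
        using torus_jac_det_nonzero[OF regular] by (simp add: divide_ennreal[symmetric])
      then show ?thesis using torus_jac_det_nonzero[OF regular] by simp
    qed
    ultimately have "\<forall>q\<in>f -` {p}. q \<notin> N" by (auto simp: indicator_def split: if_splits)
    then show ?case using N(1) by auto
  qed
qed

lemma AE_det_ge_1: "AE q in haar_torus. 1 \<le> \<bar>det (torus_jac f q)\<bar>"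
proof -
  have "AE p in haar_torus. \<forall>q\<in>f -` {p}. 1 \<le> \<bar>det (torus_jac f q)\<bar>"
    using weight_sum
  proof eventually_elim
    case (elim p)
    show ?case
    proof
      fix q assume "q \<in> f -` {p}"
      then have "1 / \<bar>det (torus_jac f q)\<bar> \<le> 1"
        using member_le_sum[of q "f -` {p}" "\<lambda>q. 1 / \<bar>det (torus_jac f q)\<bar>"] finite_preimage elim by auto
      then show "1 \<le> \<bar>det (torus_jac f q)\<bar>"
        using torus_jac_det_nonzero[OF regular, of q] by (simp add: divide_le_eq)
    qed
  qed
  \<comment> \<open>Invariance moves the statement from \<open>p\<close> to \<open>f q\<close>,
    which has \<open>q\<close> among its preimages.\<close>
  then have "AE q in haar_torus. \<forall>q'\<in>f -` {f q}. 1 \<le> \<bar>det (torus_jac f q')\<bar>"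
    using AE_funpow[of _ 1] by simp
  then show ?thesis by eventually_elim auto
qed

end

section \<open>The recursion for \<open>I_chi\<close> along preimages\<close>

lemma I_chi_jac:
  assumes "C1_regular f"
  shows "I_chi f n x v = (\<Sum>y\<in>(f ^^ n) -` {x}.
    ln (norm (inv2 (torus_jac (f ^^ n) y) *v v)) / \<bar>det (torus_jac (f ^^ n) y)\<bar>)"
proof -
  have r: "C1_regular (f ^^ n)" by (rule C1_regular_funpow[OF assms])
  show ?thesis
    unfolding I_chi_def torus_jac_def[symmetric] torus_deriv_jac[OF r]
      inv_matrix_vector_mult[OF torus_jac_det_nonzero[OF r]]
    by simp
qed

text \<open>The transfer operator of \<open>f ^^ n\<close> applied to the constant 1. If
  \<open>f\<close> preserves the measure, it is 1 almost everywhere by \<open>weight_sum\<close> for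
  the iterate.\<close>

definition weight :: "(torus \<Rightarrow> torus) \<Rightarrow> nat \<Rightarrow> torus \<Rightarrow> real" where
  "weight f n x = (\<Sum>y\<in>(f ^^ n) -` {x}. 1 / \<bar>det (torus_jac (f ^^ n) y)\<bar>)"

lemma finite_preimages: "C1_regular f \<Longrightarrow> finite ((f ^^ n) -` {x})"
  using area_formula(1)[OF C1_regular_funpow, of f "\<lambda>_. 0"] by simp

lemma sum_preimages_Suc:
  fixes \<phi> :: "torus \<Rightarrow> real"
  assumes "C1_regular f"
  shows "(\<Sum>z\<in>(f ^^ Suc n) -` {x}. \<phi> z) = (\<Sum>y\<in>f -` {x}. \<Sum>z\<in>(f ^^ n) -` {y}. \<phi> z)"
proof -
  have "(f ^^ Suc n) -` {x} = (\<Union>y\<in>f -` {x}. (f ^^ n) -` {y})" by auto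
  then show ?thesis
    using finite_preimages[OF assms, of n] finite_preimages[OF assms, of 1 x]
    by (simp, subst sum.UNION_disjoint) auto
qed

lemma torus_jac_funpow_Suc:
  assumes "C1_regular f"
  shows "torus_jac (f ^^ Suc n) z = torus_jac f ((f ^^ n) z) ** torus_jac (f ^^ n) z"
  using torus_jac_funpow_add[OF assms, of n 1 z] by simp

text \<open>The preimages under \<open>f ^^ Suc n\<close> are grouped by their images
  \<open>y\<close> under \<open>f ^^ n\<close>. The determinant and the inverse Jacobian factor
  accordingly, and the inverse of the step from \<open>y\<close> to \<open>x\<close> acts on
  \<open>v\<close> first.\<close>

lemma I_chi_Suc:
  assumes f: "C1_regular f"
  shows "I_chi f (Suc n) x v = (\<Sum>y\<in>f -` {x}. I_chi f n y (inv2 (torus_jac f y) *v v) / \<bar>det (torus_jac f y)\<bar>)"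
proof -
  have *: "det (torus_jac (f ^^ n) z) \<noteq> 0" for z n
    by (rule torus_jac_det_nonzero[OF C1_regular_funpow[OF f]])
  have **: "det (torus_jac f z) \<noteq> 0" for z by (rule torus_jac_det_nonzero[OF f])
  show ?thesis
    unfolding I_chi_jac[OF f] sum_preimages_Suc[OF f] sum_divide_distrib
  proof (intro sum.cong refl)
    fix y z assume "y \<in> f -` {x}" "z \<in> (f ^^ n) -` {y}"
    then have "(f ^^ n) z = y" by auto
    then show "ln (norm (inv2 (torus_jac (f ^^ Suc n) z) *v v)) / \<bar>det (torus_jac (f ^^ Suc n) z)\<bar>
      = ln (norm (inv2 (torus_jac (f ^^ n) z) *v (inv2 (torus_jac f y) *v v))) /
        \<bar>det (torus_jac (f ^^ n) z)\<bar> / \<bar>det (torus_jac f y)\<bar>"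
      by (simp only: torus_jac_funpow_Suc[OF f] inv2_mult[OF ** *] matrix_vector_mul_assoc det_mul abs_mult)
         (simp add: mult.commute)
  qed
qed

lemma inv2_vector_nonzero: "det A \<noteq> 0 \<Longrightarrow> v \<noteq> 0 \<Longrightarrow> inv2 A *v v \<noteq> 0"
  by (metis inv2_vector(2) matrix_vector_mult_0_right)

text \<open>The length of the vector splits off from the logarithm, with the total weight as factor;
  this brings the recursion back to unit vectors.\<close>

lemma I_chi_scale:
  assumes f: "C1_regular f" and "v \<noteq> 0"
  shows "I_chi f n x v = ln (norm v) * weight f n x + I_chi f n x ((1 / norm v) *\<^sub>R v)"
proof -
  have eq: "ln (norm (inv2 (torus_jac (f ^^ n) y) *v v)) =
      ln (norm v) + ln (norm (inv2 (torus_jac (f ^^ n) y) *v ((1 / norm v) *\<^sub>R v)))" for y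
  proof -
    have "norm (inv2 (torus_jac (f ^^ n) y) *v v) > 0"
      using inv2_vector_nonzero[OF torus_jac_det_nonzero[OF C1_regular_funpow[OF f]] assms(2)] by auto
    then show ?thesis using assms(2) by (simp add: matrix_vector_mult_scaleR ln_div)
  qed
  show ?thesis
    unfolding I_chi_jac[OF f] weight_def sum_distrib_left sum.distrib[symmetric]
    by (rule sum.cong[OF refl], subst eq) (simp only: add_divide_distrib times_divide_eq_right mult_1_right)
qed

lemma I_chi_1:
  assumes f: "C1_regular f"
  shows "I_chi f 1 x v = (\<Sum>y\<in>f -` {x}. ln (norm (inv2 (torus_jac f y) *v v)) / \<bar>det (torus_jac f y)\<bar>)"
  using I_chi_jac[OF f, of 1] by simp

section \<open>Local diffeomorphisms\<close>

lemma C1_onE: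
  fixes F :: "real^2 \<Rightarrow> real^2"
  assumes "C1_on S F" "open S"
  obtains D where "continuous_on S D" "\<And>y. y \<in> S \<Longrightarrow> (F has_derivative (*v) (D y)) (at y)"
proof -
  obtain F' where F': "continuous_on S F'"
    "\<And>y. y \<in> S \<Longrightarrow> (F has_derivative blinfun_apply (F' y)) (at y within S)"
    using assms(1) unfolding C1_on_def by blast
  have "continuous_on S (\<lambda>y. matrix (blinfun_apply (F' y)))"
    unfolding matrix_def by (intro continuous_intros F'(1))
  moreover have "(F has_derivative (*v) (matrix (blinfun_apply (F' y)))) (at y)" if "y \<in> S" for y
  proof -
    have "(*v) (matrix (blinfun_apply (F' y))) = blinfun_apply (F' y)"
      by (rule matrix_vector_mul(2)[OF bounded_linear.linear[OF blinfun.bounded_linear_right]])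
    then show ?thesis using F'(2)[OF that] at_within_open[OF that assms(2)] by simp
  qed
  ultimately show ?thesis by (rule that)
qed

lemma torus_C1_onD:
  assumes "torus_C1_on U f" "proj x \<in> U"
  shows "\<exists>W F. open W \<and> x \<in> W \<and> C1_on (proj -` U \<inter> W) F \<and>
      (\<forall>y\<in>proj -` U \<inter> W. f (proj y) = proj (F y))"
proof -
  have "x \<in> proj -` U" using assms(2) by simp
  with assms(1)[unfolded torus_C1_on_def lifts_locally_def o_def] show ?thesis
    by (rule bspec)
qed

text \<open>Lifts \<open>F\<close> of \<open>f\<close> and \<open>G\<close> of the local inverse
  compose to a lift of the identity, which may differ from the identity by an integer vector.
  Uniqueness of torus derivatives still makes the product of the Jacobians the unit matrix.\<close>

lemma C1_local_diffeo_regular: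
  assumes "C1_local_diffeo f"
  shows "C1_regular f"
  unfolding C1_regular_def
proof
  fix x
  obtain U g where U: "open U" "proj x \<in> U" "open (f ` U)" "homeomorphism U (f ` U) f g"
    "torus_C1_on U f" "torus_C1_on (f ` U) g"
    using assms unfolding C1_local_diffeo_def by blast
  have openU: "open (proj -` U)" "open (proj -` f ` U)"
    using U(1,3) by (auto simp: open_torus_def)
  obtain W F where W: "open W" "x \<in> W" "C1_on (proj -` U \<inter> W) F"
    "\<forall>y\<in>proj -` U \<inter> W. f (proj y) = proj (F y)"
    using torus_C1_onD[OF U(5,2)] by (elim exE conjE) (rule that)
  note W4 = W(4)[THEN bspec]
  obtain D where D: "continuous_on (proj -` U \<inter> W) D"
    "\<And>y. y \<in> proj -` U \<inter> W \<Longrightarrow> (F has_derivative (*v) (D y)) (at y)"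
    by (rule C1_onE[OF W(3) open_Int[OF openU(1) W(1)]]) (rule that; blast)
  have contF: "continuous_on (proj -` U \<inter> W) F"
    using D(2) by (meson has_derivative_at_withinI has_derivative_continuous_on)
  have x: "x \<in> proj -` U \<inter> W" using U(2) W(2) by auto
  then have Fx: "proj (F x) \<in> f ` U" using W4[of x] U(2) by (metis imageI)
  obtain V G where V: "open V" "F x \<in> V" "C1_on (proj -` f ` U \<inter> V) G"
    "\<forall>z\<in>proj -` f ` U \<inter> V. g (proj z) = proj (G z)"
    using torus_C1_onD[OF U(6) Fx] by (elim exE conjE) (rule that)
  obtain D' where D': "\<And>z. z \<in> proj -` f ` U \<inter> V \<Longrightarrow> (G has_derivative (*v) (D' z)) (at z)"
    by (rule C1_onE[OF V(3) open_Int[OF openU(2) V(1)]]) (rule that; blast)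
  define X where "X = (proj -` U \<inter> W) \<inter> F -` V"
  have X: "open X" "x \<in> X" "X \<subseteq> proj -` U \<inter> W"
    using contF openU(1) W(1) V(1,2) x unfolding X_def
    by (auto intro: continuous_open_preimage)
  have FX: "F y \<in> proj -` f ` U \<inter> V" if "y \<in> X" for y
  proof -
    have "proj (F y) = f (proj y)" "proj y \<in> U" "F y \<in> V" using that W4[of y] by (auto simp: X_def)
    then show ?thesis by (metis IntI imageI vimageI)
  qed
  have "det (D y) \<noteq> 0" if y: "y \<in> X" for y
  proof -
    have "((\<lambda>y. G (F y)) has_derivative (\<lambda>h. D' (F y) *v (D y *v h))) (at y)"
      using y X(3) FX by (intro has_derivative_compose[OF D(2) D']) auto
    moreover have "\<forall>\<^sub>F z in nhds y. id (proj z) = proj (G (F z))"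
    proof -
      have "id (proj z) = proj (G (F z))" if "z \<in> X" for z
      proof -
        have "g (proj (F z)) = proj (G (F z))" by (rule V(4)[THEN bspec, OF FX[OF that]])
        moreover have "proj (F z) = f (proj z)"
          by (rule W4[symmetric]) (use that X(3) in blast)
        moreover have "g (f (proj z)) = proj z"
          using U(4) that X(3) by (intro homeomorphism_apply1[OF U(4)]) auto
        ultimately show ?thesis by simp
      qed
      then show ?thesis using eventually_nhds_in_open[OF X(1) y] by (rule eventually_mono[rotated])
    qed
    ultimately have "torus_has_derivative id (proj y) (\<lambda>h. D' (F y) *v (D y *v h))"
      unfolding torus_has_derivative_def
      by (intro exI[of _ y] exI[of _ "\<lambda>y. G (F y)"] conjI refl)
    moreover have "torus_has_derivative id (proj y) (\<lambda>h. h)"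
      unfolding torus_has_derivative_def
      by (intro exI[of _ y] exI[of _ "\<lambda>y. y"]) (auto intro: has_derivative_ident)
    ultimately have "(\<lambda>h. D' (F y) *v (D y *v h)) = (\<lambda>h. h)"
      by (rule torus_has_derivative_unique)
    then have "(D' (F y) ** D y) *v h = mat 1 *v h" for h
      by (simp add: matrix_vector_mul_assoc[symmetric] fun_eq_iff)
    then have "D' (F y) ** D y = mat 1" by (simp add: matrix_eq)
    then have "det (D' (F y)) * det (D y) = 1" by (metis det_I det_mul)
    then show ?thesis by auto
  qed
  moreover have "f (proj y) = proj (F y)" "(F has_derivative (*v) (D y)) (at y)" if "y \<in> X" for y
    using X(3) that by (auto intro!: W4 D(2))
  ultimately show "\<exists>W F D. open W \<and> x \<in> W \<and> continuous_on W D \<and>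
     (\<forall>y\<in>W. f (proj y) = proj (F y) \<and> (F has_derivative (*v) (D y)) (at y) \<and> det (D y) \<noteq> 0)"
    using X(1,2) continuous_on_subset[OF D(1) X(3)]
    by (intro exI[of _ X] exI[of _ F] exI[of _ D]) auto
qed

lemma End1_torus_endo: "f \<in> End1 \<Longrightarrow> torus_endo f"
  by (simp add: End1_def torus_endo_def C1_local_diffeo_regular)

section \<open>Lyapunov exponents\<close>

text \<open>The Jacobian and its inverse are continuous on the compact torus.\<close>

lemma torus_jac_bounds:
  assumes f: "C1_regular f"
  shows "\<exists>K\<ge>1. \<forall>p. onorm ((*v) (torus_jac f p)) \<le> K \<and> 1 / K \<le> conorm ((*v) (torus_jac f p))"
proof -
  have det: "det (torus_jac f p) \<noteq> 0" for p by (rule torus_jac_det_nonzero[OF f])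
  have c: "continuous_on UNIV (\<lambda>p. torus_jac f p $ i $ j)" for i j
    by (intro continuous_intros torus_jac_continuous f)
  have "continuous_on UNIV (\<lambda>p. inv2 (torus_jac f p))"
  proof -
    have cd: "continuous_on UNIV (\<lambda>p. det (torus_jac f p))" unfolding det_2 by (intro continuous_intros c)
    have "inv2 A = (\<chi> i j. if i = 1 then (if j = 1 then A$2$2 / det A else - A$1$2 / det A)
        else (if j = 1 then - A$2$1 / det A else A$1$1 / det A))" for A :: "real^2^2"
      by (simp add: inv2_def vec_eq_iff forall_2)
    moreover have "continuous_on UNIV (\<lambda>p. if i = 1
        then (if j = 1 then torus_jac f p$2$2 / det (torus_jac f p) else - torus_jac f p$1$2 / det (torus_jac f p))
        else (if j = 1 then - torus_jac f p$2$1 / det (torus_jac f p) else torus_jac f p$1$1 / det (torus_jac f p)))"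
      for i j :: 2
      by (cases "i = 1"; cases "j = 1") (auto intro!: continuous_intros c cd simp: det)
    ultimately show ?thesis by (simp add: continuous_on_vec_lambda)
  qed
  then have "bounded (range (\<lambda>p. inv2 (torus_jac f p)))" "bounded (range (torus_jac f))"
    using torus_jac_continuous[OF f] compact_UNIV_torus
    by (auto intro!: compact_imp_bounded compact_continuous_image)
  then obtain a b where a: "\<And>p. norm (inv2 (torus_jac f p)) \<le> a" and b: "\<And>p. norm (torus_jac f p) \<le> b"
    unfolding bounded_iff by blast
  define K where "K = max 1 (max (4 * a) (4 * b))"
  have K: "K \<ge> 1" "4 * a \<le> K" "4 * b \<le> K" by (auto simp: K_def)
  have "onorm ((*v) (torus_jac f p)) \<le> K" for p
  proof (rule onorm_le)
    fix v
    have "norm (torus_jac f p *v v) \<le> 4 * norm (torus_jac f p) * norm v"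
      by (rule norm_matrix_vector_mult_le)
    also have "\<dots> \<le> K * norm v" using b[of p] K by (intro mult_right_mono) auto
    finally show "norm (torus_jac f p *v v) \<le> K * norm v" .
  qed
  moreover have "1 / K \<le> conorm ((*v) (torus_jac f p))" for p
  proof (rule conorm_geI)
    fix v
    have "norm v = norm (inv2 (torus_jac f p) *v (torus_jac f p *v v))"
      by (simp add: inv2_vector[OF det])
    also have "\<dots> \<le> 4 * norm (inv2 (torus_jac f p)) * norm (torus_jac f p *v v)"
      by (rule norm_matrix_vector_mult_le)
    also have "\<dots> \<le> K * norm (torus_jac f p *v v)" using a[of p] K by (intro mult_right_mono) auto
    finally show "1 / K * norm v \<le> norm (torus_jac f p *v v)" using K by (simp add: divide_le_eq mult.commute)
  qed
  ultimately show ?thesis using K by blast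
qed

context torus_endo
begin

abbreviation "Jac n p \<equiv> torus_jac (f ^^ n) p"

lemma det_Jac: "det (Jac n p) \<noteq> 0"
  by (rule torus_jac_det_nonzero[OF C1_regular_funpow[OF regular]])

lemma onorm_Jac_pos: "0 < onorm ((*v) (Jac n p))" and conorm_Jac_pos: "0 < conorm ((*v) (Jac n p))"
  by (simp_all add: onorm_pos conorm_pos det_Jac)

definition log_onorm :: "nat \<Rightarrow> torus \<Rightarrow> real" where
  "log_onorm n p = ln (onorm ((*v) (Jac n p)))"

text \<open>With this sign it is the logarithm of the norm of the inverse of \<open>Jac n p\<close>,
  hence subadditive, and its averages tend to minus the lower exponent.\<close>

definition log_conorm :: "nat \<Rightarrow> torus \<Rightarrow> real" where
  "log_conorm n p = - ln (conorm ((*v) (Jac n p)))"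

definition jac_bound :: real where
  "jac_bound = (SOME K. K \<ge> 1 \<and> (\<forall>p. onorm ((*v) (torus_jac f p)) \<le> K \<and> 1 / K \<le> conorm ((*v) (torus_jac f p))))"

lemma jac_bound: "jac_bound \<ge> 1" "onorm ((*v) (torus_jac f p)) \<le> jac_bound"
  "1 / jac_bound \<le> conorm ((*v) (torus_jac f p))"
  using someI_ex[OF torus_jac_bounds[OF regular]] unfolding jac_bound_def by auto

lemma conorm_le_onorm:
  fixes A :: "real^2^2"
  shows "conorm ((*v) A) \<le> onorm ((*v) A)"
proof -
  obtain v0 :: "real^2" where v0: "norm v0 = 1" using vector_choose_size[of 1] by auto
  then show ?thesis
    using conorm_mult_le[of A v0] onorm[OF matrix_vector_mul_bounded_linear, of A v0] by simp
qed

lemma Jac_Suc: "Jac (Suc n) p = Jac n (f p) ** torus_jac f p"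
  using torus_jac_funpow_add[OF regular, of 1 n p] by simp

lemma continuous_norm_Jac: "continuous_on UNIV (\<lambda>p. norm (Jac n p *v v))"
proof -
  have "continuous_on UNIV (\<lambda>p. Jac n p *v v)"
    unfolding matrix_vector_mult_def
    by (intro continuous_intros torus_jac_continuous C1_regular_funpow regular)
  then show ?thesis by (intro continuous_intros)
qed

lemma measurable_onorm: "(\<lambda>p. onorm ((*v) (Jac n p))) \<in> borel_measurable haar_torus"
  unfolding borel_measurable_iff_le
proof
  fix a
  have "{p \<in> space haar_torus. onorm ((*v) (Jac n p)) \<le> a} = (\<Inter>v\<in>sphere 0 1. {p. norm (Jac n p *v v) \<le> a})"
    by (auto simp: onorm_le_iff)
  also have "closed \<dots>"
    by (intro closed_INT ballI closed_Collect_le continuous_norm_Jac continuous_on_const)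
  finally show "{p \<in> space haar_torus. onorm ((*v) (Jac n p)) \<le> a} \<in> sets haar_torus" by auto
qed

lemma measurable_conorm: "(\<lambda>p. conorm ((*v) (Jac n p))) \<in> borel_measurable haar_torus"
  unfolding borel_measurable_iff_ge
proof
  fix a
  have "{p \<in> space haar_torus. a \<le> conorm ((*v) (Jac n p))} = (\<Inter>v\<in>sphere 0 1. {p. a \<le> norm (Jac n p *v v)})"
    by (auto simp: conorm_ge_iff)
  also have "closed \<dots>"
    by (intro closed_INT ballI closed_Collect_le continuous_norm_Jac continuous_on_const)
  finally show "{p \<in> space haar_torus. a \<le> conorm ((*v) (Jac n p))} \<in> sets haar_torus" by auto
qed

lemma onorm_conorm_id: "onorm ((*v) (mat 1 :: real^2^2)) = 1" "conorm ((*v) (mat 1 :: real^2^2)) = 1"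
proof -
  have "onorm ((*v) (mat 1 :: real^2^2)) \<le> 1" by (simp add: onorm_le_iff)
  moreover have "1 \<le> conorm ((*v) (mat 1 :: real^2^2))" by (simp add: conorm_ge_iff)
  ultimately show "onorm ((*v) (mat 1 :: real^2^2)) = 1" "conorm ((*v) (mat 1 :: real^2^2)) = 1"
    using conorm_le_onorm[of "mat 1"] by auto
qed

lemma ln_le_add:
  fixes a b c :: real
  assumes "0 < a" "0 < b" "0 < c" "a \<le> b * c"
  shows "ln a \<le> ln b + ln c"
  using assms by (metis ln_mono ln_mult_pos mult_pos_pos)

lemma ln_jac_bound:
  "ln (onorm ((*v) (torus_jac f p))) \<le> ln jac_bound" "- ln jac_bound \<le> ln (onorm ((*v) (torus_jac f p)))"
  "ln (conorm ((*v) (torus_jac f p))) \<le> ln jac_bound" "- ln jac_bound \<le> ln (conorm ((*v) (torus_jac f p)))"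
proof -
  have pos: "0 < conorm ((*v) (torus_jac f p))" "conorm ((*v) (torus_jac f p)) \<le> onorm ((*v) (torus_jac f p))"
    using conorm_Jac_pos[of 1] conorm_le_onorm by auto
  have "ln (1 / jac_bound) \<le> ln (conorm ((*v) (torus_jac f p)))"
    using jac_bound(1,3) by (intro ln_mono) auto
  then show *: "- ln jac_bound \<le> ln (conorm ((*v) (torus_jac f p)))"
    using jac_bound(1) by (simp add: ln_div)
  show **: "ln (onorm ((*v) (torus_jac f p))) \<le> ln jac_bound"
    using pos jac_bound(2) by (intro ln_mono) auto
  have "ln (conorm ((*v) (torus_jac f p))) \<le> ln (onorm ((*v) (torus_jac f p)))"
    using pos by (intro ln_mono) auto
  with * ** show "- ln jac_bound \<le> ln (onorm ((*v) (torus_jac f p)))"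
    "ln (conorm ((*v) (torus_jac f p))) \<le> ln jac_bound" by auto
qed

sublocale top: bounded_subadditive haar_torus f log_onorm "ln jac_bound"
proof
  show "log_onorm n \<in> borel_measurable haar_torus" for n
    unfolding log_onorm_def using measurable_onorm by measurable
  show "log_onorm 0 x = 0" for x
    by (simp add: log_onorm_def C1_regular_id[unfolded id_def] onorm_conorm_id id_def)
  show "log_onorm (n + m) x \<le> log_onorm n x + log_onorm m ((f ^^ n) x)" for n m x
    unfolding log_onorm_def torus_jac_funpow_add[OF regular]
    using onorm_pos[of "Jac m ((f ^^ n) x) ** Jac n x"]
    by (subst add.commute, intro ln_le_add onorm_matrix_mult onorm_Jac_pos) (simp add: det_mul det_Jac)
  show "\<bar>log_onorm (Suc n) x - log_onorm n (f x)\<bar> \<le> ln jac_bound" for n x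
  proof -
    have d: "det (torus_jac f x) \<noteq> 0" using det_Jac[of 1] by simp
    have p: "0 < onorm ((*v) (Jac n (f x) ** torus_jac f x))" "0 < conorm ((*v) (torus_jac f x))"
      "0 < onorm ((*v) (torus_jac f x))"
      using d by (auto intro!: onorm_pos conorm_pos simp: det_mul det_Jac)
    have "ln (onorm ((*v) (Jac n (f x) ** torus_jac f x))) \<le> ln (onorm ((*v) (Jac n (f x)))) + ln (onorm ((*v) (torus_jac f x)))"
      by (intro ln_le_add onorm_matrix_mult onorm_Jac_pos p)
    moreover have "ln (onorm ((*v) (Jac n (f x)))) + ln (conorm ((*v) (torus_jac f x))) \<le> ln (onorm ((*v) (Jac n (f x) ** torus_jac f x)))"
      using onorm_mult_conorm_le[OF d, of "Jac n (f x)"] onorm_Jac_pos[of n "f x"] p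
      by (subst ln_mult_pos[symmetric]) (auto intro!: ln_mono)
    ultimately show ?thesis
      using ln_jac_bound[of x] by (simp add: log_onorm_def Jac_Suc abs_le_iff del: funpow.simps)
  qed
qed

sublocale bot: bounded_subadditive haar_torus f log_conorm "ln jac_bound"
proof
  show "log_conorm n \<in> borel_measurable haar_torus" for n
    unfolding log_conorm_def using measurable_conorm by measurable
  show "log_conorm 0 x = 0" for x
    by (simp add: log_conorm_def C1_regular_id[unfolded id_def] onorm_conorm_id id_def)
  have mult: "ln (conorm ((*v) A)) + ln (conorm ((*v) B)) \<le> ln (conorm ((*v) (A ** B)))"
    if "det A \<noteq> 0" "det B \<noteq> 0" for A B :: "real^2^2"
    using conorm_matrix_mult[OF that(1), of B] conorm_pos[OF that(1)] conorm_pos[OF that(2)]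
    by (subst ln_mult_pos[symmetric]) (auto intro!: ln_mono)
  show "log_conorm (n + m) x \<le> log_conorm n x + log_conorm m ((f ^^ n) x)" for n m x
    unfolding log_conorm_def torus_jac_funpow_add[OF regular]
    using mult[OF det_Jac det_Jac, of m "(f ^^ n) x" n x] by simp
  show "\<bar>log_conorm (Suc n) x - log_conorm n (f x)\<bar> \<le> ln jac_bound" for n x
  proof -
    have d: "det (torus_jac f x) \<noteq> 0" using det_Jac[of 1] by simp
    have "ln (conorm ((*v) (Jac n (f x) ** torus_jac f x))) \<le> ln (conorm ((*v) (Jac n (f x)))) + ln (onorm ((*v) (torus_jac f x)))"
      using d by (intro ln_le_add conorm_mult_onorm_ge conorm_pos onorm_pos) (auto simp: det_mul det_Jac)
    moreover note mult[OF det_Jac[of n "f x"] d]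
    ultimately show ?thesis
      using ln_jac_bound[of x] by (simp add: log_conorm_def Jac_Suc abs_le_iff del: funpow.simps)
  qed
qed

text \<open>The product of norm and conorm is at least
  \<open>\<bar>det (Jac n x)\<bar> \<ge> 1\<close>. Since \<open>bot.lower\<close> is minus the
  lower exponent, a negative lower exponent then forces a positive upper one.\<close>

lemma AE_sum_exponents: "AE x in haar_torus. bot.lower x \<le> top.lower x"
proof -
  have "AE x in haar_torus. 1 \<le> \<bar>det (Jac n x)\<bar>" for n
    by (rule torus_endo.AE_det_ge_1[OF torus_endo_funpow])
  then have "AE x in haar_torus. \<forall>n. 1 \<le> \<bar>det (Jac n x)\<bar>" by (simp add: AE_all_countable)
  then show ?thesis using top.AE_tendsto_lower bot.AE_tendsto_lower
  proof eventually_elim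
    case (elim x)
    have "log_conorm n x \<le> log_onorm n x" for n
    proof -
      have "1 \<le> onorm ((*v) (Jac n x)) * conorm ((*v) (Jac n x))"
        using det_le_onorm_conorm[OF det_Jac, of n x] elim(1) by (meson order_trans)
      then have "0 \<le> ln (onorm ((*v) (Jac n x)) * conorm ((*v) (Jac n x)))" by simp
      then show ?thesis
        by (simp add: log_conorm_def log_onorm_def ln_mult_pos onorm_Jac_pos conorm_Jac_pos)
    qed
    then have "\<forall>n. log_conorm n x / n \<le> log_onorm n x / n" by (intro allI divide_right_mono) auto
    then show ?case using LIMSEQ_le[OF elim(3,2)] by blast
  qed
qed


section \<open>From positive \<open>I_chi\<close> to a negative lower exponent\<close>

lemma I_chi_0: "norm v = 1 \<Longrightarrow> I_chi f 0 x v = 0"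
proof -
  have "inv2 (mat 1) = mat 1" by (rule inv2_unique) auto
  then show "norm v = 1 \<Longrightarrow> I_chi f 0 x v = 0"
    by (simp add: I_chi_jac[OF regular] C1_regular_id[unfolded id_def] id_def vimage_def)
qed

text \<open>In \<open>I_chi_Suc\<close> each preimage contributes the logarithm of the length of its
  vector and, after normalization, at least \<open>k * c\<close>. The logarithms sum to
  \<open>I_chi f 1 x v\<close>, and the constants keep their value where the weights add up to 1.
  That set is only of full measure, so \<open>AE_preimages\<close> is needed to continue at the
  preimages.\<close>

lemma I_chi_iterate:
  assumes c: "\<And>x v. norm v = 1 \<Longrightarrow> c \<le> I_chi f 1 x v"
  shows "AE x in haar_torus. \<forall>v. norm v = 1 \<longrightarrow> k * c \<le> I_chi f k x v"
proof (induction k)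
  case 0
  show ?case by (simp add: I_chi_0)
next
  case (Suc k)
  have "AE x in haar_torus. weight f k x = 1"
    unfolding weight_def by (rule torus_endo.weight_sum[OF torus_endo_funpow])
  with Suc have "AE y in haar_torus. weight f k y = 1 \<and> (\<forall>v. norm v = 1 \<longrightarrow> k * c \<le> I_chi f k y v)"
    by eventually_elim simp
  from AE_preimages[OF this] weight_sum show ?case
  proof eventually_elim
    case (elim x)
    show ?case
    proof (intro allI impI)
      fix v :: "real^2" assume v: "norm v = 1"
      let ?w = "\<lambda>y. inv2 (torus_jac f y) *v v" and ?d = "\<lambda>y. \<bar>det (torus_jac f y)\<bar>"
      have "Suc k * c \<le> I_chi f 1 x v + k * c * (\<Sum>y\<in>f -` {x}. 1 / ?d y)"
        using c[OF v, of x] elim(2) by (simp add: algebra_simps)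
      also have "\<dots> = (\<Sum>y\<in>f -` {x}. (ln (norm (?w y)) + k * c) / ?d y)"
        unfolding I_chi_1[OF regular] sum_distrib_left sum.distrib[symmetric]
        by (intro sum.cong refl) (simp add: add_divide_distrib)
      also have "\<dots> \<le> (\<Sum>y\<in>f -` {x}. I_chi f k y (?w y) / ?d y)"
      proof (intro sum_mono divide_right_mono)
        fix y assume y: "y \<in> f -` {x}"
        have "v \<noteq> 0" using v by auto
        then have w: "?w y \<noteq> 0" by (rule inv2_vector_nonzero[OF torus_jac_det_nonzero[OF regular]])
        have "k * c \<le> I_chi f k y ((1 / norm (?w y)) *\<^sub>R ?w y)"
          using elim(1) y w by auto
        then show "ln (norm (?w y)) + k * c \<le> I_chi f k y (?w y)"
          using elim(1) y by (subst I_chi_scale[OF regular w]) auto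
      qed simp
      also have "\<dots> = I_chi f (Suc k) x v" by (rule I_chi_Suc[OF regular, symmetric])
      finally show "Suc k * c \<le> I_chi f (Suc k) x v" .
    qed
  qed
qed

text \<open>The logarithm of the length of an inverse image of a unit vector is at most
  \<open>log_conorm\<close>, so one fixed direction \<open>v0\<close> suffices. By the area formula
  the integral of \<open>log_conorm\<close> over \<open>Z\<close> is that of its weighted sums over
  preimages, and \<open>inv\<close> keeps these in \<open>Z\<close>.\<close>

lemma integral_log_conorm_ge:
  assumes c: "AE x in haar_torus. \<forall>v. norm v = 1 \<longrightarrow> c \<le> I_chi f n x v" and "0 \<le> c"
    and Z [measurable]: "Z \<in> sets haar_torus" and inv: "\<And>x. (f ^^ n) x \<in> Z \<longleftrightarrow> x \<in> Z"
  shows "c * measure haar_torus Z \<le> (\<integral>x. log_conorm n x * indicator Z x \<partial>haar_torus)"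
proof -
  \<comment> \<open>Adding \<open>M\<close> makes the integrand nonnegative, as the area formula
    requires. Because the weights add up to 1, the shift contributes
    \<open>M * measure haar_torus Z\<close> to both sides and cancels.\<close>
  define M where "M = ln jac_bound * n"
  have M: "\<bar>log_conorm n x\<bar> \<le> M" for x unfolding M_def by (rule bot.g_bound)
  have M0: "M \<ge> 0" using M[of undefined] by linarith
  obtain v0 :: "real^2" where v0: "norm v0 = 1" using vector_choose_size[of 1] by auto
  define \<psi> where "\<psi> x = (log_conorm n x + M) * indicator Z x" for x
  have \<psi>0: "\<psi> x \<ge> 0" for x using M[of x] by (auto simp: \<psi>_def abs_le_iff)
  have [measurable]: "\<psi> \<in> borel_measurable haar_torus" unfolding \<psi>_def by measurable
  then have \<psi>m: "(\<lambda>x. ennreal (\<psi> x)) \<in> borel_measurable borel"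
    by (simp cong: measurable_cong_sets)
  have det: "\<bar>det (Jac n q)\<bar> > 0" for q using det_Jac[of n q] by simp
  have "AE p in haar_torus. weight f n p = 1"
    unfolding weight_def by (rule torus_endo.weight_sum[OF torus_endo_funpow])
  with c have pt: "AE p in haar_torus. ennreal ((c + M) * indicator Z p)
      \<le> (\<Sum>q\<in>(f ^^ n) -` {p}. ennreal (\<psi> q) / ennreal \<bar>det (Jac n q)\<bar>)"
  proof eventually_elim
    case (elim p)
    have "(c + M) * indicator Z p \<le> (\<Sum>q\<in>(f ^^ n) -` {p}. \<psi> q / \<bar>det (Jac n q)\<bar>)"
    proof (cases "p \<in> Z")
      case True
      have "c + M \<le> I_chi f n p v0 + M * weight f n p"
        using elim v0 by auto
      also have "\<dots> = (\<Sum>q\<in>(f ^^ n) -` {p}. (ln (norm (inv2 (Jac n q) *v v0)) + M) / \<bar>det (Jac n q)\<bar>)"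
        unfolding I_chi_jac[OF regular] weight_def sum_distrib_left sum.distrib[symmetric]
        by (intro sum.cong refl) (simp add: add_divide_distrib)
      also have "\<dots> \<le> (\<Sum>q\<in>(f ^^ n) -` {p}. \<psi> q / \<bar>det (Jac n q)\<bar>)"
      proof (intro sum_mono divide_right_mono)
        fix q assume "q \<in> (f ^^ n) -` {p}"
        then have "q \<in> Z" using True inv[of q] by auto
        have "inv2 (Jac n q) *v v0 \<noteq> 0"
          using v0 by (intro inv2_vector_nonzero det_Jac) auto
        then have "ln (norm (inv2 (Jac n q) *v v0)) \<le> ln (1 / conorm ((*v) (Jac n q)))"
          using norm_inv2_le[OF det_Jac, of n q v0] v0 by (intro ln_mono) auto
        also have "\<dots> = log_conorm n q"
          using conorm_Jac_pos[of n q] by (simp add: log_conorm_def ln_div)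
        finally show "ln (norm (inv2 (Jac n q) *v v0)) + M \<le> \<psi> q"
          using \<open>q \<in> Z\<close> by (simp add: \<psi>_def)
      qed simp
      finally show ?thesis using True by simp
    qed (auto intro!: sum_nonneg divide_nonneg_nonneg \<psi>0)
    moreover have "(\<Sum>q\<in>(f ^^ n) -` {p}. ennreal (\<psi> q) / ennreal \<bar>det (Jac n q)\<bar>)
        = ennreal (\<Sum>q\<in>(f ^^ n) -` {p}. \<psi> q / \<bar>det (Jac n q)\<bar>)"
      by (subst sum_ennreal[symmetric]) (auto intro!: sum.cong divide_ennreal \<psi>0 det divide_nonneg_nonneg)
    ultimately show ?case by (simp add: ennreal_leI)
  qed
  have int: "integrable haar_torus (\<lambda>x. log_conorm n x * indicator Z x)"
    using M M0 by (intro bounded_integrable[of _ M]) (auto simp: indicator_def)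
  have intZ: "integrable haar_torus (indicat_real Z)"
    by (rule bounded_integrable[of _ 1]) (auto simp: indicator_def)
  have "ennreal ((c + M) * measure haar_torus Z) = (\<integral>\<^sup>+p. ennreal ((c + M) * indicator Z p) \<partial>haar_torus)"
    using assms(2) M0 intZ by (subst nn_integral_eq_integral) auto
  also have "\<dots> \<le> (\<integral>\<^sup>+p. (\<Sum>q\<in>(f ^^ n) -` {p}. ennreal (\<psi> q) / ennreal \<bar>det (Jac n q)\<bar>) \<partial>haar_torus)"
    by (rule nn_integral_mono_AE[OF pt])
  also have "\<dots> = (\<integral>\<^sup>+x. ennreal (\<psi> x) \<partial>haar_torus)"
    by (rule area_formula(3)[OF C1_regular_funpow[OF regular] \<psi>m, symmetric])
  also have "\<dots> = ennreal (\<integral>x. \<psi> x \<partial>haar_torus)"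
    using int intZ \<psi>0 by (intro nn_integral_eq_integral) (auto simp: \<psi>_def distrib_right)
  finally have "(c + M) * measure haar_torus Z \<le> (\<integral>x. \<psi> x \<partial>haar_torus)"
    using \<psi>0 by (subst (asm) ennreal_le_iff) (auto intro!: Bochner_Integration.integral_nonneg)
  also have "\<dots> = (\<integral>x. log_conorm n x * indicator Z x \<partial>haar_torus) + M * measure haar_torus Z"
    using int intZ by (simp add: \<psi>_def distrib_right)
  finally show ?thesis by (simp add: distrib_right)
qed

lemma AE_bot_pos:
  assumes c: "\<And>x v. norm v = 1 \<Longrightarrow> c \<le> I_chi f n0 x v" and "0 < c" "0 < n0"
  shows "AE x in haar_torus. 0 < bot.lower x"
proof -
  define Z where "Z = {x. bot.lower x \<le> 0}"
  have "Z = {x \<in> space haar_torus. bot.lower x \<le> 0}" by (simp add: Z_def)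
  also have "\<dots> \<in> sets haar_torus" by measurable
  finally have Z [measurable]: "Z \<in> sets haar_torus" .
  have mult: "(f ^^ n0) ^^ k = f ^^ (n0 * k)" for k by (simp add: funpow_mult)
  have "I_chi (f ^^ n0) k x v = I_chi f (n0 * k) x v" for k x v
    unfolding I_chi_def mult ..
  note I_eq = this
  have "c \<le> I_chi (f ^^ n0) 1 x v" if "norm v = 1" for x v
    unfolding I_eq using c[OF that] by simp
  \<comment> \<open>The iterate \<open>f ^^ n0\<close> is again a volume preserving endomorphism;
    for it the bound at time \<open>n0\<close> is the one-step hypothesis.\<close>
  from torus_endo.I_chi_iterate[OF torus_endo_funpow[of n0] this]
  have I: "AE x in haar_torus. \<forall>v. norm v = 1 \<longrightarrow> k * c \<le> I_chi f (n0 * k) x v" for k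
    unfolding I_eq .
  have step: "k * c * measure haar_torus Z \<le> (\<integral>x. log_conorm (n0 * k) x * indicator Z x \<partial>haar_torus)" for k
    using \<open>0 < c\<close> by (intro integral_log_conorm_ge I) (auto simp: Z_def bot.lower_invariant_funpow)
  \<comment> \<open>\<open>Suc k\<close> avoids the average of length 0.\<close>
  let ?s = "\<lambda>k x. log_conorm (n0 * Suc k) x / (n0 * Suc k) * indicator Z x"
  have "(\<lambda>k. \<integral>x. ?s k x \<partial>haar_torus) \<longlonglongrightarrow> (\<integral>x. bot.lower x * indicator Z x \<partial>haar_torus)"
  proof (rule integral_dominated_convergence[where w = "\<lambda>_. ln jac_bound"])
    show "AE x in haar_torus. (\<lambda>k. ?s k x) \<longlonglongrightarrow> bot.lower x * indicator Z x"
      using bot.AE_tendsto_lower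
    proof eventually_elim
      case (elim x)
      have "strict_mono (\<lambda>k. n0 * Suc k)" using \<open>0 < n0\<close> by (auto simp: strict_mono_def)
      from LIMSEQ_subseq_LIMSEQ[OF elim this] show ?case
        by (intro tendsto_intros) (simp add: o_def)
    qed
    show "AE x in haar_torus. norm (?s k x) \<le> ln jac_bound" for k
      using bot.avg_bound[of "n0 * Suc k"] bot.C_nonneg
      by (intro AE_I2) (auto simp: indicator_def simp del: of_nat_mult of_nat_Suc mult_Suc_right)
  qed auto
  moreover have "c / n0 * measure haar_torus Z \<le> (\<integral>x. ?s k x \<partial>haar_torus)" for k
  proof -
    have "(\<integral>x. ?s k x \<partial>haar_torus) = (\<integral>x. log_conorm (n0 * Suc k) x * indicator Z x \<partial>haar_torus) / (n0 * Suc k)"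
      by (simp only: times_divide_eq_left Bochner_Integration.integral_divide_zero)
    also have "\<dots> \<ge> (Suc k * c * measure haar_torus Z) / (n0 * Suc k)"
      by (intro divide_right_mono step) auto
    also have "(Suc k * c * measure haar_torus Z) / (n0 * Suc k) = c / n0 * measure haar_torus Z"
      using \<open>0 < n0\<close> unfolding of_nat_mult by (simp add: field_simps del: of_nat_Suc)
    finally show ?thesis .
  qed
  ultimately have "c / n0 * measure haar_torus Z \<le> (\<integral>x. bot.lower x * indicator Z x \<partial>haar_torus)"
    by (intro LIMSEQ_le_const) auto
  also have "\<dots> \<le> (\<integral>x. 0 \<partial>haar_torus)"
  proof (rule integral_mono')
    show "bot.lower x * indicator Z x \<le> 0" for x by (auto simp: Z_def indicator_def)
  qed auto
  finally have "measure haar_torus Z \<le> 0"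
    using \<open>0 < c\<close> \<open>0 < n0\<close> by (simp add: mult_le_0_iff divide_le_0_iff)
  then have "emeasure haar_torus Z = 0"
    using haar.emeasure_eq_measure[of Z] measure_nonneg[of haar_torus Z] by simp
  then have "AE x in haar_torus. x \<notin> Z" using Z by (intro AE_not_in) (auto simp: null_sets_def)
  then show ?thesis by eventually_elim (auto simp: Z_def)
qed

end

theorem U_chi_nonuniformly_hyperbolic:
  assumes "f \<in> U_chi"
  shows "nonuniformly_hyperbolic f"
proof -
  have "f \<in> End1" "0 < C_chi f" using assms by (auto simp: U_chi_def)
  interpret torus_endo f by (rule End1_torus_endo) fact
  obtain n where n: "n \<ge> 1" "0 < ereal (1 / real n) * (INF (x, v)\<in>UNIV \<times> sphere 0 1. ereal (I_chi f n x v))"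
    using \<open>0 < C_chi f\<close> unfolding C_chi_def less_SUP_iff by auto
  then have "0 < (INF (x, v)\<in>UNIV \<times> sphere 0 1. ereal (I_chi f n x v))"
    by (auto simp: ereal_zero_less_0_iff)
  then obtain c where c: "0 < ereal c" "ereal c < (INF (x, v)\<in>UNIV \<times> sphere 0 1. ereal (I_chi f n x v))"
    using ereal_dense2 by blast
  have "c \<le> I_chi f n x v" if "norm v = 1" for x v
  proof -
    have "(INF (x, v)\<in>UNIV \<times> sphere 0 1. ereal (I_chi f n x v)) \<le> ereal (I_chi f n x v)"
      using that by (intro INF_lower2[of "(x, v)"]) auto
    with c(2) have "ereal c < ereal (I_chi f n x v)" by (rule less_le_trans)
    then show ?thesis by simp
  qed
  then have "AE x in haar_torus. 0 < bot.lower x"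
    using c(1) n(1) by (intro AE_bot_pos[of c n]) auto
  then show ?thesis
    using AE_sum_exponents top.AE_tendsto_lower bot.AE_tendsto_lower
    unfolding nonuniformly_hyperbolic_def
  proof eventually_elim
    case (elim x)
    have "(\<lambda>n. 1 / real n * ln (conorm (torus_deriv (f ^^ n) x))) = (\<lambda>n. - (log_conorm n x / n))"
      by (simp add: log_conorm_def torus_deriv_jac[OF C1_regular_funpow[OF regular]])
    moreover have "(\<lambda>n. 1 / real n * ln (onorm (torus_deriv (f ^^ n) x))) = (\<lambda>n. log_onorm n x / n)"
      by (simp add: log_onorm_def torus_deriv_jac[OF C1_regular_funpow[OF regular]])
    ultimately show ?case
      using elim tendsto_minus[OF elim(4)]
      by (intro exI[of _ "- bot.lower x"] exI[of _ "top.lower x"]) auto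
  qed
qed

section \<open>The direction of the shear\<close>

text \<open>A common prime of the two combinations divides the determinant. If it divides both
  \<open>p\<close> and \<open>q\<close>, it does not divide \<open>k\<close> by construction, so it
  divides \<open>r\<close> and \<open>s\<close> as well, against \<open>gcd1\<close>. Otherwise it
  is a factor of \<open>k\<close>, hence divides \<open>p\<close> and \<open>q\<close> after all.
  The factor with \<open>j\<close> is 1 modulo the determinant and provides infinitely many choices
  of \<open>k\<close>.\<close>

lemma coprime_combination:
  fixes p q r s j :: int
  assumes gcd1: "\<And>\<pi>. prime \<pi> \<Longrightarrow> \<pi> dvd p \<Longrightarrow> \<pi> dvd q \<Longrightarrow> \<pi> dvd r \<Longrightarrow> \<pi> dvd s \<Longrightarrow> False"
    and \<Delta>: "p * s - q * r \<noteq> 0"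
  defines "k \<equiv> \<Prod>{\<pi> \<in> prime_factors (p * s - q * r). \<not> (\<pi> dvd p \<and> \<pi> dvd q)} * (1 + j * (p * s - q * r))"
  shows "coprime (p + k * r) (q + k * s)"
proof (rule ccontr)
  let ?\<Delta> = "p * s - q * r" and ?P = "{\<pi> \<in> prime_factors (p * s - q * r). \<not> (\<pi> dvd p \<and> \<pi> dvd q)}"
  assume "\<not> coprime (p + k * r) (q + k * s)"
  then have g: "gcd (p + k * r) (q + k * s) \<noteq> 1" by (simp add: coprime_iff_gcd_eq_1)
  have \<Delta>_eq: "?\<Delta> = s * (p + k * r) - r * (q + k * s)" by (simp add: algebra_simps)
  have "gcd (p + k * r) (q + k * s) \<noteq> 0" using \<Delta> \<Delta>_eq by auto
  then obtain \<pi> where \<pi>: "\<pi> dvd gcd (p + k * r) (q + k * s)" "prime \<pi>"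
    using g prime_divisor_exists[of "gcd (p + k * r) (q + k * s)"] by (auto simp: is_unit_gcd coprime_iff_gcd_eq_1)
  then have d: "\<pi> dvd p + k * r" "\<pi> dvd q + k * s" by auto
  then have "\<pi> dvd ?\<Delta>" unfolding \<Delta>_eq by (intro dvd_diff dvd_mult)
  then have mem: "\<pi> \<in> prime_factors ?\<Delta>" using \<pi>(2) \<Delta> by (simp add: prime_factors_dvd)
  show False
  proof (cases "\<pi> dvd p \<and> \<pi> dvd q")
    case True
    then have dd: "\<pi> dvd k * r" "\<pi> dvd k * s" using d by (simp_all add: dvd_add_right_iff)
    have "\<not> \<pi> dvd k"
    proof
      assume "\<pi> dvd k"
      then consider "\<pi> dvd \<Prod>?P" | "\<pi> dvd 1 + j * ?\<Delta>"
        unfolding k_def using prime_dvd_multD[OF \<pi>(2)] by blast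
      then show False
      proof cases
        case 1
        then obtain \<rho> where \<rho>: "\<rho> \<in> ?P" "\<pi> dvd \<rho>"
          using prime_dvd_prod_iff[of ?P \<pi> "\<lambda>x. x"] \<pi>(2) by auto
        then have "prime \<rho>" by (auto simp: prime_factors_dvd)
        then have "\<pi> = \<rho>" using \<rho>(2) \<pi>(2) primes_dvd_imp_eq by blast
        then show False using \<rho>(1) True by auto
      next
        case 2
        moreover have "\<pi> dvd j * ?\<Delta>" using \<open>\<pi> dvd ?\<Delta>\<close> by simp
        ultimately have "\<pi> dvd 1" by (metis dvd_add_left_iff)
        then show False using \<pi>(2) not_prime_unit by blast
      qed
    qed
    then have "\<pi> dvd r" "\<pi> dvd s" using dd prime_dvd_multD[OF \<pi>(2)] by blast+
    then show False using gcd1[OF \<pi>(2)] True by blast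
  next
    case False
    then have "\<pi> dvd \<Prod>?P" using mem by (intro dvd_prodI[of _ _ "\<lambda>x. x", simplified]) auto
    then have "\<pi> dvd k" unfolding k_def by simp
    then have "\<pi> dvd p" "\<pi> dvd q" using d by (meson dvd_add_left_iff dvd_mult2)+
    then show False using False by blast
  qed
qed

text \<open>A nonzero polynomial of degree at most 2 cannot vanish at the three distinct values
  \<open>K 0\<close>, \<open>K 1\<close>, \<open>K 2\<close>, all of which satisfy the
  coprimality.\<close>

lemma exists_coprime_direction:
  fixes p q r s e\<^sub>0 e\<^sub>1 e\<^sub>2 :: int
  assumes gcd1: "\<And>\<pi>. prime \<pi> \<Longrightarrow> \<pi> dvd p \<Longrightarrow> \<pi> dvd q \<Longrightarrow> \<pi> dvd r \<Longrightarrow> \<pi> dvd s \<Longrightarrow> False"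
    and \<Delta>: "p * s - q * r \<noteq> 0"
    and e: "\<not> (e\<^sub>0 = 0 \<and> e\<^sub>1 = 0 \<and> e\<^sub>2 = 0)"
  shows "\<exists>k. coprime (p + k * r) (q + k * s) \<and> e\<^sub>2 * k * k + e\<^sub>1 * k + e\<^sub>0 \<noteq> 0"
proof -
  let ?\<Delta> = "p * s - q * r"
  define k0 where "k0 = \<Prod>{\<pi> \<in> prime_factors ?\<Delta>. \<not> (\<pi> dvd p \<and> \<pi> dvd q)}"
  define K where "K j = k0 * (1 + j * ?\<Delta>)" for j
  have cop: "coprime (p + K j * r) (q + K j * s)" for j
    unfolding K_def k0_def by (rule coprime_combination[OF gcd1 \<Delta>])
  have "k0 \<noteq> 0" unfolding k0_def by (auto simp: prod_zero_iff)
  then have ne: "K i \<noteq> K j" if "i \<noteq> j" for i j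
    using that \<Delta> by (simp add: K_def)
  have "\<exists>j. e\<^sub>2 * K j * K j + e\<^sub>1 * K j + e\<^sub>0 \<noteq> 0"
  proof (rule ccontr)
    assume "\<not> ?thesis"
    then have z: "e\<^sub>2 * K j * K j + e\<^sub>1 * K j + e\<^sub>0 = 0" for j by blast
    have lin: "e\<^sub>2 * (K 0 + K j) + e\<^sub>1 = 0" if "j \<noteq> 0" for j
    proof -
      have "(K 0 - K j) * (e\<^sub>2 * (K 0 + K j) + e\<^sub>1) = 0"
        using z[of 0] z[of j] by (simp add: algebra_simps)
      then show ?thesis using ne[of 0 j] that by simp
    qed
    have "e\<^sub>2 * (K 1 - K 2) = (e\<^sub>2 * (K 0 + K 1) + e\<^sub>1) - (e\<^sub>2 * (K 0 + K 2) + e\<^sub>1)"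
      by (simp add: algebra_simps)
    then have "e\<^sub>2 * (K 1 - K 2) = 0" using lin[of 1] lin[of 2] by simp
    then have "e\<^sub>2 = 0" using ne[of 1 2] by simp
    moreover from this have "e\<^sub>1 = 0" using lin[of 1] by simp
    ultimately show False using z[of 0] e by simp
  qed
  then show ?thesis using cop by blast
qed

text \<open>With \<open>l = (1, k)\<close> and \<open>u = (-k, 1)\<close>, the pair \<open>(d - k c, k a - b)\<close> is \<open>l\<close> times the adjugate
  of \<open>E = (a, b; c, d)\<close>, and the polynomial in \<open>k\<close> is its value on \<open>u\<close>.\<close>

lemma exists_shear_direction:
  fixes a b c d :: int
  defines "g \<equiv> gcd (gcd a b) (gcd c d)"
  assumes D: "a * d - b * c \<noteq> 0" and nh: "\<not> (b = 0 \<and> c = 0 \<and> a = d)"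
  shows "\<exists>k m n. (d - k * c) * m + (k * a - b) * n = g \<and> c * k * k + (a - d) * k - b \<noteq> 0"
proof -
  have "g dvd a" "g dvd b" "g dvd c" "g dvd d"
    unfolding g_def by (meson dvd_trans gcd_dvd1 gcd_dvd2)+
  then obtain a' b' c' d' where E: "a = g * a'" "b = g * b'" "c = g * c'" "d = g * d'"
    by (auto simp: dvd_def)
  have g0: "g > 0" using D by (auto simp: g_def)
  have one: "gcd (gcd a' b') (gcd c' d') = 1"
  proof -
    define h where "h = gcd (gcd a' b') (gcd c' d')"
    have h: "h dvd a'" "h dvd b'" "h dvd c'" "h dvd d'"
      unfolding h_def by (meson dvd_trans gcd_dvd1 gcd_dvd2)+
    have "g * h dvd a" "g * h dvd b" "g * h dvd c" "g * h dvd d"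
      using h E by (metis dvd_refl mult_dvd_mono)+
    then have "g * h dvd gcd (gcd a b) (gcd c d)" by simp
    then have "g * h dvd g * 1" unfolding g_def by simp
    then have "h dvd 1" using g0 by (simp only: dvd_mult_cancel_left) auto
    then show ?thesis unfolding h_def by simp
  qed
  \<comment> \<open>After division by \<open>g\<close> the entries have no common prime factor, and
    the quadratic polynomial is identically zero only for a homothety.\<close>
  have "\<exists>k. coprime (d' + k * (- c')) (- b' + k * a') \<and> c * k * k + (a - d) * k + (- b) \<noteq> 0"
  proof (rule exists_coprime_direction)
    fix \<pi> :: int assume \<pi>: "prime \<pi>" "\<pi> dvd d'" "\<pi> dvd - b'" "\<pi> dvd - c'" "\<pi> dvd a'"
    then have "\<pi> dvd gcd (gcd a' b') (gcd c' d')" by simp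
    then show False using \<pi>(1) one not_prime_unit by metis
  next
    have "a * d - b * c = g * g * (d' * a' - b' * c')" by (simp add: E algebra_simps)
    then show "d' * a' - - b' * - c' \<noteq> 0" using D by auto
  qed (use nh in auto)
  then obtain k where k: "coprime (d' - k * c') (k * a' - b')" "c * k * k + (a - d) * k - b \<noteq> 0"
    by (auto simp: algebra_simps)
  obtain m n where "m * (d' - k * c') + n * (k * a' - b') = 1"
    using bezout_int[of "d' - k * c'" "k * a' - b'"] k(1) by (auto simp: coprime_iff_gcd_eq_1)
  then have "g * (m * (d' - k * c') + n * (k * a' - b')) = g" by simp
  then have "(d - k * c) * m + (k * a - b) * n = g" by (simp add: E algebra_simps)
  then show ?thesis using k(2) by blast
qed

section \<open>Level sets of the cosine on equidistant points\<close>

lemma sin_multiple_ge: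
  fixes n i :: nat
  assumes "0 < i" "i < n"
  shows "sin (pi / n) \<le> sin (pi * i / n)"
proof -
  have n: "n \<ge> 2" using assms by simp
  have half: "pi / n \<le> pi / 2" using n by (intro divide_left_mono) auto
  have lo: "pi / n \<le> pi * j / n" if "j \<ge> 1" for j :: real
    using that n by (intro divide_right_mono) auto
  show ?thesis
  proof (cases "pi * i / n \<le> pi / 2")
    case True
    then show ?thesis
      using half lo[of i] assms pi_gt_zero n
      by (intro sin_monotone_2pi_le) (auto intro: order_trans[of _ 0] divide_nonneg_nonneg)
  next
    case False
    define j where "j = n - i"
    have j: "pi * i / n = pi - pi * j / n" "j \<ge> 1"
      using assms by (auto simp: j_def of_nat_diff field_simps)
    have "sin (pi / n) \<le> sin (pi * j / n)"
      using half lo[of j] j False n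
      by (intro sin_monotone_2pi_le) (auto intro: order_trans[of _ 0] divide_nonneg_nonneg)
    then show ?thesis by (simp add: j(1))
  qed
qed

text \<open>If the cosine takes nearly the same value at two of the points, then the sine nearly vanishes at
  their mean. The means of \<open>x, y\<close> and of \<open>x, z\<close> differ by half of the distance of \<open>y\<close> and \<open>z\<close>, so this
  cannot happen for three points.\<close>

lemma card_cos_level:
  fixes n :: nat and \<theta> q :: real
  assumes "2 \<le> n"
  shows "card {j. j < n \<and> \<bar>cos (2 * pi * (\<theta> + j / n)) - q\<bar> < (sin (pi / n))\<^sup>2 / 2} \<le> 2"
proof (rule ccontr)
  define s where "s = sin (pi / n)"
  define S where "S = {j. j < n \<and> \<bar>cos (2 * pi * (\<theta> + j / n)) - q\<bar> < s\<^sup>2 / 2}"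
  assume "\<not> ?thesis"
  then have "3 \<le> card S" by (simp add: S_def s_def)
  then obtain T where "T \<subseteq> S" "card T = 3" by (rule obtain_subset_with_card_n)
  then obtain x y z where xyz: "x \<in> S" "y \<in> S" "z \<in> S" "x \<noteq> y" "x \<noteq> z" "y \<noteq> z"
    by (auto simp: card_3_iff)
  have s0: "s > 0" unfolding s_def using assms
    by (intro sin_gt_zero) (auto simp: divide_less_eq)
  have far: "s \<le> \<bar>sin (pi * (real i - real j) / n)\<bar>" if "i < n" "j < n" "i \<noteq> j" for i j
  proof -
    have *: "s \<le> \<bar>sin (pi * (real i - real j) / n)\<bar>" if "j < i" "i < n" for i j
    proof -
      have "s \<le> sin (pi * real (i - j) / n)"
        unfolding s_def using that by (intro sin_multiple_ge) auto
      then show ?thesis using that by (simp add: of_nat_diff)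
    qed
    consider "j < i" | "i < j" using \<open>i \<noteq> j\<close> by (meson linorder_neqE_nat)
    then show ?thesis
    proof cases
      case 2
      have "pi * (real i - real j) / n = - (pi * (real j - real i) / n)"
        unfolding minus_divide_left by (simp add: right_diff_distrib)
      then show ?thesis using *[OF 2] that by simp
    qed (use * that in blast)
  qed
  \<comment> \<open>Two cosines within \<open>s\<^sup>2 / 2\<close> of \<open>q\<close> differ by
    less than \<open>s\<^sup>2\<close>. Their difference is twice the sine at the mean times the
    sine of half the difference; the latter is at least \<open>s\<close> in absolute value by
    \<open>far\<close>, which leaves \<open>s / 2\<close> for the former.\<close>
  have close: "\<bar>sin (2 * pi * \<theta> + pi * (real i + real j) / n)\<bar> < s / 2" if "i \<in> S" "j \<in> S" "i \<noteq> j" for i j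
  proof -
    have "cos (2 * pi * (\<theta> + i / n)) - cos (2 * pi * (\<theta> + j / n))
      = 2 * sin (2 * pi * \<theta> + pi * (real i + real j) / n) * sin (pi * (real j - real i) / n)"
    proof -
      have "(2 * pi * (\<theta> + i / n) + 2 * pi * (\<theta> + j / n)) / 2 = 2 * pi * \<theta> + pi * (real i + real j) / n"
        "(2 * pi * (\<theta> + j / n) - 2 * pi * (\<theta> + i / n)) / 2 = pi * (real j - real i) / n"
        using assms by (simp_all add: field_simps)
      then show ?thesis unfolding cos_diff_cos by (simp only:)
    qed
    moreover have "\<bar>cos (2 * pi * (\<theta> + i / n)) - cos (2 * pi * (\<theta> + j / n))\<bar> < s\<^sup>2"
      using that(1,2) unfolding S_def by (simp add: abs_if split: if_splits)
    ultimately have "2 * \<bar>sin (2 * pi * \<theta> + pi * (real i + real j) / n)\<bar> * \<bar>sin (pi * (real j - real i) / n)\<bar> < s * s"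
      by (simp add: abs_mult power2_eq_square)
    moreover have "2 * \<bar>sin (2 * pi * \<theta> + pi * (real i + real j) / n)\<bar> * s
      \<le> 2 * \<bar>sin (2 * pi * \<theta> + pi * (real i + real j) / n)\<bar> * \<bar>sin (pi * (real j - real i) / n)\<bar>"
      using far[of j i] that by (intro mult_left_mono) (auto simp: S_def)
    ultimately have "(2 * \<bar>sin (2 * pi * \<theta> + pi * (real i + real j) / n)\<bar>) * s < s * s" by linarith
    then show ?thesis using s0 by simp
  qed
  let ?a = "2 * pi * \<theta> + pi * (real x + real y) / n" and ?b = "2 * pi * \<theta> + pi * (real x + real z) / n"
  have "s \<le> \<bar>sin (pi * (real y - real z) / n)\<bar>" using far xyz by (auto simp: S_def)
  also have "pi * (real y - real z) / n = ?a - ?b"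
    by (simp add: add_divide_distrib diff_divide_distrib distrib_left right_diff_distrib)
  also have "\<bar>sin (?a - ?b)\<bar> \<le> \<bar>sin ?a\<bar> * \<bar>cos ?b\<bar> + \<bar>cos ?a\<bar> * \<bar>sin ?b\<bar>"
    unfolding sin_diff by (simp add: abs_mult[symmetric] abs_triangle_ineq4)
  also have "\<dots> \<le> \<bar>sin ?a\<bar> * 1 + 1 * \<bar>sin ?b\<bar>"
    by (intro add_mono mult_mono) auto
  also have "\<dots> < s / 2 + s / 2" using close[of x y] close[of x z] xyz by simp
  finally show False by simp
qed

section \<open>Real analytic functions\<close>

text \<open>Induction on \<open>A\<close>: splitting off one coordinate turns the family into a
  product of two absolutely summable ones. It justifies multiplying out power series in several
  coordinates.\<close>

lemma abs_summable_prod_PiE: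
  fixes f :: "'a \<Rightarrow> 'b \<Rightarrow> real"
  assumes "finite A" "\<And>x. x \<in> A \<Longrightarrow> (\<lambda>y. norm (f x y)) summable_on B"
  shows "(\<lambda>g. norm (\<Prod>x\<in>A. f x (g x))) summable_on (A \<rightarrow>\<^sub>E B)"
  using assms
proof (induction A rule: finite_induct)
  case empty
  show ?case by simp
next
  case (insert x A)
  have inj: "inj_on (\<lambda>(y, g). g(x := y)) (B \<times> (A \<rightarrow>\<^sub>E B))"
    using insert.hyps(2) by (rule inj_combinator)
  have prod: "(\<Prod>z\<in>insert x A. f z ((g(x := y)) z)) = f x y * (\<Prod>z\<in>A. f z (g z))" for g y
    using insert.hyps by (simp, intro disjI2 prod.cong) auto
  have "(\<lambda>p. norm ((\<lambda>(y, g). f x y * (\<Prod>z\<in>A. f z (g z))) p)) summable_on (B \<times> (A \<rightarrow>\<^sub>E B))"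
    unfolding Infinite_Sum.abs_summable_on_Sigma_iff
  proof (intro conjI ballI)
    fix y
    show "(\<lambda>g. norm (case (y, g) of (y, g) \<Rightarrow> f x y * (\<Prod>z\<in>A. f z (g z)))) summable_on (A \<rightarrow>\<^sub>E B)"
      using insert.IH insert.prems by (simp add: abs_mult summable_on_cmult_right)
  next
    have "(\<lambda>y. norm (\<bar>f x y\<bar> * infsum (\<lambda>g. \<bar>\<Prod>z\<in>A. f z (g z)\<bar>) (A \<rightarrow>\<^sub>E B))) summable_on B"
      using insert.prems[of x] by (simp add: abs_mult summable_on_cmult_left)
    then show "(\<lambda>y. norm (\<Sum>\<^sub>\<infinity>g\<in>A \<rightarrow>\<^sub>E B. norm (case (y, g) of (y, g) \<Rightarrow> f x y * (\<Prod>z\<in>A. f z (g z))))) summable_on B"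
      by (simp add: abs_mult infsum_cmult_right')
  qed
  then have "(\<lambda>g. norm (\<Prod>z\<in>insert x A. f z (g z))) \<circ> (\<lambda>(y, g). g(x := y)) summable_on (B \<times> (A \<rightarrow>\<^sub>E B))"
    by (simp only: o_def case_prod_unfold prod)
  then show ?case
    unfolding PiE_insert_eq by (subst summable_on_reindex[OF inj])
qed

text \<open>Every centre gets its own expansion, absolutely convergent, because
  \<open>real_analytic_on\<close> expands at each point and sums over multi-indices
  unconditionally.\<close>

definition entire :: "(real \<Rightarrow> real) \<Rightarrow> bool" where
  "entire g \<longleftrightarrow> (\<forall>a. \<exists>c. \<forall>z. summable (\<lambda>n. norm (c n * z ^ n)) \<and> (\<lambda>n. c n * z ^ n) sums g (a + z))"

lemma entire_affine: "entire (\<lambda>x. p + q * x)"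
  unfolding entire_def
proof
  fix a
  let ?c = "\<lambda>n::nat. if n = 0 then p + q * a else if n = 1 then q else 0"
  have z: "?c n * z ^ n = 0" if "n \<notin> {0, 1}" for n z using that by auto
  have "summable (\<lambda>n. norm (?c n * z ^ n))" for z
    by (rule summable_finite[of "{0, 1}"]) (use z in auto)
  moreover have "(\<lambda>n. ?c n * z ^ n) sums (p + q * (a + z))" for z
    using sums_finite[of "{0, 1}" "\<lambda>n. ?c n * z ^ n", OF _ z] by (simp add: algebra_simps)
  ultimately show "\<exists>c. \<forall>z. summable (\<lambda>n. norm (c n * z ^ n)) \<and> (\<lambda>n. c n * z ^ n) sums (p + q * (a + z))"
    by (intro exI[of _ ?c]) blast
qed

lemma entire_sin_cos_aux:
  "summable (\<lambda>n. norm ((p * cos_coeff n + q * sin_coeff n) * \<omega> ^ n * z ^ n))"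
  "(\<lambda>n. (p * cos_coeff n + q * sin_coeff n) * \<omega> ^ n * z ^ n) sums (p * cos (\<omega> * z) + q * sin (\<omega> * z))"
proof -
  have eq: "(p * cos_coeff n + q * sin_coeff n) * \<omega> ^ n * z ^ n
      = p * (cos_coeff n *\<^sub>R (\<omega> * z) ^ n) + q * (sin_coeff n *\<^sub>R (\<omega> * z) ^ n)" for n
    by (simp add: algebra_simps power_mult_distrib)
  show "(\<lambda>n. (p * cos_coeff n + q * sin_coeff n) * \<omega> ^ n * z ^ n) sums (p * cos (\<omega> * z) + q * sin (\<omega> * z))"
    unfolding eq by (intro sums_add sums_mult sin_converges cos_converges)
  show "summable (\<lambda>n. norm ((p * cos_coeff n + q * sin_coeff n) * \<omega> ^ n * z ^ n))"
  proof (rule summable_comparison_test'[where N = 0])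
    show "summable (\<lambda>n. \<bar>p\<bar> * norm (cos_coeff n *\<^sub>R (\<omega> * z) ^ n) + \<bar>q\<bar> * norm (sin_coeff n *\<^sub>R (\<omega> * z) ^ n))"
      by (intro summable_add summable_mult summable_norm_sin summable_norm_cos)
    show "norm (norm ((p * cos_coeff n + q * sin_coeff n) * \<omega> ^ n * z ^ n))
      \<le> \<bar>p\<bar> * norm (cos_coeff n *\<^sub>R (\<omega> * z) ^ n) + \<bar>q\<bar> * norm (sin_coeff n *\<^sub>R (\<omega> * z) ^ n)" for n
      unfolding eq real_norm_def abs_abs by (metis abs_mult abs_triangle_ineq)
  qed
qed

lemma entire_sin: "entire (\<lambda>x. sin (\<omega> * x))"
  unfolding entire_def
proof
  fix a
  let ?c = "\<lambda>n. (sin (\<omega> * a) * cos_coeff n + cos (\<omega> * a) * sin_coeff n) * \<omega> ^ n"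
  have "sin (\<omega> * (a + z)) = sin (\<omega> * a) * cos (\<omega> * z) + cos (\<omega> * a) * sin (\<omega> * z)" for z
    by (simp add: distrib_left sin_add)
  then show "\<exists>c. \<forall>z. summable (\<lambda>n. norm (c n * z ^ n)) \<and> (\<lambda>n. c n * z ^ n) sums sin (\<omega> * (a + z))"
    using entire_sin_cos_aux by (intro exI[of _ ?c]) simp
qed

lemma entire_cos: "entire (\<lambda>x. cos (\<omega> * x))"
  unfolding entire_def
proof
  fix a
  let ?c = "\<lambda>n. (cos (\<omega> * a) * cos_coeff n + (- sin (\<omega> * a)) * sin_coeff n) * \<omega> ^ n"
  have "cos (\<omega> * (a + z)) = cos (\<omega> * a) * cos (\<omega> * z) + (- sin (\<omega> * a)) * sin (\<omega> * z)" for z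
    by (simp add: distrib_left cos_add)
  then show "\<exists>c. \<forall>z. summable (\<lambda>n. norm (c n * z ^ n)) \<and> (\<lambda>n. c n * z ^ n) sums cos (\<omega> * (a + z))"
    by (intro exI[of _ ?c] allI conjI) (simp_all only: entire_sin_cos_aux)
qed

text \<open>Multiplying out the one-variable expansions gives the multi-index series, whose
  coefficients are the products of theirs. Convergence is global, so any radius serves.\<close>

lemma real_analytic_on_prod:
  fixes g :: "'a::euclidean_space \<Rightarrow> real \<Rightarrow> real" and w :: "'b::euclidean_space"
  assumes "\<And>b. b \<in> Basis \<Longrightarrow> entire (g b)"
  shows "real_analytic_on S (\<lambda>x. (\<Prod>b\<in>Basis. g b (x \<bullet> b)) *\<^sub>R w)"
  unfolding real_analytic_on_def
proof
  fix a assume "a \<in> S"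
  have "\<exists>C. \<forall>b\<in>Basis. \<forall>z. summable (\<lambda>n. norm (C b n * z ^ n)) \<and> (\<lambda>n. C b n * z ^ n) sums g b (a \<bullet> b + z)"
    using assms unfolding entire_def by (intro bchoice) blast
  then obtain C where C: "\<And>b z. b \<in> Basis \<Longrightarrow> summable (\<lambda>n. norm (C b n * z ^ n))"
    "\<And>b z. b \<in> Basis \<Longrightarrow> (\<lambda>n. C b n * z ^ n) sums g b (a \<bullet> b + z)" by metis
  have "((\<lambda>\<alpha>. (\<Prod>b\<in>Basis. ((y - a) \<bullet> b) ^ \<alpha> b) *\<^sub>R ((\<Prod>b\<in>Basis. C b (\<alpha> b)) *\<^sub>R w)) has_sum
      (\<Prod>b\<in>Basis. g b (y \<bullet> b)) *\<^sub>R w) (Basis \<rightarrow>\<^sub>E UNIV)" for y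
  proof -
    let ?f = "\<lambda>b n. C b n * ((y - a) \<bullet> b) ^ n"
    have abs: "(\<lambda>n. norm (?f b n)) summable_on UNIV" and sum: "(?f b has_sum g b (y \<bullet> b)) UNIV" if "b \<in> Basis" for b
    proof -
      show "(\<lambda>n. norm (?f b n)) summable_on UNIV"
        using C(1)[OF that] by (intro norm_summable_imp_summable_on) simp
      have "?f b sums g b (a \<bullet> b + (y - a) \<bullet> b)" by (rule C(2)[OF that])
      then show "(?f b has_sum g b (y \<bullet> b)) UNIV"
        using C(1)[OF that] by (intro norm_summable_imp_has_sum) (auto simp: inner_diff_left)
    qed
    have "(\<lambda>\<alpha>. norm (\<Prod>b\<in>Basis. ?f b (\<alpha> b))) summable_on (Basis \<rightarrow>\<^sub>E UNIV)"
      by (intro abs_summable_prod_PiE abs) auto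
    then have "((\<lambda>\<alpha>. \<Prod>b\<in>Basis. ?f b (\<alpha> b)) has_sum (\<Sum>\<^sub>\<infinity>\<alpha>\<in>Basis \<rightarrow>\<^sub>E UNIV. \<Prod>b\<in>Basis. ?f b (\<alpha> b))) (Basis \<rightarrow>\<^sub>E UNIV)"
      by (rule has_sum_infsum[OF Infinite_Sum.abs_summable_summable])
    also have "(\<Sum>\<^sub>\<infinity>\<alpha>\<in>Basis \<rightarrow>\<^sub>E UNIV. \<Prod>b\<in>Basis. ?f b (\<alpha> b)) = (\<Prod>b\<in>Basis. infsum (?f b) UNIV)"
      by (intro infsum_prod_PiE_abs abs) auto
    also have "\<dots> = (\<Prod>b\<in>Basis. g b (y \<bullet> b))"
      by (intro prod.cong refl infsumI sum)
    finally have "((\<lambda>\<alpha>. \<Prod>b\<in>Basis. ?f b (\<alpha> b)) has_sum (\<Prod>b\<in>Basis. g b (y \<bullet> b))) (Basis \<rightarrow>\<^sub>E UNIV)" .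
    then have "((\<lambda>\<alpha>. (\<Prod>b\<in>Basis. ?f b (\<alpha> b)) *\<^sub>R w) has_sum (\<Prod>b\<in>Basis. g b (y \<bullet> b)) *\<^sub>R w) (Basis \<rightarrow>\<^sub>E UNIV)"
      by (rule has_sum_bounded_linear[OF bounded_linear_scaleR_left])
    then show ?thesis by (simp add: prod.distrib mult.commute)
  qed
  then show "\<exists>r>0. \<exists>c. \<forall>y. y \<in> S \<longrightarrow> dist y a < r \<longrightarrow>
     ((\<lambda>\<alpha>. (\<Prod>b\<in>Basis. ((y - a) \<bullet> b) ^ \<alpha> b) *\<^sub>R c \<alpha>) has_sum (\<Prod>b\<in>Basis. g b (y \<bullet> b)) *\<^sub>R w)
       (Basis \<rightarrow>\<^sub>E UNIV)"
    by (intro exI[of _ 1] conjI exI[of _ "\<lambda>\<alpha>. (\<Prod>b\<in>Basis. C b (\<alpha> b)) *\<^sub>R w"]) auto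
qed

lemma real_analytic_on_add:
  assumes "real_analytic_on S F" "real_analytic_on S G"
  shows "real_analytic_on S (\<lambda>x. F x + G x)"
  unfolding real_analytic_on_def
proof
  fix a assume a: "a \<in> S"
  obtain r c where r: "r > 0" "\<And>y. y \<in> S \<Longrightarrow> dist y a < r \<Longrightarrow>
     ((\<lambda>\<alpha>. (\<Prod>b\<in>Basis. ((y - a) \<bullet> b) ^ \<alpha> b) *\<^sub>R c \<alpha>) has_sum F y) (Basis \<rightarrow>\<^sub>E UNIV)"
    using assms(1) a unfolding real_analytic_on_def by blast
  obtain r' c' where r': "r' > 0" "\<And>y. y \<in> S \<Longrightarrow> dist y a < r' \<Longrightarrow>
     ((\<lambda>\<alpha>. (\<Prod>b\<in>Basis. ((y - a) \<bullet> b) ^ \<alpha> b) *\<^sub>R c' \<alpha>) has_sum G y) (Basis \<rightarrow>\<^sub>E UNIV)"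
    using assms(2) a unfolding real_analytic_on_def by blast
  show "\<exists>r>0. \<exists>c. \<forall>y. y \<in> S \<longrightarrow> dist y a < r \<longrightarrow>
     ((\<lambda>\<alpha>. (\<Prod>b\<in>Basis. ((y - a) \<bullet> b) ^ \<alpha> b) *\<^sub>R c \<alpha>) has_sum (F y + G y)) (Basis \<rightarrow>\<^sub>E UNIV)"
  proof (intro exI[of _ "min r r'"] conjI exI[of _ "\<lambda>\<alpha>. c \<alpha> + c' \<alpha>"] allI impI)
    fix y assume "y \<in> S" "dist y a < min r r'"
    then show "((\<lambda>\<alpha>. (\<Prod>b\<in>Basis. ((y - a) \<bullet> b) ^ \<alpha> b) *\<^sub>R (c \<alpha> + c' \<alpha>)) has_sum (F y + G y)) (Basis \<rightarrow>\<^sub>E UNIV)"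
      using has_sum_add[OF r(2) r'(2)] by (simp add: scaleR_add_right)
  qed (use r(1) r'(1) in auto)
qed

section \<open>Sheared linear endomorphisms\<close>

lemma C1_onI:
  fixes F :: "'a::euclidean_space \<Rightarrow> 'b::euclidean_space"
  assumes "\<And>x. x \<in> S \<Longrightarrow> (F has_derivative F' x) (at x within S)"
    "\<And>i. i \<in> Basis \<Longrightarrow> continuous_on S (\<lambda>x. F' x i)"
  shows "C1_on S F"
proof -
  have B: "blinfun_apply (Blinfun (F' x)) = F' x" if "x \<in> S" for x
    using assms(1)[OF that] by (intro bounded_linear_Blinfun_apply has_derivative_bounded_linear)
  have "continuous_on S (\<lambda>x. Blinfun (F' x))"
  proof (rule continuous_on_blinfun_componentwise)
    fix i :: 'a assume "i \<in> Basis"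
    then have "continuous_on S (\<lambda>x. F' x i)" by (rule assms(2))
    then show "continuous_on S (\<lambda>x. blinfun_apply (Blinfun (F' x)) i)"
      by (rule continuous_on_eq) (simp add: B)
  qed
  then show ?thesis
    unfolding C1_on_def using assms(1) B by (intro exI[of _ "\<lambda>x. Blinfun (F' x)"]) auto
qed

definition torus_map :: "(real^2 \<Rightarrow> real^2) \<Rightarrow> torus \<Rightarrow> torus" where
  "torus_map F p = proj (F (SOME x. proj x = p))"

lemma torus_map_proj:
  assumes "\<And>x m. m \<in> int_vecs \<Longrightarrow> F (x + m) - F x \<in> int_vecs"
  shows "torus_map F (proj x) = proj (F x)"
proof -
  define y where "y = (SOME y. proj y = proj x)"
  have "proj y = proj x" unfolding y_def by (rule someI) simp
  then have "y - x \<in> int_vecs" by (simp add: proj_eq_iff_diff)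
  then have "F (x + (y - x)) - F x \<in> int_vecs" by (rule assms)
  then show ?thesis unfolding torus_map_def y_def[symmetric] by (simp add: proj_eq_iff_diff)
qed

lemma toral_end_proj: "toral_end E (proj x) = proj (map_matrix real_of_int E *v x)"
  by transfer (simp add: int_vec_rel_def)

text \<open>Serves to compare fibres: the preimages of any two points are indexed by the integer
  vectors, with the same pairs of indices identified.\<close>

lemma card_image_eq_by_kernel:
  assumes "\<And>a b. a \<in> S \<Longrightarrow> b \<in> S \<Longrightarrow> \<phi> a = \<phi> b \<longleftrightarrow> \<psi> a = \<psi> b"
  shows "card (\<phi> ` S) = card (\<psi> ` S)"
proof -
  have "bij_betw (\<lambda>y. \<psi> (inv_into S \<phi> y)) (\<phi> ` S) (\<psi> ` S)"
    unfolding bij_betw_def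
  proof
    have inv: "inv_into S \<phi> (\<phi> a) \<in> S" "\<phi> (inv_into S \<phi> (\<phi> a)) = \<phi> a" if "a \<in> S" for a
      using that by (auto intro: inv_into_into f_inv_into_f)
    show "inj_on (\<lambda>y. \<psi> (inv_into S \<phi> y)) (\<phi> ` S)"
    proof (rule inj_onI)
      fix y z assume "y \<in> \<phi> ` S" "z \<in> \<phi> ` S" and eq: "\<psi> (inv_into S \<phi> y) = \<psi> (inv_into S \<phi> z)"
      then obtain a b where ab: "a \<in> S" "b \<in> S" "y = \<phi> a" "z = \<phi> b" by blast
      then show "y = z" using eq assms[OF inv(1)[OF ab(1)] inv(1)[OF ab(2)]] inv by simp
    qed
    have "\<psi> (inv_into S \<phi> (\<phi> a)) = \<psi> a" if "a \<in> S" for a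
      using assms[OF inv(1)[OF that] that] inv(2)[OF that] by simp
    then show "(\<lambda>y. \<psi> (inv_into S \<phi> y)) ` \<phi> ` S = \<psi> ` S"
      unfolding image_image by (rule image_cong[OF refl])
  qed
  then show ?thesis by (rule bij_betw_same_card)
qed

locale sheared_endo =
  fixes E :: "int^2^2" and k :: int and t :: real
  assumes det_E: "det E \<noteq> 0"
begin

definition A :: "real^2^2" where "A = map_matrix real_of_int E"
definition ell :: "real^2 \<Rightarrow> real" where "ell x = x$1 + k * x$2"
definition u :: "real^2" where "u = vector [- k, 1]"
text \<open>The rank one matrix sending \<open>v\<close> to \<open>ell v\<close> times
  \<open>u\<close>. Its square is 0 because \<open>ell u = 0\<close>, so
  \<open>mat 1 + c *\<^sub>R M\<close> has determinant 1 and inverse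
  \<open>mat 1 - c *\<^sub>R M\<close>.\<close>

definition M :: "real^2^2" where "M = vector [vector [- k, - (k * k)], vector [1, k]]"

text \<open>\<open>s\<close> is the homotopy parameter: the value 0 gives the shear followed by
  \<open>A\<close>, the value 1 gives \<open>A\<close> itself. The divisor \<open>2 * pi\<close>
  makes the derivative of the shear proportional to \<open>t * cos\<close>.\<close>

definition lift :: "real \<Rightarrow> real^2 \<Rightarrow> real^2" where
  "lift s x = A *v x + ((1 - s) * (t / (2 * pi)) * sin (2 * pi * ell x)) *\<^sub>R (A *v u)"

text \<open>The global inverse of \<open>lift 0\<close>: the shear does not change
  \<open>ell\<close>, so it is undone by subtracting the same multiple of \<open>u\<close>.\<close>

definition unlift :: "real^2 \<Rightarrow> real^2" where
  "unlift x = inv2 A *v x - (t / (2 * pi) * sin (2 * pi * ell (inv2 A *v x))) *\<^sub>R u"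

definition f :: "torus \<Rightarrow> torus" where "f = torus_map (lift 0)"

lemma det_A: "det A = of_int (det E)"
  by (simp add: A_def det_2)

lemma det_A_nonzero: "det A \<noteq> 0" using det_E det_A by simp

lemma M_vector: "M *v v = ell v *\<^sub>R u"
  by (simp add: M_def ell_def u_def matrix_vector_mult_def vec_eq_iff forall_2 sum_2 algebra_simps)

lemma ell_linear: "ell (x + y) = ell x + ell y" "ell (x - y) = ell x - ell y" "ell (c *\<^sub>R x) = c * ell x"
  by (simp_all add: ell_def algebra_simps)

lemma ell_u [simp]: "ell u = 0" by (simp add: ell_def u_def)

lemma ell_int: "m \<in> int_vecs \<Longrightarrow> ell m \<in> \<int>"
  by (auto simp: ell_def int_vecs_def)

lemma A_int: "m \<in> int_vecs \<Longrightarrow> A *v m \<in> int_vecs"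
  by (auto simp: int_vecs_def A_def matrix_vector_mult_def intro!: Ints_sum)

lemma sin_int: "m \<in> \<int> \<Longrightarrow> sin (2 * pi * (x + m)) = sin (2 * pi * x)"
  and cos_int: "m \<in> \<int> \<Longrightarrow> cos (2 * pi * (x + m)) = cos (2 * pi * x)"
  by (auto simp: distrib_left sin_add cos_add sin_integer_2pi cos_integer_2pi)

lemma lift_add_int: "m \<in> int_vecs \<Longrightarrow> lift s (x + m) = lift s x + A *v m"
  by (simp add: lift_def ell_linear sin_int[OF ell_int] matrix_vector_right_distrib)

lemma torus_map_lift: "torus_map (lift s) (proj x) = proj (lift s x)"
  by (rule torus_map_proj) (simp add: lift_add_int A_int)

lemma f_proj: "f (proj x) = proj (lift 0 x)"
  unfolding f_def by (rule torus_map_lift)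

lemma lift_alt: "lift 0 x = A *v (x + (t / (2 * pi) * sin (2 * pi * ell x)) *\<^sub>R u)"
  by (simp add: lift_def matrix_vector_right_distrib matrix_vector_mult_scaleR)

lemma unlift_lift: "unlift (lift 0 x) = x"
  unfolding unlift_def lift_alt inv2_vector[OF det_A_nonzero] by (simp add: ell_linear)

lemma lift_unlift: "lift 0 (unlift x) = x"
  unfolding unlift_def lift_alt by (simp add: ell_linear inv2_vector[OF det_A_nonzero])

definition jac :: "real^2 \<Rightarrow> real^2^2" where
  "jac x = A ** (mat 1 + (t * cos (2 * pi * ell x)) *\<^sub>R M)"

definition jac_inv :: "real^2 \<Rightarrow> real^2^2" where
  "jac_inv x = (mat 1 - (t * cos (2 * pi * ell x)) *\<^sub>R M) ** inv2 A"

lemma det_shear: "det (mat 1 + c *\<^sub>R M) = 1"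
  by (simp add: det_2 M_def mat_def algebra_simps)

lemma shear_inverse: "(mat 1 + c *\<^sub>R M) ** (mat 1 - c *\<^sub>R M) = mat 1"
  by (simp add: M_def matrix_matrix_mult_def vec_eq_iff forall_2 sum_2 mat_def algebra_simps)

lemma det_jac: "det (jac x) = det A"
  by (simp add: jac_def det_mul det_shear)

lemma inv2_jac: "inv2 (jac x) = jac_inv x"
proof (rule inv2_unique)
  have "jac x ** jac_inv x = A ** ((mat 1 + (t * cos (2 * pi * ell x)) *\<^sub>R M) ** (mat 1 - (t * cos (2 * pi * ell x)) *\<^sub>R M)) ** inv2 A"
    unfolding jac_def jac_inv_def by (simp only: matrix_mul_assoc)
  then show "jac x ** jac_inv x = mat 1" by (simp add: shear_inverse inv2[OF det_A_nonzero])
  show "det (jac x) \<noteq> 0" by (simp add: det_jac det_A_nonzero)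
qed

lemma inv2_jac_vector:
  "inv2 (jac x) *v v = inv2 A *v v - (t * cos (2 * pi * ell x) * ell (inv2 A *v v)) *\<^sub>R u"
  unfolding inv2_jac jac_inv_def
  by (simp add: matrix_vector_mul_assoc[symmetric] matrix_vector_mult_diff_rdistrib
      scaleR_matrix_vector_assoc[symmetric] M_vector)

lemma bounded_linear_ell: "bounded_linear ell"
  unfolding ell_def by (intro bounded_linear_intros bounded_linear_vec_nth)

lemmas has_derivative_ell [derivative_intros] = bounded_linear.has_derivative[OF bounded_linear_ell]
lemmas continuous_on_ell [continuous_intros] = bounded_linear.continuous_on[OF bounded_linear_ell]
lemmas has_derivative_mv [derivative_intros] = bounded_linear.has_derivative[OF matrix_vector_mul_bounded_linear]
lemmas continuous_on_mv [continuous_intros] = bounded_linear.continuous_on[OF matrix_vector_mul_bounded_linear]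

lemma has_derivative_lift:
  "((\<lambda>(s, x). lift s x) has_derivative (\<lambda>(ds, h). A *v h
     + ((1 - s) * t * cos (2 * pi * ell x) * ell h - ds * (t / (2 * pi)) * sin (2 * pi * ell x)) *\<^sub>R (A *v u))) (at (s, x) within S)"
proof -
  have "((\<lambda>p. (1 - fst p) * (t / (2 * pi)) * sin (2 * pi * ell (snd p))) has_derivative
      (\<lambda>dp. (1 - s) * t * cos (2 * pi * ell x) * ell (snd dp) - fst dp * (t / (2 * pi)) * sin (2 * pi * ell x)))
      (at (s, x) within S)"
    by (auto intro!: derivative_eq_intros ext simp: field_simps)
  moreover have "((\<lambda>p. A *v snd p) has_derivative (\<lambda>dp. A *v snd dp)) (at (s, x) within S)"
    by (auto intro!: derivative_eq_intros)
  ultimately show ?thesis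
    unfolding lift_def case_prod_unfold by (intro has_derivative_add has_derivative_scaleR_left)
qed

lemma has_derivative_lift_0: "(lift 0 has_derivative (*v) (jac x)) (at x within S)"
proof -
  have "jac x *v h = A *v h + (t * cos (2 * pi * ell x) * ell h) *\<^sub>R (A *v u)" for h
    by (simp add: jac_def matrix_vector_mul_assoc[symmetric] matrix_vector_mult_add_rdistrib
       matrix_vector_right_distrib matrix_vector_mult_scaleR scaleR_matrix_vector_assoc[symmetric] M_vector)
  then have eq: "(*v) (jac x) = (\<lambda>h. A *v h + (t * cos (2 * pi * ell x) * ell h) *\<^sub>R (A *v u))" by auto
  show ?thesis
    unfolding eq lift_def by (auto intro!: derivative_eq_intros ext simp: algebra_simps)
qed

lemma has_derivative_unlift:
  "(unlift has_derivative (\<lambda>h. inv2 A *v h - (t * cos (2 * pi * ell (inv2 A *v x)) * ell (inv2 A *v h)) *\<^sub>R u)) (at x within S)"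
  unfolding unlift_def by (auto intro!: derivative_eq_intros ext simp: algebra_simps)

lemma continuous_jac: "continuous_on S jac"
  unfolding jac_def matrix_matrix_mult_def by (intro continuous_intros)

lemma C1_on_lift_0: "C1_on S (lift 0)"
proof (rule C1_onI[OF has_derivative_lift_0])
  show "continuous_on S (\<lambda>x. jac x *v i)" for i
    unfolding matrix_vector_mult_def by (intro continuous_intros continuous_jac)
qed

lemma C1_on_lift: "C1_on S (\<lambda>(s, x). lift s x)"
  unfolding case_prod_unfold
proof (rule C1_onI)
  fix p :: "real \<times> (real^2)"
  show "((\<lambda>p. lift (fst p) (snd p)) has_derivative (\<lambda>dp. A *v snd dp
     + ((1 - fst p) * t * cos (2 * pi * ell (snd p)) * ell (snd dp)
       - fst dp * (t / (2 * pi)) * sin (2 * pi * ell (snd p))) *\<^sub>R (A *v u))) (at p within S)"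
    using has_derivative_lift[of "fst p" "snd p"] by (simp add: case_prod_unfold)
qed (intro continuous_intros)

lemma C1_on_unlift: "C1_on S (\<lambda>x. unlift (x + m))"
proof (rule C1_onI)
  fix x :: "real^2"
  have "((\<lambda>x. x + m) has_derivative (\<lambda>h. h)) (at x within S)"
    by (auto intro!: derivative_eq_intros)
  from has_derivative_compose[OF this has_derivative_unlift]
  show "((\<lambda>x. unlift (x + m)) has_derivative (\<lambda>h. inv2 A *v h
    - (t * cos (2 * pi * ell (inv2 A *v (x + m))) * ell (inv2 A *v h)) *\<^sub>R u)) (at x within S)"
    by simp
qed (intro continuous_intros)

lemma C1_regular_f: "C1_regular f"
  unfolding C1_regular_def
  by (intro allI exI[of _ UNIV] exI[of _ "lift 0"] exI[of _ jac])
     (auto simp: f_proj has_derivative_lift_0 det_jac det_A_nonzero continuous_jac)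

lemma torus_jac_f: "torus_jac f (proj x) = jac x"
  by (rule torus_deriv_lift(2)[OF open_UNIV _ f_proj has_derivative_lift_0]) simp

lemma det_torus_jac_f: "det (torus_jac f p) = of_int (det E)"
  using torus_jac_f det_jac det_A proj_surj by (metis surj_def)

text \<open>Enumerates the preimages of \<open>proj x\<close> by integer vectors; by
  \<open>branch_eq_iff\<close> two indices give the same preimage exactly when they agree modulo the
  image of the lattice under \<open>A\<close>.\<close>

definition branch :: "real^2 \<Rightarrow> real^2 \<Rightarrow> torus" where
  "branch x m = proj (unlift (x + m))"

lemma preimage_branch: "f -` {proj x} = branch x ` int_vecs"
proof (intro set_eqI iffI)
  fix q assume q: "q \<in> f -` {proj x}"
  obtain y where y: "q = proj y" using proj_surj by (metis surj_def)
  then have "lift 0 y - x \<in> int_vecs" using q by (simp add: f_proj proj_eq_iff_diff)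
  moreover have "q = branch x (lift 0 y - x)" by (simp add: branch_def y unlift_lift)
  ultimately show "q \<in> branch x ` int_vecs" by blast
next
  fix q assume "q \<in> branch x ` int_vecs"
  then show "q \<in> f -` {proj x}" by (auto simp: branch_def f_proj lift_unlift)
qed

lemma branch_eq_iff:
  assumes "m \<in> int_vecs" "m' \<in> int_vecs"
  shows "branch x m = branch x m' \<longleftrightarrow> inv2 A *v (m - m') \<in> int_vecs"
proof
  assume "branch x m = branch x m'"
  then obtain n where n: "n \<in> int_vecs" "unlift (x + m) = unlift (x + m') + n"
    unfolding branch_def proj_eq_iff_diff by (metis add.commute diff_add_cancel)
  have "x + m = lift 0 (unlift (x + m') + n)" using n(2) lift_unlift by metis
  also have "\<dots> = x + m' + A *v n" by (simp add: lift_add_int[OF n(1)] lift_unlift)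
  finally have "m - m' = A *v n" by simp
  then show "inv2 A *v (m - m') \<in> int_vecs" using n(1) by (simp add: inv2_vector[OF det_A_nonzero])
next
  assume n: "inv2 A *v (m - m') \<in> int_vecs"
  define n where "n = inv2 A *v (m - m')"
  have "inv2 A *v (x + m) = inv2 A *v (x + m') + n"
    by (simp add: n_def matrix_vector_right_distrib[symmetric])
  then have "unlift (x + m) = unlift (x + m') + n"
    using n unfolding unlift_def n_def[symmetric] by (simp add: ell_linear sin_int[OF ell_int])
  then show "branch x m = branch x m'" using n by (simp add: branch_def n_def)
qed

text \<open>The number is the same for all points, because the criterion in
  \<open>branch_eq_iff\<close> does not involve \<open>x\<close>. The determinant is constant too,
  so the area formula for the constant 1 determines the number.\<close>

lemma card_preimage: "card (f -` {p}) = nat \<bar>det E\<bar>"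
proof -
  have const: "card (f -` {p}) = card (f -` {q})" for p q
  proof -
    obtain x y where xy: "p = proj x" "q = proj y" using proj_surj by (metis surj_def)
    show ?thesis
      unfolding xy preimage_branch by (intro card_image_eq_by_kernel) (simp add: branch_eq_iff)
  qed
  define d where "d = \<bar>real_of_int (det E)\<bar>"
  have d: "d > 0" using det_E by (simp add: d_def)
  have "1 = (\<integral>\<^sup>+q. 1 \<partial>haar_torus)" by (simp add: haar.emeasure_space_1[simplified])
  also have "\<dots> = (\<integral>\<^sup>+q. (\<Sum>r\<in>f -` {q}. 1 / ennreal \<bar>det (torus_jac f r)\<bar>) \<partial>haar_torus)"
    by (rule area_formula(3)[OF C1_regular_f]) simp
  also have "\<dots> = (\<integral>\<^sup>+q. ennreal (card (f -` {p}) / d) \<partial>haar_torus)"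
  proof (rule nn_integral_cong)
    fix q
    have "1 / ennreal d = ennreal (1 / d)" using d by (simp add: divide_ennreal[symmetric])
    then have "(\<Sum>r\<in>f -` {q}. 1 / ennreal \<bar>det (torus_jac f r)\<bar>) = of_nat (card (f -` {q})) * ennreal (1 / d)"
      by (simp add: det_torus_jac_f d_def)
    also have "\<dots> = ennreal (card (f -` {q}) / d)"
      using d by (simp add: ennreal_of_nat_eq_real_of_nat ennreal_mult[symmetric])
    also have "card (f -` {q}) = card (f -` {p})" by (rule const)
    finally show "(\<Sum>r\<in>f -` {q}. 1 / ennreal \<bar>det (torus_jac f r)\<bar>) = ennreal (card (f -` {p}) / d)" .
  qed
  also have "\<dots> = ennreal (card (f -` {p}) / d)" by (simp add: haar.emeasure_space_1[simplified])
  finally have "card (f -` {p}) / d = 1" by (metis ennreal_eq_1)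
  then have "real (card (f -` {p})) = d" using d by simp
  then show ?thesis unfolding d_def by linarith
qed

text \<open>Converse of \<open>weight_sum\<close>: every point has \<open>\<bar>det E\<bar>\<close>
  preimages of weight \<open>1 / \<bar>det E\<bar>\<close> each, so the area formula returns the
  measure of \<open>X\<close>.\<close>

lemma f_invariant: "distr haar_torus haar_torus f = haar_torus"
proof (rule measure_eqI)
  fix X assume "X \<in> sets (distr haar_torus haar_torus f)"
  then have X [measurable]: "X \<in> sets borel" by simp
  have fb [measurable]: "f \<in> borel \<rightarrow>\<^sub>M borel"
    by (intro borel_measurable_continuous_onI C1_regular_continuous C1_regular_f)
  then have fm: "f \<in> haar_torus \<rightarrow>\<^sub>M haar_torus" by (simp cong: measurable_cong_sets)
  define d where "d = \<bar>real_of_int (det E)\<bar>"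
  have d: "d > 0" "real (card (f -` {p})) = d" for p using det_E by (simp_all add: d_def card_preimage)
  have "emeasure (distr haar_torus haar_torus f) X = (\<integral>\<^sup>+p. indicator X p \<partial>distr haar_torus haar_torus f)"
    by simp
  also have "\<dots> = (\<integral>\<^sup>+q. indicator X (f q) \<partial>haar_torus)"
    by (rule nn_integral_distr[OF fm]) simp
  also have "\<dots> = (\<integral>\<^sup>+p. (\<Sum>q\<in>f -` {p}. indicator X (f q) / ennreal \<bar>det (torus_jac f q)\<bar>) \<partial>haar_torus)"
    by (rule area_formula(3)[OF C1_regular_f]) measurable
  also have "\<dots> = (\<integral>\<^sup>+p. indicator X p \<partial>haar_torus)"
  proof (rule nn_integral_cong)
    fix p
    have "(\<Sum>q\<in>f -` {p}. indicator X (f q) / ennreal \<bar>det (torus_jac f q)\<bar>)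
        = (\<Sum>q\<in>f -` {p}. ennreal (indicator X p / d))"
      using d(1) by (intro sum.cong) (auto simp: det_torus_jac_f d_def indicator_def divide_ennreal[symmetric])
    also have "\<dots> = ennreal (d * (indicator X p / d))"
      using d by (simp add: ennreal_of_nat_eq_real_of_nat ennreal_mult[symmetric] del: ennreal_divide_times)
    finally show "(\<Sum>q\<in>f -` {p}. indicator X (f q) / ennreal \<bar>det (torus_jac f q)\<bar>) = indicator X p"
      using d(1) by (simp add: indicator_def)
  qed
  finally show "emeasure (distr haar_torus haar_torus f) X = emeasure haar_torus X" by simp
qed simp

sublocale torus_endo f
  by unfold_locales (rule C1_regular_f f_invariant)+

lemma C1_local_diffeo_f: "C1_local_diffeo f"
  unfolding C1_local_diffeo_def
proof
  fix p
  obtain U where U: "p \<in> U" "open U" "inj_on f U" "\<And>V. V \<subseteq> U \<Longrightarrow> open V \<Longrightarrow> open (f ` V)"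
    using area_local[OF C1_regular_f, of p] unfolding area_chart_def by metis
  have contf: "continuous_on U f"
    using C1_regular_continuous[OF C1_regular_f] by (rule continuous_on_subset) simp
  obtain g where g: "homeomorphism U (f ` U) f g"
  proof (rule homeomorphism_injective_open_map[OF contf refl U(3)])
    fix V assume "openin (top_of_set U) V"
    then have "V \<subseteq> U" "open V" using U(2) by (auto simp: openin_open_eq)
    then show "openin (top_of_set (f ` U)) (f ` V)"
      using U(4) by (intro open_subset) auto
  qed
  have "torus_C1_on U f"
    unfolding torus_C1_on_def lifts_locally_def
    by (intro ballI exI[of _ UNIV] exI[of _ "lift 0"]) (auto simp: C1_on_lift_0 f_proj)
  moreover have "torus_C1_on (f ` U) g"
    unfolding torus_C1_on_def lifts_locally_def
  proof
    fix z assume "z \<in> proj -` f ` U"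
    then obtain q where q: "q \<in> U" "f q = proj z" by auto
    then obtain m where m: "m \<in> int_vecs" "q = branch z m" using preimage_branch[of z] by blast
    \<comment> \<open>On \<open>W\<close> the branch of the inverse with index \<open>m\<close>
      stays in \<open>U\<close>, hence coincides with \<open>g\<close> there; so \<open>g\<close> is
      lifted by a translate of \<open>unlift\<close>.\<close>
    define W where "W = (\<lambda>x. proj (unlift (x + m))) -` U"
    have "continuous_on UNIV (\<lambda>x. proj (unlift (x + m)))"
      unfolding unlift_def by (intro continuous_on_compose2[OF continuous_on_proj] continuous_intros) auto
    then have "open W" unfolding W_def using U(2) by (simp add: continuous_on_open_vimage)
    moreover have "z \<in> W" using q(1) m(2) by (simp add: W_def branch_def)
    moreover have "g (proj y) = proj (unlift (y + m))" if "y \<in> W" for y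
    proof -
      have "f (proj (unlift (y + m))) = proj y" using m(1) by (simp add: f_proj lift_unlift)
      moreover have "g (f (proj (unlift (y + m)))) = proj (unlift (y + m))"
        using that by (intro homeomorphism_apply1[OF g]) (simp add: W_def)
      ultimately show ?thesis by simp
    qed
    ultimately show "\<exists>W F. open W \<and> z \<in> W \<and> C1_on (proj -` f ` U \<inter> W) F \<and>
      (\<forall>y\<in>proj -` f ` U \<inter> W. (g \<circ> proj) y = proj (F y))"
      by (intro exI[of _ W] exI[of _ "\<lambda>x. unlift (x + m)"]) (auto simp: C1_on_unlift)
  qed
  ultimately show "\<exists>U g. open U \<and> p \<in> U \<and> open (f ` U) \<and> homeomorphism U (f ` U) f g \<and>
      torus_C1_on U f \<and> torus_C1_on (f ` U) g"
    using U g by (intro exI[of _ U] exI[of _ g]) auto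
qed

lemma f_End1:
  assumes "\<bar>det E\<bar> \<noteq> 1"
  shows "f \<in> End1"
proof -
  have "\<not> bij f"
  proof
    assume "bij f"
    then have "f -` {f (proj 0)} = {proj 0}" by (auto simp: bij_def inj_def)
    then have "card (f -` {f (proj 0)}) = 1" by simp
    then show False using card_preimage[of "f (proj 0)"] assms by simp
  qed
  then show ?thesis
    using C1_local_diffeo_f f_measurable f_invariant by (simp add: End1_def)
qed

lemma homotopicI:
  assumes "P ({0..1} \<times> UNIV) (\<lambda>(s, x). lift s x)"
  shows "torus_homotopic P f (toral_end E)"
  unfolding torus_homotopic_def
proof (intro exI[of _ "\<lambda>s. torus_map (lift s)"] conjI)
  show "lifts_locally P ({0..1} \<times> UNIV) (\<lambda>(s, x). torus_map (lift s) (proj x))"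
    unfolding lifts_locally_def using assms
    by (intro ballI exI[of _ UNIV] exI[of _ "\<lambda>(s, x). lift s x"]) (auto simp: torus_map_lift)
  show "torus_map (lift 0) = f" by (simp add: f_def)
  show "torus_map (lift 1) = toral_end E"
  proof
    fix p
    obtain x where "p = proj x" using proj_surj by (metis surj_def)
    then show "torus_map (lift 1) p = toral_end E p"
      by (simp add: torus_map_lift toral_end_proj lift_def A_def)
  qed
qed

lemma f_homotopic_C1: "f \<in> C1_homotopy_class E"
  unfolding C1_homotopy_class_def using homotopicI[of C1_on] C1_on_lift by simp

text \<open>The addition theorem separates the two coordinates in the sine of \<open>ell x\<close>,
  so that \<open>lift\<close> becomes a sum of products of entire functions of one coordinate each,
  as \<open>real_analytic_on_prod\<close> requires.\<close>

lemma f_homotopic_analytic: "torus_homotopic real_analytic_on f (toral_end E)"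
proof (rule homotopicI)
  let ?S = "{0..1} \<times> UNIV :: (real \<times> (real^2)) set"
  let ?b0 = "(1, 0) :: real \<times> (real^2)" and ?b1 = "(0, axis 1 1) :: real \<times> (real^2)"
    and ?b2 = "(0, axis 2 1) :: real \<times> (real^2)"
  have ne: "axis 1 1 \<noteq> (axis 2 1 :: real^2)" "axis 1 1 \<noteq> (0 :: real^2)" "axis 2 1 \<noteq> (0 :: real^2)"
    by (simp_all add: axis_eq_axis axis_eq_0_iff)
  have Basis: "Basis = {?b0, ?b1, ?b2}"
    by (auto simp: Basis_prod_def Basis_vec_def UNIV_2)
  have prod3: "real_analytic_on ?S (\<lambda>(s, x). (g0 s * g1 (x$1) * g2 (x$2)) *\<^sub>R w)"
    if "entire g0" "entire g1" "entire g2" for g0 g1 g2 and w :: "real^2"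
  proof -
    define g where "g b = (if b = ?b0 then g0 else if b = ?b1 then g1 else g2)" for b
    have "real_analytic_on ?S (\<lambda>p. (\<Prod>b\<in>Basis. g b (p \<bullet> b)) *\<^sub>R w)"
      by (rule real_analytic_on_prod) (use that in \<open>auto simp: g_def\<close>)
    also have "(\<lambda>p. (\<Prod>b\<in>Basis. g b (p \<bullet> b)) *\<^sub>R w) = (\<lambda>(s, x). (g0 s * g1 (x$1) * g2 (x$2)) *\<^sub>R w)"
      unfolding Basis using ne by (auto simp: g_def inner_axis fun_eq_iff mult.assoc)
    finally show ?thesis .
  qed
  have const: "entire (\<lambda>_. 1)" and ident: "entire (\<lambda>x. x)" and rev: "entire (\<lambda>x. 1 - x)"
    using entire_affine[of 1 0] entire_affine[of 0 1] entire_affine[of 1 "-1"] by simp_all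
  let ?c = "(t / (2 * pi)) *\<^sub>R (A *v u)"
  have "real_analytic_on ?S (\<lambda>p. (\<lambda>(s, x). (1 * x$1 * 1) *\<^sub>R (A *v axis 1 1)) p +
      ((\<lambda>(s, x). (1 * 1 * x$2) *\<^sub>R (A *v axis 2 1)) p +
      ((\<lambda>(s, x). ((1 - s) * sin (2 * pi * x$1) * cos (2 * pi * k * x$2)) *\<^sub>R ?c) p +
       (\<lambda>(s, x). ((1 - s) * cos (2 * pi * x$1) * sin (2 * pi * k * x$2)) *\<^sub>R ?c) p)))"
    by (intro real_analytic_on_add prod3 const ident rev entire_sin entire_cos)
  moreover have "lift s x = (1 * x$1 * 1) *\<^sub>R (A *v axis 1 1) + ((1 * 1 * x$2) *\<^sub>R (A *v axis 2 1) +
      (((1 - s) * sin (2 * pi * x$1) * cos (2 * pi * k * x$2)) *\<^sub>R ?c +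
       ((1 - s) * cos (2 * pi * x$1) * sin (2 * pi * k * x$2)) *\<^sub>R ?c))" for s x
  proof -
    have "x = x$1 *\<^sub>R axis 1 1 + x$2 *\<^sub>R axis 2 1"
      by (simp add: vec_eq_iff forall_2 axis_def)
    then have "A *v x = x$1 *\<^sub>R (A *v axis 1 1) + x$2 *\<^sub>R (A *v axis 2 1)"
      by (metis matrix_vector_right_distrib matrix_vector_mult_scaleR)
    note Ax = this
    have sin: "sin (2 * pi * ell x) = sin (2 * pi * x$1) * cos (2 * pi * k * x$2) + cos (2 * pi * x$1) * sin (2 * pi * k * x$2)"
      by (simp add: ell_def distrib_left sin_add mult.assoc)
    have distrib: "(a * b * (p + q)) *\<^sub>R w = (a * p) *\<^sub>R (b *\<^sub>R w) + (a * q) *\<^sub>R (b *\<^sub>R w)"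
      for a b p q and w :: "real^2"
      by (simp add: vec_eq_iff algebra_simps)
    show ?thesis
      unfolding lift_def Ax sin distrib by (simp only: mult.assoc mult_1_left mult_1_right add.assoc)
  qed
  ultimately show "real_analytic_on ?S (\<lambda>(s, x). lift s x)" by (simp add: case_prod_unfold)
qed

end

section \<open>Growth along preimages\<close>

text \<open>A vector \<open>v\<close> is good if \<open>B v\<close> is transversal to the shear direction \<open>u\<close>. The vector \<open>w\<close> below is
  \<open>B v\<close> sheared by the factor \<open>t c\<close>; with \<open>B = A\<^sup>-\<^sup>1\<close> and \<open>c\<close> a value of the cosine it is the image of \<open>v\<close>
  under an inverse branch.\<close>

definition shear_bound :: "real^2^2 \<Rightarrow> (real^2 \<Rightarrow> real) \<Rightarrow> real^2 \<Rightarrow> real \<Rightarrow> real \<Rightarrow> real \<Rightarrow> real \<Rightarrow>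
    real^2 \<Rightarrow> real \<Rightarrow> real \<Rightarrow> bool" where
  "shear_bound B ell u \<kappa> \<eta> \<epsilon> t v q c \<longleftrightarrow>
    (let good = (\<lambda>x. \<eta> * norm x \<le> \<bar>ell (B *v x)\<bar>); w = B *v v - (t * c * ell (B *v v)) *\<^sub>R u in
      (\<kappa> \<le> \<bar>c - q\<bar> \<longrightarrow> good w \<and> \<epsilon> * norm v * (if good v then t else 1) \<le> norm w) \<and>
      \<epsilon> * norm v / (if good v then 1 else t) \<le> norm w)"

text \<open>In the basis \<open>e1\<close>, \<open>u\<close> the sheared vector is
  \<open>\<alpha> *\<^sub>R e1 + b c *\<^sub>R u\<close>, where
  \<open>\<alpha> = ell (B *v v)\<close> is untouched by the shear and
  \<open>b c = \<beta> - t * c * \<alpha>\<close>. If \<open>\<bar>b c\<bar>\<close> is large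
  compared with \<open>\<bar>\<alpha>\<bar>\<close>, the vector is nearly parallel to
  \<open>u\<close>, hence good by transversality. For good \<open>v\<close> this happens for
  \<open>c\<close> away from 0; otherwise \<open>\<beta>\<close> is large and it happens for
  \<open>c\<close> away from the zero of \<open>b\<close>.\<close>

lemma shear_growth:
  fixes B :: "real^2^2" and k \<kappa> :: real and ell :: "real^2 \<Rightarrow> real" and u :: "real^2"
  assumes ell_def: "\<And>x. ell x = x$1 + k * x$2" and u_def: "u = vector [- k, 1]"
    and det: "det B \<noteq> 0" and transversal: "ell (B *v u) \<noteq> 0" and \<kappa>: "0 < \<kappa>" "\<kappa> \<le> 1"
  shows "\<exists>\<eta> \<epsilon> t0. 0 < \<epsilon> \<and> 1 \<le> t0 \<and>
    (\<forall>t\<ge>t0. \<forall>v. v \<noteq> 0 \<longrightarrow> (\<exists>q. \<forall>c. \<bar>c\<bar> \<le> 1 \<longrightarrow> shear_bound B ell u \<kappa> \<eta> \<epsilon> t v q c))"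
proof -
  define e1 where "e1 = (axis 1 1 :: real^2)"
  define \<nu> \<mu> where "\<nu> = \<bar>ell (B *v u)\<bar>" and "\<mu> = \<bar>ell (B *v e1)\<bar>"
  define P where "P = 1 + \<bar>k\<bar>"
  define K where "K = onorm ((*v) B)"
  define K1 where "K1 = conorm ((*v) B)"
  have \<nu>: "\<nu> > 0" and \<mu>: "\<mu> \<ge> 0" and P: "P \<ge> 1" using transversal by (auto simp: \<nu>_def \<mu>_def P_def)
  have K: "K > 0" and K1: "K1 > 0" using onorm_pos[OF det] conorm_pos[OF det] by (auto simp: K_def K1_def)
  \<comment> \<open>For \<open>\<bar>\<alpha>\<bar> \<le> \<delta> * \<bar>b c\<bar>\<close> the
    \<open>e1\<close> part of the functional is at most half of its \<open>u\<close> part.\<close>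
  define \<delta> where "\<delta> = min 1 (\<nu> / (2 * (\<mu> + 1)))"
  have \<delta>: "0 < \<delta>" "\<delta> \<le> 1" "\<delta> * \<mu> \<le> \<nu> / 2"
  proof -
    show "0 < \<delta>" "\<delta> \<le> 1" using \<nu> \<mu> by (auto simp: \<delta>_def)
    have "\<delta> * \<mu> \<le> \<nu> / (2 * (\<mu> + 1)) * (\<mu> + 1)"
      using \<nu> \<mu> by (intro mult_mono) (auto simp: \<delta>_def)
    also have "\<dots> = \<nu> / 2"
    proof -
      have "\<mu> + 1 \<noteq> 0" using \<mu> by simp
      then show ?thesis by (simp add: field_simps)
    qed
    finally show "\<delta> * \<mu> \<le> \<nu> / 2" .
  qed
  define c3 where "c3 = K1 / (2 * P)"
  have c3: "c3 > 0" using K1 P by (auto simp: c3_def)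
  \<comment> \<open>The first bound makes vectors nearly parallel to \<open>u\<close> good. The
    other two concern a \<open>v\<close> that is not good: its \<open>\<beta>\<close> is at least
    \<open>c3 * norm v\<close>, and its \<open>\<alpha>\<close> is at most
    \<open>\<delta> * \<bar>b c\<bar>\<close> away from \<open>q\<close>.\<close>
  define \<eta> where "\<eta> = min (\<nu> / (2 * (1 + P))) (min (K1 / 2) (\<delta> * \<kappa> * c3 / 2))"
  have \<eta>: "0 < \<eta>" "\<eta> * (1 + P) \<le> \<nu> / 2" "\<eta> \<le> K1 / 2" "\<eta> \<le> \<delta> * \<kappa> * c3 / 2"
  proof -
    show "0 < \<eta>" using \<nu> P K1 \<delta> \<kappa> c3 by (auto simp: \<eta>_def)
    show "\<eta> \<le> K1 / 2" "\<eta> \<le> \<delta> * \<kappa> * c3 / 2" by (auto simp only: \<eta>_def min_le_iff_disj order_refl)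
    have "\<eta> \<le> \<nu> / (2 * (1 + P))" by (simp add: \<eta>_def)
    then have "\<eta> * (1 + P) \<le> \<nu> / (2 * (1 + P)) * (1 + P)" using P by (intro mult_right_mono) auto
    also have "\<dots> = \<nu> / 2"
    proof -
      have "1 + P \<noteq> 0" using P by simp
      then show ?thesis by (simp add: field_simps)
    qed
    finally show "\<eta> * (1 + P) \<le> \<nu> / 2" .
  qed
  \<comment> \<open>For good \<open>v\<close> and \<open>\<kappa> \<le> \<bar>c\<bar>\<close> the
    term \<open>t * c * \<alpha>\<close> then exceeds \<open>\<beta>\<close> by enough to make
    \<open>b c\<close> of order \<open>t\<close> and at least
    \<open>\<bar>\<alpha>\<bar> / \<delta>\<close>.\<close>
  define t0 where "t0 = max 1 (max (2 * K / (\<kappa> * \<eta>)) (2 * P * K / (\<kappa> * \<eta> * \<delta>)))"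
  define \<epsilon> where "\<epsilon> = min (\<kappa> * \<eta> / 2) (min (\<eta> / P) (min (\<kappa> * c3 / 2) (K1 / (3 * P * P))))"
  have \<epsilon>: "0 < \<epsilon>" "\<epsilon> \<le> \<kappa> * \<eta> / 2" "\<epsilon> \<le> \<eta> / P" "\<epsilon> \<le> \<kappa> * c3 / 2" "\<epsilon> \<le> K1 / (3 * P * P)"
  proof -
    show "0 < \<epsilon>" using \<kappa> \<eta> c3 K1 P by (auto simp: \<epsilon>_def)
  qed (auto simp only: \<epsilon>_def min_le_iff_disj order_refl)
  have main: "\<exists>q. \<forall>c. \<bar>c\<bar> \<le> 1 \<longrightarrow> shear_bound B ell u \<kappa> \<eta> \<epsilon> t v q c"
    if t: "t0 \<le> t" and v: "v \<noteq> 0" for t v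
  proof -
    have t1: "t \<ge> 1" and t2: "2 * K / (\<kappa> * \<eta>) \<le> t" and t3: "2 * P * K / (\<kappa> * \<eta> * \<delta>) \<le> t"
      using t by (auto simp: t0_def)
    have t2: "2 * K \<le> t * (\<kappa> * \<eta>)" using t2 \<kappa> \<eta> by (simp add: divide_le_eq)
    have t3: "2 * P * K \<le> t * (\<kappa> * \<eta> * \<delta>)" using t3 \<kappa> \<eta> \<delta> by (simp add: divide_le_eq)
    define n where "n = norm v"
    have n: "n > 0" using v by (simp add: n_def)
    define w where "w = B *v v"
    define \<alpha> \<beta> where "\<alpha> = ell w" and "\<beta> = w$2"
    have wK: "norm w \<le> K * n" unfolding w_def K_def n_def by (rule onorm[OF matrix_vector_mul_bounded_linear])
    have wK1: "K1 * n \<le> norm w" unfolding w_def K1_def n_def by (rule conorm_mult_le)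
    have ell_le: "\<bar>ell x\<bar> \<le> P * norm x" for x
    proof -
      have "\<bar>ell x\<bar> \<le> \<bar>x$1\<bar> + \<bar>k\<bar> * \<bar>x$2\<bar>"
        unfolding ell_def using abs_triangle_ineq[of "x$1" "k * x$2"] by (simp add: abs_mult)
      also have "\<dots> \<le> norm x + \<bar>k\<bar> * norm x"
        by (intro add_mono mult_left_mono component_le_norm_cart) auto
      finally show ?thesis by (simp add: P_def algebra_simps)
    qed
    have \<beta>K: "\<bar>\<beta>\<bar> \<le> K * n" unfolding \<beta>_def using component_le_norm_cart[of w 2] wK by linarith
    have \<alpha>K: "\<bar>\<alpha>\<bar> \<le> P * (K * n)"
      unfolding \<alpha>_def by (rule order_trans[OF ell_le]) (use wK P in \<open>intro mult_left_mono, auto\<close>)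
    define W where "W c = w - (t * c * \<alpha>) *\<^sub>R u" for c
    define b where "b c = \<beta> - t * c * \<alpha>" for c
    have W2: "W c $ 2 = b c" and W1: "W c $ 1 = \<alpha> - k * b c" for c
      by (simp_all add: W_def b_def \<alpha>_def \<beta>_def ell_def u_def algebra_simps)
    have W_eq: "W c = \<alpha> *\<^sub>R e1 + b c *\<^sub>R u" for c
      using W1[of c] W2[of c] by (simp add: vec_eq_iff forall_2 e1_def u_def axis_def)
    have b_le: "\<bar>b c\<bar> \<le> norm (W c)" for c using component_le_norm_cart[of "W c" 2] W2 by simp
    have \<alpha>_le: "\<bar>\<alpha>\<bar> \<le> P * norm (W c)" for c
    proof -
      have "ell (W c) = \<alpha>" by (simp add: ell_def W1 W2)
      then show ?thesis using ell_le[of "W c"] by simp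
    qed
    have W_le: "norm (W c) \<le> \<bar>\<alpha>\<bar> + P * \<bar>b c\<bar>" for c
    proof -
      have "norm (W c) \<le> \<bar>W c $ 1\<bar> + \<bar>W c $ 2\<bar>" using norm_le_l1_cart[of "W c"] by (simp add: sum_2)
      also have "\<dots> \<le> (\<bar>\<alpha>\<bar> + \<bar>k\<bar> * \<bar>b c\<bar>) + \<bar>b c\<bar>"
        unfolding W1 W2 using abs_triangle_ineq4[of \<alpha> "k * b c"] by (simp add: abs_mult)
      finally show ?thesis by (simp add: P_def algebra_simps)
    qed
    have good: "\<eta> * norm (W c) \<le> \<bar>ell (B *v W c)\<bar>" if "\<bar>\<alpha>\<bar> \<le> \<delta> * \<bar>b c\<bar>" for c
    proof -
      have "ell (B *v W c) = \<alpha> * ell (B *v e1) + b c * ell (B *v u)"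
        unfolding W_eq by (simp add: ell_def matrix_vector_right_distrib matrix_vector_mult_scaleR algebra_simps)
      then have "\<bar>b c\<bar> * \<nu> - \<bar>\<alpha>\<bar> * \<mu> \<le> \<bar>ell (B *v W c)\<bar>"
        unfolding \<nu>_def \<mu>_def abs_mult[symmetric] by linarith
      moreover have "\<bar>\<alpha>\<bar> * \<mu> \<le> \<bar>b c\<bar> * (\<nu> / 2)"
      proof -
        have "\<bar>\<alpha>\<bar> * \<mu> \<le> (\<delta> * \<bar>b c\<bar>) * \<mu>" using that \<mu> by (rule mult_right_mono)
        also have "\<dots> = \<bar>b c\<bar> * (\<delta> * \<mu>)" by simp
        also have "\<dots> \<le> \<bar>b c\<bar> * (\<nu> / 2)" by (intro mult_left_mono \<delta>) auto
        finally show ?thesis .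
      qed
      moreover have "\<eta> * norm (W c) \<le> \<bar>b c\<bar> * (\<nu> / 2)"
      proof -
        have "\<bar>\<alpha>\<bar> \<le> 1 * \<bar>b c\<bar>" using that \<delta>(2) by (meson abs_ge_zero mult_right_mono order_trans)
        then have "norm (W c) \<le> (1 + P) * \<bar>b c\<bar>" using W_le[of c] by (simp add: algebra_simps)
        then have "\<eta> * norm (W c) \<le> \<eta> * ((1 + P) * \<bar>b c\<bar>)" using \<eta>(1) by (intro mult_left_mono) auto
        also have "\<dots> = \<bar>b c\<bar> * (\<eta> * (1 + P))" by simp
        also have "\<dots> \<le> \<bar>b c\<bar> * (\<nu> / 2)" by (intro mult_left_mono \<eta>) auto
        finally show ?thesis .
      qed
      ultimately show ?thesis by (simp add: field_simps)
    qed
    have "\<exists>q. \<forall>c. \<bar>c\<bar> \<le> 1 \<longrightarrow>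
      (\<kappa> \<le> \<bar>c - q\<bar> \<longrightarrow> \<eta> * norm (W c) \<le> \<bar>ell (B *v W c)\<bar> \<and>
        \<epsilon> * n * (if \<eta> * n \<le> \<bar>\<alpha>\<bar> then t else 1) \<le> norm (W c)) \<and>
      \<epsilon> * n / (if \<eta> * n \<le> \<bar>\<alpha>\<bar> then 1 else t) \<le> norm (W c)"
    proof (cases "\<eta> * n \<le> \<bar>\<alpha>\<bar>")
      case True
      have 1: "\<epsilon> * n \<le> norm (W c)" for c
      proof -
        have "P * (\<epsilon> * n) \<le> P * (\<eta> / P * n)" using \<epsilon>(3) P n by (intro mult_left_mono mult_right_mono) auto
        also have "\<dots> = \<eta> * n" using P by simp
        also have "\<dots> \<le> P * norm (W c)" using True \<alpha>_le[of c] by linarith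
        finally show ?thesis using P by simp
      qed
      have 2: "t * (\<kappa> * \<eta>) / 2 * n \<le> \<bar>b c\<bar>" if "\<kappa> \<le> \<bar>c\<bar>" for c
      proof -
        have "t * (\<kappa> * (\<eta> * n)) \<le> t * (\<bar>c\<bar> * \<bar>\<alpha>\<bar>)"
          using that True \<kappa> \<eta> n t1 by (intro mult_left_mono mult_mono) auto
        also have "\<dots> = \<bar>t * c * \<alpha>\<bar>" using t1 by (simp add: abs_mult)
        also have "\<dots> \<le> \<bar>b c\<bar> + \<bar>\<beta>\<bar>" unfolding b_def by linarith
        finally have "t * (\<kappa> * (\<eta> * n)) \<le> \<bar>b c\<bar> + K * n" using \<beta>K by linarith
        moreover have "2 * K * n \<le> t * (\<kappa> * \<eta>) * n" using t2 n by (intro mult_right_mono) auto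
        ultimately show ?thesis by (simp add: algebra_simps)
      qed
      have 3: "\<bar>\<alpha>\<bar> \<le> \<delta> * \<bar>b c\<bar>" if "\<kappa> \<le> \<bar>c\<bar>" for c
      proof -
        have "2 * P * K * n \<le> t * (\<kappa> * \<eta> * \<delta>) * n" using t3 n by (intro mult_right_mono) auto
        moreover have "\<delta> * (t * (\<kappa> * \<eta>) / 2 * n) \<le> \<delta> * \<bar>b c\<bar>" using 2[OF that] \<delta> by (intro mult_left_mono) auto
        ultimately show ?thesis using \<alpha>K by (simp add: algebra_simps)
      qed
      have 4: "\<epsilon> * n * t \<le> norm (W c)" if "\<kappa> \<le> \<bar>c\<bar>" for c
      proof -
        have "\<epsilon> * n * t \<le> \<kappa> * \<eta> / 2 * n * t" using \<epsilon>(2) n t1 by (intro mult_right_mono) auto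
        also have "\<dots> = t * (\<kappa> * \<eta>) / 2 * n" by simp
        also have "\<dots> \<le> norm (W c)" using 2[OF that] b_le[of c] by linarith
        finally show ?thesis .
      qed
      show ?thesis using True 1 4 good[OF 3] by (intro exI[of _ 0]) auto
    next
      case False
      have \<beta>: "c3 * n \<le> \<bar>\<beta>\<bar>"
      proof -
        have "norm w \<le> \<bar>\<alpha>\<bar> + P * \<bar>\<beta>\<bar>" using W_le[of 0] by (simp add: W_def b_def)
        moreover have "\<eta> * n \<le> K1 / 2 * n" using \<eta>(3) n by (intro mult_right_mono) auto
        ultimately have "K1 / 2 * n \<le> P * \<bar>\<beta>\<bar>" using False wK1 by linarith
        then show ?thesis using P by (simp add: c3_def field_simps)
      qed
      \<comment> \<open>The zero of \<open>b\<close>; if \<open>\<alpha> = 0\<close>, then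
        \<open>b\<close> is constantly \<open>\<beta>\<close> and the value of \<open>q\<close> is
        arbitrary.\<close>
      define q where "q = (if \<alpha> = 0 then 0 else \<beta> / (t * \<alpha>))"
      have 2: "\<kappa> / 2 * \<bar>\<beta>\<bar> \<le> \<bar>b c\<bar>" if "\<bar>c\<bar> \<le> 1" "\<kappa> \<le> \<bar>c - q\<bar>" for c
      proof (cases "\<bar>t * \<alpha>\<bar> \<le> \<bar>\<beta>\<bar> / 2")
        case True
        have "\<bar>t * c * \<alpha>\<bar> = \<bar>c\<bar> * \<bar>t * \<alpha>\<bar>" by (simp add: abs_mult)
        also have "\<dots> \<le> 1 * \<bar>t * \<alpha>\<bar>" using that by (intro mult_right_mono) auto
        finally have "\<bar>\<beta>\<bar> / 2 \<le> \<bar>b c\<bar>" unfolding b_def using True by linarith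
        moreover have "\<kappa> / 2 * \<bar>\<beta>\<bar> \<le> 1 / 2 * \<bar>\<beta>\<bar>" using \<kappa> by (intro mult_right_mono) auto
        ultimately show ?thesis by linarith
      next
        case F: False
        then have "\<alpha> \<noteq> 0" by auto
        then have "b c = t * \<alpha> * (q - c)" using t1 by (simp add: b_def q_def field_simps)
        then have "\<bar>b c\<bar> = \<bar>t * \<alpha>\<bar> * \<bar>c - q\<bar>" by (simp add: abs_mult abs_minus_commute)
        moreover have "(\<bar>\<beta>\<bar> / 2) * \<kappa> \<le> \<bar>t * \<alpha>\<bar> * \<bar>c - q\<bar>" using F that \<kappa> by (intro mult_mono) auto
        ultimately show ?thesis by (simp add: mult.commute)
      qed
      have 3: "\<kappa> * c3 / 2 * n \<le> \<bar>b c\<bar>" if "\<bar>c\<bar> \<le> 1" "\<kappa> \<le> \<bar>c - q\<bar>" for c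
      proof -
        have "\<kappa> / 2 * (c3 * n) \<le> \<kappa> / 2 * \<bar>\<beta>\<bar>" using \<beta> \<kappa> by (intro mult_left_mono) auto
        then show ?thesis using 2[OF that] by simp
      qed
      have 4: "\<bar>\<alpha>\<bar> \<le> \<delta> * \<bar>b c\<bar>" if "\<bar>c\<bar> \<le> 1" "\<kappa> \<le> \<bar>c - q\<bar>" for c
      proof -
        have "\<bar>\<alpha>\<bar> \<le> (\<delta> * \<kappa> * c3 / 2) * n" using False \<eta>(4) n by (meson less_imp_le mult_right_mono not_le order_trans)
        also have "\<dots> = \<delta> * (\<kappa> * c3 / 2 * n)" by simp
        also have "\<dots> \<le> \<delta> * \<bar>b c\<bar>" using 3[OF that] \<delta> by (intro mult_left_mono) auto
        finally show ?thesis .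
      qed
      have 5: "\<epsilon> * n \<le> norm (W c)" if "\<bar>c\<bar> \<le> 1" "\<kappa> \<le> \<bar>c - q\<bar>" for c
      proof -
        have "\<epsilon> * n \<le> \<kappa> * c3 / 2 * n" using \<epsilon>(4) n by (intro mult_right_mono) auto
        then show ?thesis using 3[OF that] b_le[of c] by linarith
      qed
      \<comment> \<open>If shearing cancels \<open>\<beta>\<close>, then
        \<open>\<bar>\<alpha>\<bar>\<close> has at least the order of
        \<open>\<bar>\<beta>\<bar> / t\<close>, and \<open>\<alpha>\<close> survives in the sheared
        vector; so at most a factor of order \<open>t\<close> is lost.\<close>
      have 6: "\<epsilon> * n / t \<le> norm (W c)" if c: "\<bar>c\<bar> \<le> 1" for c
      proof -
        have "\<bar>t * c * \<alpha>\<bar> = \<bar>c\<bar> * (t * \<bar>\<alpha>\<bar>)" using t1 by (simp add: abs_mult)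
        also have "\<dots> \<le> 1 * (t * (P * norm (W c)))"
          using c \<alpha>_le[of c] t1 by (intro mult_mono mult_left_mono) auto
        finally have "\<bar>\<beta>\<bar> \<le> norm (W c) + t * (P * norm (W c))" using b_le[of c] unfolding b_def by linarith
        then have "P * \<bar>\<beta>\<bar> \<le> P * (norm (W c) + t * (P * norm (W c)))" using P by (intro mult_left_mono) auto
        moreover have "norm w \<le> \<bar>\<alpha>\<bar> + P * \<bar>\<beta>\<bar>" using W_le[of 0] by (simp add: W_def b_def)
        ultimately have "K1 * n \<le> P * norm (W c) + P * (norm (W c) + t * (P * norm (W c)))"
          using wK1 \<alpha>_le[of c] by linarith
        also have "\<dots> = (P + P + t * (P * P)) * norm (W c)" by (simp add: algebra_simps)
        also have "\<dots> \<le> (3 * P * P * t) * norm (W c)"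
        proof (intro mult_right_mono)
          have "P * 1 \<le> P * P" using P by (intro mult_left_mono) auto
          moreover have "(P * P) * 1 \<le> (P * P) * t" using P t1 by (intro mult_left_mono) auto
          ultimately show "P + P + t * (P * P) \<le> 3 * P * P * t" by (simp add: algebra_simps)
        qed simp
        finally have *: "K1 * n \<le> (3 * P * P * t) * norm (W c)" .
        have PP: "0 < 3 * P * P" using P by (intro mult_pos_pos) auto
        have "K1 * n / (3 * P * P) \<le> t * norm (W c)"
          unfolding pos_divide_le_eq[OF PP] using * by (simp only: mult_ac)
        moreover have "\<epsilon> * n \<le> K1 * n / (3 * P * P)"
          using mult_right_mono[OF \<epsilon>(5), of n] n by (simp only: times_divide_eq_left less_imp_le)
        ultimately have "\<epsilon> * n \<le> t * norm (W c)" by linarith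
        then show ?thesis using t1 by (simp add: divide_le_eq mult.commute)
      qed
      show ?thesis using False 5 6 good[OF 4] by (intro exI[of _ q]) auto
    qed
    then show ?thesis
      unfolding shear_bound_def Let_def W_def n_def \<alpha>_def w_def .
  qed
  show ?thesis
    using main \<epsilon>(1) by (intro exI[of _ \<eta>] exI[of _ \<epsilon>] exI[of _ t0]) (auto simp: t0_def)
qed

section \<open>Growth of \<open>I_chi\<close> for the sheared endomorphism\<close>

context sheared_endo
begin

definition cos_at :: "torus \<Rightarrow> real" where
  "cos_at y = cos (2 * pi * ell (SOME x. proj x = y))"

lemma cos_at_proj: "cos_at (proj x) = cos (2 * pi * ell x)"
proof -
  define z where "z = (SOME z. proj z = proj x)"
  have "proj z = proj x" unfolding z_def by (rule someI) simp
  then have "z - x \<in> int_vecs" by (simp add: proj_eq_iff_diff)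
  then have "cos (2 * pi * (ell x + ell (z - x))) = cos (2 * pi * ell x)" by (intro cos_int ell_int)
  then show ?thesis by (simp add: cos_at_def z_def[symmetric] ell_linear)
qed

lemma inv2_torus_jac_f:
  "inv2 (torus_jac f y) *v v = inv2 A *v v - (t * cos_at y * ell (inv2 A *v v)) *\<^sub>R u"
proof -
  obtain x where "y = proj x" using proj_surj by (metis surj_def)
  then show ?thesis by (simp add: torus_jac_f inv2_jac_vector cos_at_proj)
qed

text \<open>Translating by \<open>j m\<^sub>1\<close> permutes the preimages and moves the argument of the cosine by \<open>j / n\<close>,
  so each orbit of length \<open>n\<close> meets a level set in at most two points; double counting gives the rest.\<close>

lemma card_level_preimage:
  fixes n :: nat
  assumes n: "2 \<le> n" and m1: "m1 \<in> int_vecs" "ell (inv2 A *v m1) = 1 / n"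
  shows "n * card {y \<in> f -` {p}. \<bar>cos_at y - q\<bar> < (sin (pi / n))\<^sup>2 / 2} \<le> 2 * card (f -` {p})"
proof -
  obtain x where x: "p = proj x" using proj_surj by (metis surj_def)
  let ?P = "f -` {p}" and ?Q = "\<lambda>y. \<bar>cos_at y - q\<bar> < (sin (pi / n))\<^sup>2 / 2"
  have P: "?P = branch x ` int_vecs" unfolding x by (rule preimage_branch)
  define rep where "rep = inv_into int_vecs (branch x)"
  have rep: "rep y \<in> int_vecs" "branch x (rep y) = y" if "y \<in> ?P" for y
    using that unfolding rep_def P by (auto intro: inv_into_into f_inv_into_f)
  have jm: "real j *\<^sub>R m1 \<in> int_vecs" for j :: nat
    using m1(1) by (auto simp: int_vecs_def)
  \<comment> \<open>Translation acts through the chosen indices \<open>rep y\<close>; it is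
    injective because a common translation cancels in \<open>branch_eq_iff\<close>.\<close>
  define T where "T j y = branch x (rep y + real j *\<^sub>R m1)" for j y
  have injT: "inj_on (T j) ?P" for j
  proof (rule inj_onI)
    fix y z assume yz: "y \<in> ?P" "z \<in> ?P" "T j y = T j z"
    then have "inv2 A *v (rep y - rep z) \<in> int_vecs"
      unfolding T_def using rep jm by (subst (asm) branch_eq_iff) (auto intro: int_vecs_closed)
    then have "branch x (rep y) = branch x (rep z)" using rep yz by (subst branch_eq_iff) auto
    then show "y = z" using rep yz by simp
  qed
  have subT: "T j ` ?P \<subseteq> ?P" for j
    unfolding T_def P using rep jm by (auto intro!: imageI int_vecs_closed(3) simp: P)
  have bij: "bij_betw (T j) ?P ?P" for j
    unfolding bij_betw_def by (intro conjI endo_inj_surj finite_preimage injT subT)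
  have cosT: "cos_at (T j y) = cos (2 * pi * (ell (inv2 A *v (x + rep y)) + j / n))" for j y
  proof -
    have "ell (unlift z) = ell (inv2 A *v z)" for z by (simp add: unlift_def ell_linear)
    moreover have "inv2 A *v (x + (rep y + real j *\<^sub>R m1)) = inv2 A *v (x + rep y) + real j *\<^sub>R (inv2 A *v m1)"
      by (simp add: matrix_vector_right_distrib matrix_vector_mult_scaleR)
    ultimately show ?thesis by (simp add: T_def branch_def cos_at_proj ell_linear m1(2))
  qed
  have "n * card {y \<in> ?P. ?Q y} = (\<Sum>j<n. \<Sum>y\<in>?P. of_bool (?Q y))"
    by (simp add: finite_preimage Int_def)
  also have "\<dots> = (\<Sum>j<n. \<Sum>y\<in>?P. of_bool (?Q (T j y)))"
    by (intro sum.cong refl sum.reindex_bij_betw[OF bij, symmetric])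
  also have "\<dots> = (\<Sum>y\<in>?P. \<Sum>j<n. of_bool (?Q (T j y)))" by (rule sum.swap)
  also have "\<dots> = (\<Sum>y\<in>?P. card {j. j < n \<and> ?Q (T j y)})"
    by (simp add: Int_def)
  also have "\<dots> \<le> (\<Sum>y\<in>?P. 2)"
    unfolding cosT by (intro sum_mono card_cos_level n)
  finally show ?thesis by simp
qed

text \<open>The subtracted \<open>ln t\<close> is the debt of a vector that is not good. Far from
  the level \<open>q\<close> a good \<open>v\<close> gains \<open>ln t\<close> and stays good, while
  another \<open>v\<close> gains nothing but pays off its debt. On \<open>Bad\<close> a good
  \<open>v\<close> may incur the debt, and another \<open>v\<close> loses \<open>ln t\<close> and
  may keep its debt. In every case the net change is at least \<open>ln t\<close> off
  \<open>Bad\<close> and \<open>- ln t\<close> on it, up to \<open>ln \<epsilon>\<close>, and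
  averaging over preimages yields \<open>\<rho>\<close>.\<close>

lemma I_chi_lower:
  fixes n \<tau> :: nat and \<eta> \<epsilon> \<rho> :: real
  assumes \<tau>: "2 \<le> \<tau>" and m1: "m1 \<in> int_vecs" "ell (inv2 A *v m1) = 1 / \<tau>"
    and t: "1 \<le> t" and \<epsilon>: "0 < \<epsilon>"
    and step: "\<forall>v. v \<noteq> 0 \<longrightarrow> (\<exists>q. \<forall>c. \<bar>c\<bar> \<le> 1 \<longrightarrow> shear_bound (inv2 A) ell u ((sin (pi / \<tau>))\<^sup>2 / 2) \<eta> \<epsilon> t v q c)"
    and v: "v \<noteq> 0"
  defines "\<rho> \<equiv> (1 - 4 / \<tau>) * ln t + ln \<epsilon>"
  shows "ln (norm v) + n * \<rho> - (if \<eta> * norm v \<le> \<bar>ell (inv2 A *v v)\<bar> then 0 else ln t) \<le> I_chi f n x v"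
  using v
proof (induction n arbitrary: x v)
  case 0
  have "inv2 (mat 1) = mat 1" by (rule inv2_unique) auto
  then have "I_chi f 0 x v = ln (norm v)"
    by (simp add: I_chi_jac[OF C1_regular_f] C1_regular_id[unfolded id_def] id_def vimage_def)
  then show ?case using t by simp
next
  case (Suc n)
  define L where "L = ln t"
  have L: "L \<ge> 0" using t by (simp add: L_def)
  define good where "good v \<longleftrightarrow> \<eta> * norm v \<le> \<bar>ell (inv2 A *v v)\<bar>" for v
  define w where "w y = inv2 (torus_jac f y) *v v" for y
  obtain q where q0: "\<forall>c. \<bar>c\<bar> \<le> 1 \<longrightarrow> shear_bound (inv2 A) ell u ((sin (pi / \<tau>))\<^sup>2 / 2) \<eta> \<epsilon> t v q c"
    using step Suc.prems by blast
  have q: "((sin (pi / \<tau>))\<^sup>2 / 2 \<le> \<bar>cos_at y - q\<bar> \<longrightarrow> good (w y) \<and>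
      \<epsilon> * norm v * (if good v then t else 1) \<le> norm (w y)) \<and>
      \<epsilon> * norm v / (if good v then 1 else t) \<le> norm (w y)" for y
  proof -
    have "\<bar>cos_at y\<bar> \<le> 1" by (simp add: cos_at_def)
    then have "shear_bound (inv2 A) ell u ((sin (pi / \<tau>))\<^sup>2 / 2) \<eta> \<epsilon> t v q (cos_at y)"
      using q0 by blast
    then show ?thesis
      unfolding shear_bound_def Let_def good_def w_def inv2_torus_jac_f .
  qed
  define N where "N = card (f -` {x})"
  have N: "N > 0" "\<bar>real_of_int (det E)\<bar> = N" using det_E by (auto simp: N_def card_preimage)
  define Bad where "Bad = {y \<in> f -` {x}. \<bar>cos_at y - q\<bar> < (sin (pi / \<tau>))\<^sup>2 / 2}"
  have Bad: "\<tau> * card Bad \<le> 2 * N" unfolding Bad_def N_def by (rule card_level_preimage[OF \<tau> m1])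
  define X where "X = ln (norm v) + ln \<epsilon> + n * \<rho> - (if good v then 0 else L)"
  have lower: "X + (L - 2 * L * of_bool (y \<in> Bad)) \<le> I_chi f n y (w y)" if y: "y \<in> f -` {x}" for y
  proof -
    have w: "w y \<noteq> 0"
      unfolding w_def by (rule inv2_vector_nonzero[OF torus_jac_det_nonzero[OF C1_regular_f] Suc.prems])
    have IH: "ln (norm (w y)) + n * \<rho> - (if good (w y) then 0 else L) \<le> I_chi f n y (w y)"
      using Suc.IH[OF w] unfolding good_def L_def .
    have v: "norm v > 0" using Suc.prems by simp
    show ?thesis
    proof (cases "y \<in> Bad")
      case True
      have "ln (\<epsilon> * norm v / (if good v then 1 else t)) \<le> ln (norm (w y))"
        using q[of y] v \<epsilon> t by (intro ln_mono) auto
      then have "ln \<epsilon> + ln (norm v) - (if good v then 0 else L) \<le> ln (norm (w y))"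
        using v \<epsilon> t by (simp add: ln_div ln_mult_pos L_def split: if_splits)
      then show ?thesis using IH True L unfolding X_def by (simp split: if_splits)
    next
      case False
      then have far: "(sin (pi / \<tau>))\<^sup>2 / 2 \<le> \<bar>cos_at y - q\<bar>" using y by (auto simp: Bad_def)
      have "ln (\<epsilon> * norm v * (if good v then t else 1)) \<le> ln (norm (w y))"
        using q[of y] far v \<epsilon> t by (intro ln_mono) auto
      then have "ln \<epsilon> + ln (norm v) + (if good v then L else 0) \<le> ln (norm (w y))"
        using v \<epsilon> t by (simp add: ln_mult_pos L_def split: if_splits)
      moreover have "good (w y)" using q[of y] far by blast
      ultimately show ?thesis using IH False unfolding X_def by (simp split: if_splits)
    qed
  qed
  have fin: "finite (f -` {x})" by (rule finite_preimage)
  have "N * (X + L * (1 - 4 / \<tau>)) \<le> N * X + L * (real N - 2 * real (card Bad))"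
  proof -
    have "real \<tau> * card Bad \<le> 2 * N" using Bad by (metis of_nat_le_iff of_nat_mult of_nat_numeral)
    then have "2 * card Bad \<le> 4 * N / \<tau>" using \<tau> by (simp add: field_simps)
    then have "L * (real N - 4 * N / \<tau>) \<le> L * (real N - 2 * real (card Bad))" using L by (intro mult_left_mono) auto
    then show ?thesis by (simp add: algebra_simps)
  qed
  also have "\<dots> = (\<Sum>y\<in>f -` {x}. X + (L - 2 * L * of_bool (y \<in> Bad)))"
  proof -
    have "(\<Sum>y\<in>f -` {x}. of_bool (y \<in> Bad) :: real) = card Bad"
      using fin by (simp add: Bad_def Int_def)
    then show ?thesis
      by (simp add: sum.distrib sum_subtractf sum_distrib_left[symmetric] N_def algebra_simps)
  qed
  also have "\<dots> \<le> (\<Sum>y\<in>f -` {x}. I_chi f n y (w y))" by (intro sum_mono lower)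
  also have "\<dots> = N * I_chi f (Suc n) x v"
    unfolding I_chi_Suc[OF C1_regular_f] det_torus_jac_f N(2) w_def
    using N(1) by (simp add: sum_divide_distrib[symmetric])
  finally have "X + L * (1 - 4 / \<tau>) \<le> I_chi f (Suc n) x v"
    using N(1) by simp
  moreover have "ln (norm v) + Suc n * \<rho> - (if good v then 0 else ln t) = X + L * (1 - 4 / \<tau>)"
    by (simp add: X_def \<rho>_def L_def algebra_simps add_divide_distrib)
  ultimately show ?case unfolding good_def by simp
qed

end

section \<open>Choice of the parameters for a given matrix\<close>

lemma Gcd_entries:
  fixes E :: "int^2^2"
  shows "Gcd (range (\<lambda>(i, j). E $ i $ j)) = gcd (gcd (E$1$1) (E$1$2)) (gcd (E$2$1) (E$2$2))"
proof -
  have "range (\<lambda>(i, j). E $ i $ j) = {E$1$1, E$1$2, E$2$1, E$2$2}"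
    unfolding UNIV_Times_UNIV[symmetric] UNIV_2 by auto
  then show ?thesis by (simp add: gcd.assoc)
qed

lemma homothety_iff:
  fixes E :: "int^2^2"
  shows "homothety E \<longleftrightarrow> E$1$2 = 0 \<and> E$2$1 = 0 \<and> E$1$1 = E$2$2"
  unfolding homothety_def by (auto simp: mat_def vec_eq_iff forall_2)

theorem exists_in_homotopy_class:
  fixes E :: "int^2^2"
  assumes "\<not> homothety E"
    and gt4: "real_of_int \<bar>det E\<bar> / real_of_int (Gcd (range (\<lambda>(i, j). E $ i $ j))) > 4"
  shows "\<exists>f \<in> C1_homotopy_class E \<inter> U_chi. torus_homotopic real_analytic_on f (toral_end E)"
proof -
  define a b c d where "a = E$1$1" and "b = E$1$2" and "c = E$2$1" and "d = E$2$2"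
  define g where "g = gcd (gcd a b) (gcd c d)"
  have g_eq: "Gcd (range (\<lambda>(i, j). E $ i $ j)) = g" by (simp add: Gcd_entries g_def a_def b_def c_def d_def)
  have detE: "det E = a * d - b * c" by (simp add: det_2 a_def b_def c_def d_def)
  have D: "det E \<noteq> 0" using gt4 by auto
  then have g0: "g > 0" by (auto simp: g_def detE)
  have "g dvd a" "g dvd b" unfolding g_def by (meson dvd_trans gcd_dvd1 gcd_dvd2)+
  then have "g dvd \<bar>det E\<bar>" by (simp add: detE)
  then obtain r where r: "\<bar>det E\<bar> = g * r" by (auto simp: dvd_def)
  \<comment> \<open>The quotient of \<open>\<bar>det E\<bar>\<close> by \<open>g\<close>, an integer
    because \<open>g\<close> divides the first row.\<close>
  define \<tau> where "\<tau> = nat r"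
  have "r > 0" using r D g0 by (metis abs_le_zero_iff linorder_not_le mult_le_0_iff not_less_iff_gr_or_eq)
  then have r\<tau>: "real_of_int r = real \<tau>" by (simp add: \<tau>_def)
  have \<tau>: "real \<tau> > 4" using gt4 g0 unfolding g_eq r by (simp add: r\<tau>)
  obtain k m n where k: "(d - k * c) * m + (k * a - b) * n = g" "c * k * k + (a - d) * k - b \<noteq> 0"
    using exists_shear_direction[of a d b c] D assms(1)
    unfolding detE homothety_iff g_def a_def[symmetric] b_def[symmetric] c_def[symmetric] d_def[symmetric] by auto
  define B where "B = inv2 (map_matrix real_of_int E)"
  have detA: "det (map_matrix real_of_int E) = of_int (det E)" by (simp add: det_2)
  have B_eq: "B *v x = vector [(d * x$1 - b * x$2) / of_int (det E), (a * x$2 - c * x$1) / of_int (det E)]" for x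
    by (simp add: B_def inv2_def detA matrix_vector_mult_def vec_eq_iff forall_2 sum_2
        a_def b_def c_def d_def diff_divide_distrib)
  have detB: "det B \<noteq> 0"
  proof -
    have "det (map_matrix real_of_int E) * det B = 1"
      unfolding det_mul[symmetric] B_def using inv2(2)[of "map_matrix real_of_int E"] D detA by simp
    then show ?thesis by auto
  qed
  define lin where "lin x = x$1 + real_of_int k * x$2" for x :: "real^2"
  define dir :: "real^2" where "dir = vector [- real_of_int k, 1]"
  have "lin (B *v dir) = of_int (c * k * k + (a - d) * k - b) / of_int (det E)"
    by (simp add: lin_def B_eq dir_def add_divide_distrib diff_divide_distrib algebra_simps)
  then have transversal: "lin (B *v dir) \<noteq> 0" using k(2) D by (simp del: of_int_add of_int_diff of_int_mult)
  \<comment> \<open>By the Bezout identity the row \<open>lin\<close> times the adjugate takes the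
    value \<open>g\<close> on \<open>(m, n)\<close>; the sign of the determinant makes the quotient
    \<open>+ 1 / \<tau>\<close>.\<close>
  define m1 :: "real^2" where "m1 = of_int (sgn (det E)) *\<^sub>R vector [of_int m, of_int n]"
  have m1: "m1 \<in> int_vecs" by (auto simp: m1_def int_vecs_def forall_2)
  have lin_m1: "lin (B *v m1) = 1 / \<tau>"
  proof -
    have "lin (B *v m1) = of_int (sgn (det E) * ((d - k * c) * m + (k * a - b) * n)) / of_int (det E)"
      by (simp add: lin_def B_eq m1_def add_divide_distrib diff_divide_distrib algebra_simps)
    also have "\<dots> = of_int (sgn (det E) * g) / of_int (det E)" unfolding k(1) ..
    also have "\<dots> = of_int g / of_int \<bar>det E\<bar>" using D by (simp add: sgn_if abs_if)
    also have "\<dots> = 1 / \<tau>" unfolding r using g0 by (simp add: r\<tau>)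
    finally show ?thesis .
  qed
  define \<kappa> where "\<kappa> = (sin (pi / \<tau>))\<^sup>2 / 2"
  have "sin (pi / \<tau>) > 0" using \<tau> by (intro sin_gt_zero) (auto simp: divide_less_eq)
  moreover have "(sin (pi / \<tau>))\<^sup>2 \<le> 1" by (simp add: abs_square_le_1)
  ultimately have \<kappa>: "0 < \<kappa>" "\<kappa> \<le> 1" by (auto simp: \<kappa>_def)
  obtain \<eta> \<epsilon> t0 where \<epsilon>: "0 < \<epsilon>" and t0: "1 \<le> t0"
    and growth: "\<forall>t\<ge>t0. \<forall>v. v \<noteq> 0 \<longrightarrow> (\<exists>q. \<forall>c. \<bar>c\<bar> \<le> 1 \<longrightarrow> shear_bound B lin dir \<kappa> \<eta> \<epsilon> t v q c)"
    using shear_growth[OF lin_def dir_def detB transversal \<kappa>] by (elim exE conjE)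
  define p where "p = 1 - 4 / real \<tau>"
  have p: "p > 0" using \<tau> by (simp add: p_def)
  \<comment> \<open>Solves \<open>p * ln t + ln \<epsilon> \<ge> 1\<close>, which is possible
    because \<open>\<tau> > 4\<close> makes \<open>p\<close> positive.\<close>
  define t where "t = max t0 (exp ((1 - ln \<epsilon>) / p))"
  have t: "t0 \<le> t" "1 \<le> t" using t0 by (auto simp: t_def)
  define \<rho> where "\<rho> = p * ln t + ln \<epsilon>"
  have "\<rho> \<ge> 1"
  proof -
    have "exp ((1 - ln \<epsilon>) / p) \<le> t" by (simp add: t_def)
    then have "(1 - ln \<epsilon>) / p \<le> ln t" using t(2) by (simp add: ln_ge_iff)
    then have "1 - ln \<epsilon> \<le> p * ln t" using p by (simp add: divide_le_eq mult.commute)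
    then show ?thesis by (simp add: \<rho>_def)
  qed
  interpret sheared_endo E k t by unfold_locales (rule D)
  have eqs: "inv2 A = B" "sheared_endo.ell k = lin" "sheared_endo.u k = dir"
    by (simp_all add: A_def B_def ell_def lin_def u_def dir_def fun_eq_iff)
  have I: "n * \<rho> - ln t \<le> I_chi f n x v" if v: "norm v = 1" for n x v
  proof -
    have v0: "v \<noteq> 0" using v by auto
    have "ln (norm v) + n * \<rho> - (if \<eta> * norm v \<le> \<bar>lin (B *v v)\<bar> then 0 else ln t) \<le> I_chi f n x v"
      unfolding \<rho>_def p_def eqs[symmetric]
    proof (rule I_chi_lower[OF _ m1])
      show "2 \<le> \<tau>" using \<tau> by linarith
    qed (use lin_m1 t(2) \<epsilon> v0 growth t(1) in \<open>auto simp: eqs \<kappa>_def\<close>)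
    moreover have "0 \<le> ln t" using t(2) by simp
    ultimately show ?thesis using v by (simp split: if_splits)
  qed
  \<comment> \<open>Long enough for the gain \<open>n * \<rho> \<ge> n\<close> to exceed a possible
    initial debt \<open>ln t\<close> by 1.\<close>
  define n where "n = nat \<lceil>ln t\<rceil> + 1"
  have n: "real n \<ge> 1" "real n \<ge> ln t + 1" by (auto simp: n_def) linarith+
  have I1: "1 \<le> I_chi f n x v" if "norm v = 1" for x v
  proof -
    have "real n * 1 \<le> real n * \<rho>" using \<open>\<rho> \<ge> 1\<close> by (intro mult_left_mono) auto
    then show ?thesis using I[OF that, of n x] n(2) by linarith
  qed
  have "0 < ereal (1 / real n) * 1" using n(1) by simp
  also have "\<dots> \<le> ereal (1 / real n) * (INF (x, v)\<in>UNIV \<times> sphere 0 1. ereal (I_chi f n x v))"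
    using n(1) I1 by (intro ereal_mult_left_mono INF_greatest) auto
  also have "\<dots> \<le> C_chi f"
    unfolding C_chi_def using n(1) by (intro SUP_upper) auto
  finally have "C_chi f > 0" .
  moreover have "\<bar>det E\<bar> \<noteq> 1"
  proof
    assume "\<bar>det E\<bar> = 1"
    then have "g * r = 1" using r by simp
    then have "r = 1" using g0 by (metis pos_zmult_eq_1_iff)
    then show False using \<tau> r\<tau> by simp
  qed
  ultimately have "f \<in> U_chi" using f_End1 by (simp add: U_chi_def)
  then show ?thesis using f_homotopic_C1 f_homotopic_analytic by blast
qed

theorem theoremA:
  shows "(\<forall>f\<in>U_chi. nonuniformly_hyperbolic f) \<and>
    (\<forall>E :: int^2^2. \<not> homothety E \<longrightarrow>
       real_of_int \<bar>det E\<bar> / real_of_int (Gcd (range (\<lambda>(i, j). E $ i $ j))) > 4 \<longrightarrow>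
       C1_homotopy_class E \<inter> U_chi \<noteq> {} \<and>
       (\<exists>f \<in> C1_homotopy_class E \<inter> U_chi. torus_homotopic real_analytic_on f (toral_end E)))"
proof (intro conjI ballI allI impI)
  show "nonuniformly_hyperbolic f" if "f \<in> U_chi" for f
    using that by (rule U_chi_nonuniformly_hyperbolic)
next
  fix E :: "int^2^2"
  assume "\<not> homothety E" "real_of_int \<bar>det E\<bar> / real_of_int (Gcd (range (\<lambda>(i, j). E $ i $ j))) > 4"
  then show *: "\<exists>f \<in> C1_homotopy_class E \<inter> U_chi. torus_homotopic real_analytic_on f (toral_end E)"
    by (rule exists_in_homotopy_class)
  then show "C1_homotopy_class E \<inter> U_chi \<noteq> {}" by blast
qed

end
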